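(* For any positive integers $n$, $k\ge 2$ and any even positive integer $p$ with $p\le k\le n$, there is a Karp reduction from $(0,1)$-$\mathrm{CVP}_p$ on lattices of rank $n$ to minimum-weight-$k$-Clique on $p$-uniform hypergraphs on $N=k\cdot 2^{\lceil n/k\rceil}$ vertices. Furthermore, the reduction takes only $O(\mathrm{poly}(n,m)\cdot(k^2\cdot 2^{n/k})^p)$ time and space.
   Context: $\|\vec v\|_p=(\sum_i|v[i]|^p)^{1/p}$. $(0,1)$-$\mathrm{CVP}_p$: given a basis $\mathbf{B}\in\mathbb{Z}^{m\times n}$ (linearly independent columns; $n$ is the rank), a target $\vec t\in\mathbb{Z}^m$ and $d>0$, distinguish YES instances (some $\vec z\in\{0,1\}^n$ has $\|\mathbf{B}\vec z-\vec t\|_p\le d$) from NO instances ($\|\mathbf{B}\vec z-\vec t\|_p>d$ for all $\vec z\in\{0,1\}^n$). A $p$-uniform hypergraph has hyperedges each consisting of exactly $p$ vertices; a $k$-clique is a set of $k$ vertices all of whose $\binom{k}{p}$ $p$-subsets are hyperedges, and its total weight is the sum of the weights of these hyperedges. Minimum-weight-$k$-Clique: given a $p$-uniform hypergraph, a hyperedge weight function $w$, and a number $d$, distinguish YES instances (some $k$-clique has total weight at most $d$) from NO instances (every $k$-clique has total weight greater than $d$). A Karp reduction maps instances to instances, YES to YES and NO to NO. *)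

theory Defs
  imports
    Complex_Main
    "HOL-Library.Log_Nat"
    "Jordan_Normal_Form.VS_Connect"
begin

section \<open>Promise problems and Karp reductions\<close>

text \<open>A problem is the pair of its YES instances and its NO instances.\<close>

type_synonym 'a problem = "'a set \<times> 'a set"

definition yes_instances :: "'a problem \<Rightarrow> 'a set" where
  "yes_instances = fst"

definition no_instances :: "'a problem \<Rightarrow> 'a set" where
  "no_instances = snd"

definition instances :: "'a problem \<Rightarrow> 'a set" where
  "instances Q = yes_instances Q \<union> no_instances Q"

definition karp_reduction :: "('a \<Rightarrow> 'b) \<Rightarrow> 'a problem \<Rightarrow> 'b problem \<Rightarrow> bool" where
  "karp_reduction f Q Q' \<longleftrightarrow>
     (\<forall>I \<in> yes_instances Q. f I \<in> yes_instances Q') \<and>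
     (\<forall>I \<in> no_instances Q. f I \<in> no_instances Q')"


section \<open>The \<open>(0,1)\<close>-closest vector problem in the \<open>p\<close>-norm\<close>

definition lp_norm :: "nat \<Rightarrow> real vec \<Rightarrow> real" where
  "lp_norm p v = root p (\<Sum>i<dim_vec v. \<bar>v $ i\<bar> ^ p)"

definition lin_indpt_cols :: "real mat \<Rightarrow> bool" where
  "lin_indpt_cols A \<longleftrightarrow> distinct (cols A) \<and>
     LinearCombinations.module.lin_indpt class_ring (module_vec TYPE(real) (dim_row A)) (set (cols A))"

record cvp_instance =
  basis :: "int mat"
  target :: "int vec"
  dist_bound :: rat

definition cvp_instances :: "nat \<Rightarrow> cvp_instance set" where
  "cvp_instances n = {I.
     dim_col (basis I) = n \<and>
     lin_indpt_cols (map_mat real_of_int (basis I)) \<and>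
     dim_vec (target I) = dim_row (basis I) \<and>
     dist_bound I > 0}"

definition binary_vecs :: "nat \<Rightarrow> int vec set" where
  "binary_vecs n = {z \<in> carrier_vec n. \<forall>j<n. z $ j \<in> {0, 1}}"

definition cvp_dist :: "nat \<Rightarrow> cvp_instance \<Rightarrow> int vec \<Rightarrow> real" where
  "cvp_dist p I z = lp_norm p (map_vec real_of_int (basis I *\<^sub>v z - target I))"

definition CVP01 :: "nat \<Rightarrow> nat \<Rightarrow> cvp_instance problem" where
  "CVP01 p n =
    ({I \<in> cvp_instances n. \<exists>z \<in> binary_vecs n. cvp_dist p I z \<le> of_rat (dist_bound I)},
     {I \<in> cvp_instances n. \<forall>z \<in> binary_vecs n. cvp_dist p I z > of_rat (dist_bound I)})"


section \<open>Minimum-weight \<open>k\<close>-clique on \<open>p\<close>-uniform hypergraphs\<close>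

text \<open>The vertex set is \<open>{..<num_verts H}\<close>. The values of \<open>weight H\<close> outside \<open>hyperedges H\<close>
  are irrelevant.\<close>

record whypergraph =
  num_verts :: nat
  hyperedges :: "nat set set"
  weight :: "nat set \<Rightarrow> rat"

definition p_uniform :: "nat \<Rightarrow> whypergraph \<Rightarrow> bool" where
  "p_uniform p H \<longleftrightarrow> (\<forall>e \<in> hyperedges H. e \<subseteq> {..<num_verts H} \<and> card e = p)"

definition p_subsets :: "nat \<Rightarrow> 'a set \<Rightarrow> 'a set set" where
  "p_subsets p K = {e. e \<subseteq> K \<and> card e = p}"

definition is_clique :: "nat \<Rightarrow> nat \<Rightarrow> whypergraph \<Rightarrow> nat set \<Rightarrow> bool" where
  "is_clique p k H K \<longleftrightarrow>
     K \<subseteq> {..<num_verts H} \<and> card K = k \<and> p_subsets p K \<subseteq> hyperedges H"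

definition clique_weight :: "nat \<Rightarrow> whypergraph \<Rightarrow> nat set \<Rightarrow> rat" where
  "clique_weight p H K = (\<Sum>e \<in> p_subsets p K. weight H e)"

record clique_instance =
  hypergraph :: whypergraph
  weight_bound :: rat

definition clique_instances :: "nat \<Rightarrow> nat \<Rightarrow> clique_instance set" where
  "clique_instances p N = {J. p_uniform p (hypergraph J) \<and> num_verts (hypergraph J) = N}"

definition min_weight_clique :: "nat \<Rightarrow> nat \<Rightarrow> nat \<Rightarrow> clique_instance problem" where
  "min_weight_clique k p N =
    ({J \<in> clique_instances p N.
        \<exists>K. is_clique p k (hypergraph J) K \<and> clique_weight p (hypergraph J) K \<le> weight_bound J},
     {J \<in> clique_instances p N.
        \<forall>K. is_clique p k (hypergraph J) K \<longrightarrow> clique_weight p (hypergraph J) K > weight_bound J})"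


section \<open>Random access machines\<close>

text \<open>
  The model of computation is a random access machine over the integers with structured control
  flow. A program uses finitely many registers, a random access memory (indexed by integers, which
  spares a convention for negative addresses) and a write-only output tape. Each assignment,
  memory access, output operation and test takes one step.

  The components \<open>steps\<close>, \<open>cells\<close> and \<open>width\<close> cannot be read by programs. They record the number of
  steps, the set of memory addresses that were accessed, and the largest bit length of a value
  that was ever put into a register. Every integer that the machine computes, and every
  address, passes through a register; a bound on \<open>width\<close> therefore rules out the well-known abuse of
  unit-cost arithmetic on very long integers.
\<close>

datatype arith_op = Plus | Minus | Times | Divide

text \<open>Division rounds down; division by \<open>0\<close> yields \<open>0\<close>.\<close>

fun arith :: "arith_op \<Rightarrow> int \<Rightarrow> int \<Rightarrow> int" where
  "arith Plus x y = x + y"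
| "arith Minus x y = x - y"
| "arith Times x y = x * y"
| "arith Divide x y = x div y"

type_synonym reg = nat

datatype com =
    Const reg int
  | Arith reg arith_op reg reg
  | Load reg reg
  | Store reg reg
  | Emit reg
  | Seq com com
  | IfPos reg com com
  | WhilePos reg com

record ram_state =
  regs :: "reg \<Rightarrow> int"
  mem :: "int \<Rightarrow> int"
  out_tape :: "int list"
  steps :: nat
  cells :: "int set"
  width :: nat

definition bit_length :: "int \<Rightarrow> nat" where
  "bit_length x = floorlog 2 (nat \<bar>x\<bar>)"

definition tick :: "ram_state \<Rightarrow> ram_state" where
  "tick s = s\<lparr>steps := steps s + 1\<rparr>"

definition set_reg :: "reg \<Rightarrow> int \<Rightarrow> ram_state \<Rightarrow> ram_state" where
  "set_reg r x s = s\<lparr>regs := (regs s)(r := x), width := max (width s) (bit_length x)\<rparr>"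

definition touch :: "int \<Rightarrow> ram_state \<Rightarrow> ram_state" where
  "touch a s = s\<lparr>cells := insert a (cells s)\<rparr>"

inductive big_step :: "com \<Rightarrow> ram_state \<Rightarrow> ram_state \<Rightarrow> bool" where
  Const: "big_step (Const r x) s (set_reg r x (tick s))"
| Arith: "big_step (Arith r f r1 r2) s (set_reg r (arith f (regs s r1) (regs s r2)) (tick s))"
| Load: "big_step (Load r ra) s (set_reg r (mem s (regs s ra)) (touch (regs s ra) (tick s)))"
| Store: "big_step (Store ra r) s
    ((touch (regs s ra) (tick s))\<lparr>mem := (mem s)(regs s ra := regs s r)\<rparr>)"
| Emit: "big_step (Emit r) s ((tick s)\<lparr>out_tape := out_tape s @ [regs s r]\<rparr>)"
| Seq: "big_step c1 s s' \<Longrightarrow> big_step c2 s' s'' \<Longrightarrow> big_step (Seq c1 c2) s s''"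
| IfPos_True: "regs s r > 0 \<Longrightarrow> big_step c1 (tick s) s' \<Longrightarrow> big_step (IfPos r c1 c2) s s'"
| IfPos_False: "\<not> regs s r > 0 \<Longrightarrow> big_step c2 (tick s) s' \<Longrightarrow> big_step (IfPos r c1 c2) s s'"
| WhilePos_True: "regs s r > 0 \<Longrightarrow> big_step c (tick s) s' \<Longrightarrow> big_step (WhilePos r c) s' s'' \<Longrightarrow>
    big_step (WhilePos r c) s s''"
| WhilePos_False: "\<not> regs s r > 0 \<Longrightarrow> big_step (WhilePos r c) s (tick s)"

inductive_cases Const_cases: "big_step (Const r x) s t"
inductive_cases Arith_cases: "big_step (Arith r f r1 r2) s t"
inductive_cases Load_cases: "big_step (Load r ra) s t"
inductive_cases Store_cases: "big_step (Store ra r) s t"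
inductive_cases Emit_cases: "big_step (Emit r) s t"
inductive_cases Seq_cases: "big_step (Seq c1 c2) s t"
inductive_cases IfPos_cases: "big_step (IfPos r c1 c2) s t"
inductive_cases WhilePos_cases: "big_step (WhilePos r c) s t"

lemma big_step_deterministic:
  "big_step c s t \<Longrightarrow> big_step c s t' \<Longrightarrow> t' = t"
proof (induction arbitrary: t' rule: big_step.induct)
  case (Const r x s)
  then show ?case by (rule Const_cases)
next
  case (Arith r f r1 r2 s)
  then show ?case by (rule Arith_cases)
next
  case (Load r ra s)
  then show ?case by (rule Load_cases)
next
  case (Store ra r s)
  then show ?case by (rule Store_cases)
next
  case (Emit r s)
  then show ?case by (rule Emit_cases)
next
  case (Seq c1 s s' c2 s'')
  from Seq.prems show ?case
  proof (rule Seq_cases)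
    fix u assume "big_step c1 s u" "big_step c2 u t'"
    then show ?thesis using Seq.IH by blast
  qed
next
  case (IfPos_True s r c1 s' c2)
  from IfPos_True.prems show ?case
    by (rule IfPos_cases) (use IfPos_True.hyps IfPos_True.IH in blast)+
next
  case (IfPos_False s r c2 s' c1)
  from IfPos_False.prems show ?case
    by (rule IfPos_cases) (use IfPos_False.hyps IfPos_False.IH in blast)+
next
  case (WhilePos_True s r c s' s'')
  from WhilePos_True.prems show ?case
  proof (rule WhilePos_cases)
    fix u assume "big_step c (tick s) u" "big_step (WhilePos r c) u t'"
    then show ?thesis using WhilePos_True.IH by blast
  next
    assume "\<not> regs s r > 0"
    then show ?thesis using WhilePos_True.hyps by blast
  qed
next
  case (WhilePos_False s r c)
  from WhilePos_False.prems show ?case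
    by (rule WhilePos_cases) (use WhilePos_False.hyps in blast)+
qed

text \<open>The input occupies the memory cells \<open>0, 1, 2, \<dots>\<close>; everything else is zero.\<close>

definition init_state :: "int list \<Rightarrow> ram_state" where
  "init_state xs = \<lparr>regs = (\<lambda>_. 0),
     mem = (\<lambda>a. if 0 \<le> a \<and> a < int (length xs) then xs ! nat a else 0),
     out_tape = [], steps = 0, cells = {}, width = 0\<rparr>"

text \<open>The registers contribute only a constant that depends on the program alone.\<close>

definition space_used :: "ram_state \<Rightarrow> nat" where
  "space_used s = card (cells s) + length (out_tape s)"

text \<open>\<open>halts_within P xs T S W ys\<close>: on input \<open>xs\<close>, the program \<open>P\<close> halts with output \<open>ys\<close> after at
  most \<open>T\<close> steps, in space at most \<open>S\<close>, and on integers of at most \<open>W\<close> bits.\<close>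

definition halts_within :: "com \<Rightarrow> int list \<Rightarrow> real \<Rightarrow> real \<Rightarrow> real \<Rightarrow> int list \<Rightarrow> bool" where
  "halts_within P xs T S W ys \<longleftrightarrow> (\<exists>s. big_step P (init_state xs) s \<and> out_tape s = ys \<and>
     real (steps s) \<le> T \<and> real (space_used s) \<le> S \<and> real (width s) \<le> W)"


section \<open>Encodings of instances\<close>

text \<open>Rationals are encoded in lowest terms, with positive denominator.\<close>

definition encode_rat :: "rat \<Rightarrow> int list" where
  "encode_rat q = [fst (quotient_of q), snd (quotient_of q)]"

text \<open>The rows of the basis are listed one after the other. The parameters \<open>k\<close> and \<open>p\<close> are part of the
  input.\<close>

definition encode_cvp :: "nat \<Rightarrow> nat \<Rightarrow> cvp_instance \<Rightarrow> int list" where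
  "encode_cvp k p I =
     [int k, int p, int (dim_row (basis I)), int (dim_col (basis I))] @
     concat (map list_of_vec (rows (basis I))) @ list_of_vec (target I) @
     encode_rat (dist_bound I)"

definition max_bit_length :: "int list \<Rightarrow> nat" where
  "max_bit_length xs = Max (bit_length ` set xs)"

text \<open>A weighted hypergraph is given by the list of its hyperedges, each once and in any order, where
  a hyperedge is given by its vertices in increasing order, followed by its weight.\<close>

definition encodes_clique :: "nat \<Rightarrow> nat \<Rightarrow> clique_instance \<Rightarrow> int list \<Rightarrow> bool" where
  "encodes_clique k p J ys \<longleftrightarrow> (\<exists>es. distinct es \<and> set es = hyperedges (hypergraph J) \<and>
     ys = [int k, int p, int (num_verts (hypergraph J))] @ encode_rat (weight_bound J) @
       concat (map (\<lambda>e. map int (sorted_list_of_set e) @ encode_rat (weight (hypergraph J) e)) es))"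

end

(*
  Split the columns into k blocks; a vertex is a block together with a 0/1-assignment to its columns,
  and hyperedges are the p-sets of vertices from distinct blocks. Since p >= 2, the k-cliques are
  then exactly the 0/1-vectors z. As p is even, the p-th power of |Bz - t| is the sum over the rows of
  (y_1 + ... + y_k)^p, where y_i depends on the vertex chosen in block i only. Expanding the power
  gives a sum over words of length p over the blocks. Each word is charged to a single p-set of blocks
  that contains its support, namely the one obtained by adding the smallest missing blocks; so all
  weights are integers and the bound is d^p. The words charged to a given p-set are those whose
  support contains a certain part T of it, and inclusion-exclusion over the subsets of T evaluates
  their sum with 2^p powers instead of p^p products. Trying all N^p tuples of vertices therefore takes
  time poly * (2 N)^p, which is within the required bound.
*)
theory Submission
  imports Defs
begin

section \<open>Expanding the power of a sum\<close>

text \<open>The constants of the time bound are chosen before \<open>n\<close>, \<open>k\<close> and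
  \<open>p\<close>, so no factor exponential in \<open>p\<close> can hide in the polynomial.
  Compared with the required \<open>(k^2 * 2 powr (n/k)) ^ p\<close>, the tuples alone leave a
  factor \<open>k^p\<close>, of which rounding \<open>n/k\<close> up can already take almost
  \<open>2^p\<close>. Summing \<open>p^p\<close> products per tuple would use up all of
  \<open>k^p\<close> when \<open>p = k\<close>, whereas the \<open>2^p\<close> masks of
  inclusion-exclusion still fit. A word whose support has fewer than \<open>p\<close> blocks lies in
  several p-sets. Charging it to one of them instead of sharing it out evenly keeps the weights
  integral, so that no weight has to be reduced to lowest terms. Choosing the smallest missing
  blocks makes membership in \<open>T\<close> cheap to test: it compares the block number of a
  vertex with its position in the sorted tuple. Arithmetic has unit cost on the machine, so a bound
  on the length of all intermediate integers is carried along with the time.\<close>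

lemma sum_mult_lessThan:
  fixes f :: "nat \<Rightarrow> 'a :: comm_monoid_add"
  shows "(\<Sum>r<a * b. f r) = (\<Sum>l<a. \<Sum>u<b. f (l * b + u))"
proof -
  have "(\<Sum>u<b. f (l * b + u)) = sum f {l * b..<l * b + b}" for l
    using sum.shift_bounds_nat_ivl[of f 0 "l * b" b] by (simp add: lessThan_atLeast0 add.commute)
  then show ?thesis by (simp add: sum.nat_group)
qed

definition bit_of :: "nat \<Rightarrow> nat \<Rightarrow> nat" where
  "bit_of u j = u div 2 ^ j mod 2"

lemma bit_of_cases: "bit_of u j = 0 \<or> bit_of u j = 1"
  unfolding bit_of_def by auto

lemma bit_of_add_high:
  assumes "j < p"
  shows "bit_of (l * 2 ^ p + u) j = bit_of u j"
proof -
  have "(2 :: nat) ^ p = 2 ^ (j + (p - Suc j) + 1)" using assms by simp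
  then have "(2 :: nat) ^ p = 2 ^ j * 2 ^ (p - Suc j) * 2"
    by (simp only: power_add power_one_right)
  then have "l * 2 ^ p = 2 ^ j * (l * 2 ^ (p - Suc j) * 2)" by simp
  then have "(l * 2 ^ p + u) div 2 ^ j = l * 2 ^ (p - Suc j) * 2 + u div 2 ^ j"
    by (simp only:) simp
  then show ?thesis by (simp add: bit_of_def)
qed

text \<open>The bits of \<open>u\<close> record which summand is picked from each factor when the
  product on the right is multiplied out. The induction splits off the top bit.\<close>

lemma sum_prod_bits:
  fixes g :: "nat \<Rightarrow> nat \<Rightarrow> 'a :: comm_semiring_1"
  shows "(\<Sum>u<2 ^ p. \<Prod>j<p. g j (u div 2 ^ j mod 2)) = (\<Prod>j<p. g j 0 + g j 1)"
proof (induction p)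
  case (Suc p)
  have hi: "(l * 2 ^ p + u) div 2 ^ p mod 2 = l" if "u < 2 ^ p" "l < 2" for l u :: nat
    using that by simp
  have lo: "(l * 2 ^ p + u) div 2 ^ j mod 2 = u div 2 ^ j mod 2" if "j < p" for l u j :: nat
    using bit_of_add_high[OF that, of l u] by (simp only: bit_of_def)
  have "(\<Sum>u<2 ^ Suc p. \<Prod>j<Suc p. g j (u div 2 ^ j mod 2)) =
    (\<Sum>l<2. \<Sum>u<2 ^ p. \<Prod>j<Suc p. g j ((l * 2 ^ p + u) div 2 ^ j mod 2))"
    unfolding power_Suc by (rule sum_mult_lessThan)
  also have "\<dots> = (\<Sum>l<2. \<Sum>u<2 ^ p. (\<Prod>j<p. g j (u div 2 ^ j mod 2)) * g p l)"
    unfolding prod.lessThan_Suc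
    by (intro sum.cong refl arg_cong2[of _ _ _ _ "(*)"] prod.cong) (simp_all only: lessThan_iff hi lo)
  also have "\<dots> = (\<Prod>j<p. g j 0 + g j 1) * (g p 0 + g p 1)"
  proof -
    have "{..<2 :: nat} = {0, 1}" by auto
    then show ?thesis by (simp add: Suc.IH distrib_left flip: sum_distrib_right)
  qed
  finally show ?case by simp
qed simp

section \<open>Words and the block sets to which they are charged\<close>

lemma power_sum_PiE:
  fixes z :: "'b \<Rightarrow> 'a :: comm_semiring_1"
  assumes "finite A"
  shows "(\<Sum>a\<in>A. z a) ^ p = (\<Sum>w\<in>{..<p} \<rightarrow>\<^sub>E A. \<Prod>i<p. z (w i))"
  using prod_sum_PiE[of "{..<p}" "\<lambda>_. A" "\<lambda>_. z"] assms by simp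

text \<open>For fixed \<open>S\<close> there is exactly one such \<open>E\<close>: \<open>S\<close> together with the smallest elements outside
  \<open>S\<close>. The elements of \<open>E\<close> that must lie in \<open>S\<close> can be read off from \<open>E\<close> alone: those with a gap
  of \<open>E\<close> below them.\<close>

definition canonical :: "nat \<Rightarrow> nat \<Rightarrow> nat set \<Rightarrow> nat set \<Rightarrow> bool" where
  "canonical p k S E \<longleftrightarrow> S \<subseteq> E \<and> E \<in> p_subsets p {..<k} \<and> (\<forall>e\<in>E - S. {..<e} \<subseteq> E)"

text \<open>For uniqueness, two different candidates of equal size have elements \<open>a\<close>
  and \<open>b\<close> outside each other. Both lie outside \<open>S\<close>, so each candidate
  contains everything below its own element, and the smaller of \<open>a\<close> and
  \<open>b\<close> would lie in both.\<close>

lemma canonical_unique: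
  assumes "S \<subseteq> {..<k}" "card S \<le> p" "p \<le> k"
  shows "\<exists>!E. canonical p k S E"
proof (rule ex_ex1I)
  have fin: "finite S" using assms finite_subset by blast
  from assms show "\<exists>E. canonical p k S E"
  proof (induction p)
    case 0
    then have "S = {}" using fin by simp
    then show ?case by (auto simp: canonical_def p_subsets_def)
  next
    case (Suc p)
    show ?case
    proof (cases "card S = Suc p")
      case True
      then show ?thesis using assms(1) by (auto simp: canonical_def p_subsets_def)
    next
      case False
      then obtain E where E: "canonical p k S E" using Suc by auto
      define a where "a = (LEAST a. a \<notin> E)"
      have fE: "finite E" "card E = p" "E \<subseteq> {..<k}"
        using E finite_subset by (auto simp: canonical_def p_subsets_def)
      \<comment> \<open>Since \<open>E\<close> has only \<open>p < k\<close> elements, it misses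
        some number below \<open>k\<close>; this keeps the least missing number \<open>a\<close>
        below \<open>k\<close>.\<close>
      obtain b where b: "b < k" "b \<notin> E"
        using fE Suc.prems by (metis Suc_n_not_le_n card_lessThan lessThan_iff subsetI subset_antisym)
      have a: "a \<notin> E" "a \<le> b" unfolding a_def using b LeastI[of "\<lambda>a. a \<notin> E" b] by (auto intro: Least_le)
      have "{..<a} \<subseteq> E" unfolding a_def using not_less_Least by auto
      then have "canonical (Suc p) k S (insert a E)"
        using E a b fE unfolding canonical_def p_subsets_def by auto
      then show ?thesis ..
    qed
  qed
next
  fix E E' assume E: "canonical p k S E" and E': "canonical p k S E'"
  have fin: "finite E" "finite E'" "card E = card E'"
    using E E' finite_subset by (auto simp: canonical_def p_subsets_def)
  show "E = E'"
  proof (rule ccontr)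
    assume "E \<noteq> E'"
    then have "\<not> E \<subseteq> E'" "\<not> E' \<subseteq> E" using fin card_subset_eq by metis+
    then obtain a b where ab: "a \<in> E" "a \<notin> E'" "b \<in> E'" "b \<notin> E" by auto
    then have "{..<a} \<subseteq> E" "{..<b} \<subseteq> E'" using E E' by (auto simp: canonical_def)
    then show False using ab by (cases a b rule: linorder_cases) auto
  qed
qed

text \<open>The support of a word of length \<open>p\<close> has at most \<open>p\<close> elements,
  hence exactly one canonical \<open>E\<close>, so the inner index sets partition all words over the
  blocks. The condition on \<open>w\<close> is \<open>canonical\<close> solved for the word with
  \<open>E\<close> fixed.\<close>

lemma sum_canonical:
  fixes y :: "nat \<Rightarrow> int"
  assumes "p \<le> k"
  shows "(\<Sum>E\<in>p_subsets p {..<k}. \<Sum>w\<in>{w \<in> {..<p} \<rightarrow>\<^sub>E E. \<forall>e\<in>E. \<not> {..<e} \<subseteq> E \<longrightarrow> e \<in> w ` {..<p}}.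
           \<Prod>i<p. y (w i)) = (\<Sum>i<k. y i) ^ p"
proof -
  let ?W = "\<lambda>E. {w \<in> {..<p} \<rightarrow>\<^sub>E E. \<forall>e\<in>E. \<not> {..<e} \<subseteq> E \<longrightarrow> e \<in> w ` {..<p}}"
  have fin: "finite (p_subsets p {..<k})" unfolding p_subsets_def by simp
  have finW: "finite (?W E)" if "E \<in> p_subsets p {..<k}" for E
  proof -
    have "finite E" using that finite_subset by (auto simp: p_subsets_def)
    then have "finite ({..<p} \<rightarrow>\<^sub>E E)" by (intro finite_PiE) auto
    then show ?thesis by simp
  qed
  have W_iff: "w \<in> ?W E \<longleftrightarrow> w \<in> {..<p} \<rightarrow>\<^sub>E {..<k} \<and> canonical p k (w ` {..<p}) E"
    if "E \<in> p_subsets p {..<k}" for w E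
  proof -
    have "E \<subseteq> {..<k}" using that by (simp add: p_subsets_def)
    then have "w \<in> {..<p} \<rightarrow>\<^sub>E E \<longleftrightarrow> w \<in> {..<p} \<rightarrow>\<^sub>E {..<k} \<and> w ` {..<p} \<subseteq> E"
      unfolding PiE_iff image_subset_iff by blast
    moreover have "(\<forall>e\<in>E. \<not> {..<e} \<subseteq> E \<longrightarrow> e \<in> w ` {..<p}) \<longleftrightarrow> (\<forall>e\<in>E - w ` {..<p}. {..<e} \<subseteq> E)"
      by blast
    ultimately show ?thesis unfolding canonical_def mem_Collect_eq by (simp only: that simp_thms conj_assoc)
  qed
  have un: "(\<Union>E\<in>p_subsets p {..<k}. ?W E) = {..<p} \<rightarrow>\<^sub>E {..<k}"
  proof (intro equalityI subsetI)
    fix w assume w: "w \<in> {..<p} \<rightarrow>\<^sub>E {..<k}"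
    moreover from this have "w ` {..<p} \<subseteq> {..<k}" by auto
    moreover have "card (w ` {..<p}) \<le> p" using card_image_le[of "{..<p}" w] by simp
    ultimately obtain E where E: "canonical p k (w ` {..<p}) E"
      using canonical_unique[of "w ` {..<p}" k p] assms by blast
    then have "E \<in> p_subsets p {..<k}" by (simp add: canonical_def)
    moreover from this have "w \<in> ?W E" using W_iff[of E w] E w by blast
    ultimately show "w \<in> (\<Union>E\<in>p_subsets p {..<k}. ?W E)" by (rule UN_I)
  next
    fix w assume "w \<in> (\<Union>E\<in>p_subsets p {..<k}. ?W E)"
    then obtain E where E: "E \<in> p_subsets p {..<k}" and w: "w \<in> ?W E" by (rule UN_E)
    show "w \<in> {..<p} \<rightarrow>\<^sub>E {..<k}" by (rule W_iff[OF E, THEN iffD1, OF w, THEN conjunct1])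
  qed
  have disj: "?W E \<inter> ?W E' = {}"
    if "E \<in> p_subsets p {..<k}" "E' \<in> p_subsets p {..<k}" "E \<noteq> E'" for E E'
  proof (rule ccontr)
    assume "?W E \<inter> ?W E' \<noteq> {}"
    then obtain w where "w \<in> ?W E" "w \<in> ?W E'" by blast
    then have w: "w \<in> {..<p} \<rightarrow>\<^sub>E {..<k}" "canonical p k (w ` {..<p}) E" "canonical p k (w ` {..<p}) E'"
      using W_iff[OF that(1), of w] W_iff[OF that(2), of w] by blast+
    moreover have "w ` {..<p} \<subseteq> {..<k}" using w(1) by auto
    moreover have "card (w ` {..<p}) \<le> p" using card_image_le[of "{..<p}" w] by simp
    ultimately have "\<exists>!E. canonical p k (w ` {..<p}) E" using assms by (intro canonical_unique)
    then have "E = E'" using w(2,3) by (auto simp only: Ex1_def)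
    then show False using that(3) by contradiction
  qed
  show ?thesis
    unfolding power_sum_PiE[OF finite_lessThan] un[symmetric]
    by (rule sum.UNION_disjoint[symmetric, OF fin]; intro ballI impI; rule finW disj; assumption)
qed

text \<open>A set bit of the mask \<open>u\<close> deletes that letter. Once the power is expanded
  and the sums are swapped, the sum over \<open>u\<close> factors over the bits: letter
  \<open>j\<close> contributes 1 if it occurs in \<open>w\<close>, and otherwise
  \<open>1 - 1 = 0\<close> or \<open>1 + 0 = 1\<close> according to \<open>T j\<close>. The product
  is the indicator of the condition on \<open>w\<close>.\<close>

lemma inclusion_exclusion_words:
  fixes z :: "nat \<Rightarrow> int"
  shows "(\<Sum>u<2 ^ p. (\<Prod>j<p. if bit_of u j = 0 then 1 else if T j then - 1 else 0) *
            (\<Sum>j<p. (1 - int (bit_of u j)) * z j) ^ p) =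
         (\<Sum>w\<in>{w \<in> {..<p} \<rightarrow>\<^sub>E {..<p}. \<forall>j<p. T j \<longrightarrow> j \<in> w ` {..<p}}. \<Prod>i<p. z (w i))"
    (is "?L = _")
proof -
  define cf :: "nat \<Rightarrow> nat \<Rightarrow> int"
    where "cf j b = (if b = 0 then 1 else if T j then - 1 else 0)" for j b
  let ?P = "{..<p} \<rightarrow>\<^sub>E {..<p}"
  have fin: "finite ?P" by (intro finite_PiE) auto
  \<comment> \<open>The factors \<open>1 - bit\<close> are 0 or 1, hence idempotent, so repeated
    letters of \<open>w\<close> may be counted once.\<close>
  have pr: "(\<Prod>i<p. (1 - int (bit_of u (w i))) * z (w i)) =
      (\<Prod>j<p. if j \<in> w ` {..<p} then 1 - int (bit_of u j) else 1) * (\<Prod>i<p. z (w i))"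
    if "w \<in> ?P" for w u
  proof -
    have sub: "w ` {..<p} \<subseteq> {..<p}" using that by auto
    have "(\<Prod>i<p. 1 - int (bit_of u (w i))) = (\<Prod>j\<in>w ` {..<p}. 1 - int (bit_of u j))"
    proof (cases "\<exists>i<p. bit_of u (w i) = 1")
      case True
      then obtain i where i: "i < p" "bit_of u (w i) = 1" by blast
      have "(\<Prod>i<p. 1 - int (bit_of u (w i))) = 0"
        by (rule prod_zero) (use i in auto)
      moreover have "(\<Prod>j\<in>w ` {..<p}. 1 - int (bit_of u j)) = 0"
        by (rule prod_zero) (use i in auto)
      ultimately show ?thesis by (simp only:)
    next
      case False
      then have "bit_of u (w i) = 0" if "i < p" for i using that bit_of_cases by blast
      then show ?thesis by (auto intro!: prod.neutral simp: prod.neutral)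
    qed
    also have "\<dots> = (\<Prod>j<p. if j \<in> w ` {..<p} then 1 - int (bit_of u j) else 1)"
      using sub by (subst prod.inter_restrict[symmetric]) (auto simp: Int_absorb1)
    finally show ?thesis by (simp add: prod.distrib)
  qed
  have "?L = (\<Sum>u<2 ^ p. \<Sum>w\<in>?P. (\<Prod>j<p. cf j (bit_of u j)) *
      ((\<Prod>j<p. if j \<in> w ` {..<p} then 1 - int (bit_of u j) else 1) * (\<Prod>i<p. z (w i))))"
    unfolding power_sum_PiE[OF finite_lessThan] sum_distrib_left cf_def
    by (intro sum.cong refl) (simp only: pr)
  also have "\<dots> = (\<Sum>w\<in>?P. \<Sum>u<2 ^ p. (\<Prod>j<p. cf j (bit_of u j)) *
      ((\<Prod>j<p. if j \<in> w ` {..<p} then 1 - int (bit_of u j) else 1) * (\<Prod>i<p. z (w i))))"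
    by (rule sum.swap)
  also have "\<dots> = (\<Sum>w\<in>?P. (if \<forall>j<p. T j \<longrightarrow> j \<in> w ` {..<p} then (\<Prod>i<p. z (w i)) else 0))"
  proof (rule sum.cong[OF refl])
    fix w
    define g :: "nat \<Rightarrow> nat \<Rightarrow> int"
      where "g j b = cf j b * (if j \<in> w ` {..<p} then 1 - int b else 1)" for j b
    have "(\<Sum>u<2 ^ p. (\<Prod>j<p. cf j (bit_of u j)) *
      ((\<Prod>j<p. if j \<in> w ` {..<p} then 1 - int (bit_of u j) else 1) * (\<Prod>i<p. z (w i)))) =
      (\<Sum>u<2 ^ p. \<Prod>j<p. g j (u div 2 ^ j mod 2)) * (\<Prod>i<p. z (w i))"
      unfolding g_def sum_distrib_right prod.distrib bit_of_def by (simp add: mult.assoc)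
    also have "(\<Sum>u<2 ^ p. \<Prod>j<p. g j (u div 2 ^ j mod 2)) = (\<Prod>j<p. g j 0 + g j 1)"
      by (rule sum_prod_bits)
    also have "\<dots> = (\<Prod>j<p. if T j \<longrightarrow> j \<in> w ` {..<p} then 1 else 0)"
      by (intro prod.cong) (auto simp: g_def cf_def)
    also have "\<dots> = (if \<forall>j<p. T j \<longrightarrow> j \<in> w ` {..<p} then 1 else 0)"
      by (auto intro!: prod.neutral prod_zero)
    finally show "(\<Sum>u<2 ^ p. (\<Prod>j<p. cf j (bit_of u j)) *
      ((\<Prod>j<p. if j \<in> w ` {..<p} then 1 - int (bit_of u j) else 1) * (\<Prod>i<p. z (w i)))) =
      (if \<forall>j<p. T j \<longrightarrow> j \<in> w ` {..<p} then (\<Prod>i<p. z (w i)) else 0)"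
      by (simp only: mult_1 mult_zero_left split: if_split) blast
  qed
  also have "\<dots> = (\<Sum>w\<in>{w \<in> ?P. \<forall>j<p. T j \<longrightarrow> j \<in> w ` {..<p}}. \<Prod>i<p. z (w i))"
    using fin by (simp add: sum.inter_filter)
  finally show ?thesis .
qed

section \<open>The weighted hypergraph\<close>

text \<open>An index \<open>r\<close> encodes the row \<open>r div 2 ^ p\<close> together with, in its \<open>p\<close> low bits, the set of positions
  that inclusion-exclusion leaves out. Positions with \<open>vs j div D = j\<close> lie in the initial segment of
  the blocks, so a word need not use them and they must not be left out.\<close>

definition term_sign :: "nat \<Rightarrow> nat \<Rightarrow> (nat \<Rightarrow> nat) \<Rightarrow> nat \<Rightarrow> int" where
  "term_sign p D vs r = (\<Prod>j<p. if bit_of r j = 0 then 1 else if vs j div D \<noteq> j then - 1 else 0)"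

definition term_base :: "nat \<Rightarrow> (nat \<Rightarrow> int) \<Rightarrow> (nat \<Rightarrow> nat) \<Rightarrow> nat \<Rightarrow> int" where
  "term_base p y vs r = (\<Sum>j<p. (1 - int (bit_of r j)) * y (vs j))"

definition edge_weight :: "nat \<Rightarrow> nat \<Rightarrow> nat \<Rightarrow> (nat \<Rightarrow> nat \<Rightarrow> int) \<Rightarrow> (nat \<Rightarrow> nat) \<Rightarrow> int" where
  "edge_weight p m D y vs =
     (\<Sum>r<m * 2 ^ p. term_sign p D vs r * term_base p (y (r div 2 ^ p)) vs r ^ p)"

lemma edge_weight_cong:
  assumes "\<And>j. j < p \<Longrightarrow> vs j = vs' j"
  shows "edge_weight p m D y vs = edge_weight p m D y vs'"
  unfolding edge_weight_def term_sign_def term_base_def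
  by (intro sum.cong prod.cong arg_cong2[of _ _ _ _ "(*)"] arg_cong2[of _ _ _ _ "(^)"] refl) (simp_all add: assms)

text \<open>Splitting \<open>r = l * 2 ^ p + u\<close> separates row and mask. The words here are
  over the positions \<open>0, ..., p - 1\<close> of the tuple, not yet over blocks.\<close>

lemma edge_weight_words:
  "edge_weight p m D y vs =
    (\<Sum>l<m. \<Sum>w\<in>{w \<in> {..<p} \<rightarrow>\<^sub>E {..<p}. \<forall>j<p. vs j div D \<noteq> j \<longrightarrow> j \<in> w ` {..<p}}.
       \<Prod>i<p. y l (vs (w i)))"
proof -
  have "edge_weight p m D y vs =
    (\<Sum>l<m. \<Sum>u<2 ^ p. term_sign p D vs (l * 2 ^ p + u) *
       term_base p (y ((l * 2 ^ p + u) div 2 ^ p)) vs (l * 2 ^ p + u) ^ p)"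
    unfolding edge_weight_def by (rule sum_mult_lessThan)
  also have "\<dots> = (\<Sum>l<m. \<Sum>u<2 ^ p. (\<Prod>j<p. if bit_of u j = 0 then 1 else if vs j div D \<noteq> j then - 1 else 0) *
       (\<Sum>j<p. (1 - int (bit_of u j)) * y l (vs j)) ^ p)"
    unfolding term_sign_def term_base_def
    by (intro sum.cong refl) (simp add: bit_of_add_high)
  finally show ?thesis by (simp only: inclusion_exclusion_words)
qed

text \<open>Exactly \<open>j\<close> elements of \<open>E\<close> lie below its \<open>j\<close>-th
  element, so that element equals \<open>j\<close> iff nothing below it is missing. This turns the
  search for a gap into one comparison.\<close>

lemma sorted_nth_eq_index_iff:
  fixes E :: "nat set"
  assumes "finite E" "j < card E"
  shows "sorted_list_of_set E ! j = j \<longleftrightarrow> {..<sorted_list_of_set E ! j} \<subseteq> E"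
proof -
  let ?es = "sorted_list_of_set E"
  have mono: "?es ! i < ?es ! i'" if "i < i'" "i' < card E" for i i'
    using that sorted_wrt_nth_less[OF strict_sorted_list_of_set[of E], of i i'] by simp
  have "{e \<in> E. e < ?es ! j} = (\<lambda>i. ?es ! i) ` {..<j}"
  proof (intro equalityI subsetI)
    fix e assume e: "e \<in> {e \<in> E. e < ?es ! j}"
    then obtain i where "i < card E" "e = ?es ! i"
      using assms by (metis (lifting) in_set_conv_nth length_sorted_list_of_set mem_Collect_eq set_sorted_list_of_set)
    moreover from this have "i < j" using e mono[of j i] by (cases i j rule: linorder_cases) auto
    ultimately show "e \<in> (\<lambda>i. ?es ! i) ` {..<j}" by auto
  next
    fix e assume "e \<in> (\<lambda>i. ?es ! i) ` {..<j}"
    then obtain i where "i < j" "e = ?es ! i" by auto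
    then show "e \<in> {e \<in> E. e < ?es ! j}"
      using mono[of i j] assms nth_mem[of i ?es] by auto
  qed
  moreover have "inj_on (\<lambda>i. ?es ! i) {..<j}"
    using assms by (intro inj_on_nth) auto
  ultimately have card: "card {e \<in> E. e < ?es ! j} = j" by (simp add: card_image)
  show ?thesis
  proof
    assume eq: "?es ! j = j"
    have "{e \<in> E. e < ?es ! j} = {..<?es ! j}"
      by (rule card_subset_eq) (use card eq in auto)
    then show "{..<?es ! j} \<subseteq> E" by auto
  next
    assume "{..<?es ! j} \<subseteq> E"
    then have "{e \<in> E. e < ?es ! j} = {..<?es ! j}" by auto
    then show "?es ! j = j" using card by simp
  qed
qed

lemma sorted_list_of_set_image:
  assumes "strict_mono_on E V" "finite E"
  shows "sorted_list_of_set (V ` E) = map V (sorted_list_of_set E)"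
proof (rule sorted_distinct_set_unique)
  have "sorted_wrt (<) (map V (sorted_list_of_set E))"
    unfolding sorted_wrt_map
    by (rule sorted_wrt_mono_rel[OF _ strict_sorted_list_of_set])
      (use assms in \<open>auto simp: strict_mono_on_def\<close>)
  then show "sorted (map V (sorted_list_of_set E))" "distinct (map V (sorted_list_of_set E))"
    by (auto simp: strict_sorted_iff)
qed (use assms in auto)

text \<open>Words over positions become words over blocks along the increasing enumeration
  \<open>es\<close> of \<open>E\<close>. As \<open>V\<close> is increasing, it maps this enumeration
  to that of the edge, whose \<open>j\<close>-th vertex lies in block \<open>es j\<close>. Both
  translations are restricted to \<open>{..<p}\<close> to stay within the extensional
  functions.\<close>

lemma edge_weight_block_set:
  assumes E: "E \<in> p_subsets p {..<k}" and V: "\<And>i. i < k \<Longrightarrow> V i div D = i"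
    and mono: "strict_mono_on {..<k} V"
  shows "edge_weight p m D y ((!) (sorted_list_of_set (V ` E))) =
    (\<Sum>l<m. \<Sum>w\<in>{w \<in> {..<p} \<rightarrow>\<^sub>E E. \<forall>e\<in>E. \<not> {..<e} \<subseteq> E \<longrightarrow> e \<in> w ` {..<p}}. \<Prod>i<p. y l (V (w i)))"
proof -
  have fin: "finite E" "card E = p" "E \<subseteq> {..<k}"
    using E finite_subset by (auto simp: p_subsets_def)
  define es where "es j = sorted_list_of_set E ! j" for j
  have nth: "sorted_list_of_set (V ` E) ! j = V (es j)" if "j < p" for j
    using sorted_list_of_set_image[OF monotone_on_subset[OF mono fin(3)] fin(1)] fin that
    by (simp add: es_def)
  have bij: "bij_betw es {..<p} E"
    using bij_betw_nth[of "sorted_list_of_set E" "{..<p}" E] fin by (simp add: es_def[abs_def])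
  then have es: "es j \<in> E" if "j < p" for j using that by (auto simp: bij_betw_def)
  let ?A = "{w \<in> {..<p} \<rightarrow>\<^sub>E {..<p}. \<forall>j<p. sorted_list_of_set (V ` E) ! j div D \<noteq> j \<longrightarrow> j \<in> w ` {..<p}}"
  let ?B = "{w \<in> {..<p} \<rightarrow>\<^sub>E E. \<forall>e\<in>E. \<not> {..<e} \<subseteq> E \<longrightarrow> e \<in> w ` {..<p}}"
  define g where "g = inv_into {..<p} es"
  have g_es: "g (es j) = j" if "j < p" for j
    using that bij by (simp add: g_def bij_betw_def)
  have es_g: "es (g e) = e" and g: "g e < p" if "e \<in> E" for e
    using that bij f_inv_into_f[of e es "{..<p}"] inv_into_into[of e es "{..<p}"]
    by (auto simp: g_def bij_betw_def)
  let ?h = "\<lambda>w. restrict (es \<circ> w) {..<p}"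
  let ?g = "\<lambda>w. restrict (g \<circ> w) {..<p}"
  have T: "sorted_list_of_set (V ` E) ! j div D \<noteq> j \<longleftrightarrow> \<not> {..<es j} \<subseteq> E" if "j < p" for j
    using nth[OF that] V[of "es j"] es[OF that] fin sorted_nth_eq_index_iff[of E j] that
    by (auto simp: es_def)
  have "(\<Sum>w\<in>?A. \<Prod>i<p. y l (sorted_list_of_set (V ` E) ! w i)) = (\<Sum>w\<in>?B. \<Prod>i<p. y l (V (w i)))" for l
  proof (rule sum.reindex_bij_witness[where j = ?h and i = ?g])
    fix w assume w: "w \<in> ?A"
    then have wp: "w i < p" if "i < p" for i using that by auto
    have out: "w i = undefined" if "\<not> i < p" for i using w that by (auto simp: PiE_iff extensional_def)
    show "?g (?h w) = w" by (rule ext) (simp add: restrict_def g_es wp out)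
    have img: "?h w ` {..<p} = es ` w ` {..<p}" by auto
    have "e \<in> es ` w ` {..<p}" if "e \<in> E" "\<not> {..<e} \<subseteq> E" for e
    proof -
      have "e \<in> es ` {..<p}" using bij that(1) by (simp add: bij_betw_def)
      then obtain j where j: "j < p" "e = es j" by auto
      then have "j \<in> w ` {..<p}" using w T[of j] that by blast
      then show ?thesis using j by blast
    qed
    then show "?h w \<in> ?B" unfolding mem_Collect_eq img using wp es by auto
    show "(\<Prod>i<p. y l (V (?h w i))) = (\<Prod>i<p. y l (sorted_list_of_set (V ` E) ! w i))"
      by (intro prod.cong refl) (simp add: nth wp)
  next
    fix w assume w: "w \<in> ?B"
    then have wE: "w i \<in> E" if "i < p" for i using that by auto
    have out: "w i = undefined" if "\<not> i < p" for i using w that by (auto simp: PiE_iff extensional_def)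
    show "?h (?g w) = w" by (rule ext) (simp add: restrict_def es_g wE out)
    have img: "?g w ` {..<p} = g ` w ` {..<p}" by auto
    have "j \<in> g ` w ` {..<p}" if "j < p" "sorted_list_of_set (V ` E) ! j div D \<noteq> j" for j
    proof -
      have "es j \<in> w ` {..<p}" using w T[of j] es[of j] that by blast
      then show ?thesis using g_es[OF that(1)] by (metis imageI)
    qed
    then show "?g w \<in> ?A" unfolding mem_Collect_eq img using wE g by auto
  qed
  then show ?thesis unfolding edge_weight_words by simp
qed

text \<open>The p-subsets of the clique correspond to the p-sets of blocks, and over all of these
  every word is counted exactly once.\<close>

lemma sum_edge_weight_clique:
  assumes V: "\<And>i. i < k \<Longrightarrow> V i div D = i" and mono: "strict_mono_on {..<k} V" and "p \<le> k"
  shows "(\<Sum>e\<in>p_subsets p (V ` {..<k}). edge_weight p m D y ((!) (sorted_list_of_set e))) =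
    (\<Sum>l<m. (\<Sum>i<k. y l (V i)) ^ p)"
proof -
  have inj: "inj_on V {..<k}" using mono by (rule strict_mono_on_imp_inj_on)
  have "bij_betw ((`) V) (p_subsets p {..<k}) (p_subsets p (V ` {..<k}))"
  proof (rule bij_betw_imageI)
    show "inj_on ((`) V) (p_subsets p {..<k})"
    proof (rule inj_onI)
      fix E F assume "E \<in> p_subsets p {..<k}" "F \<in> p_subsets p {..<k}" "V ` E = V ` F"
      then show "E = F" using inj_on_image_eq_iff[OF inj, of E F] by (simp add: p_subsets_def)
    qed
    show "(`) V ` p_subsets p {..<k} = p_subsets p (V ` {..<k})"
    proof (intro equalityI subsetI)
      fix e assume "e \<in> (`) V ` p_subsets p {..<k}"
      then obtain E where E: "e = V ` E" "E \<subseteq> {..<k}" "card E = p" by (auto simp: p_subsets_def)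
      then have "card e = p" using card_image[OF inj_on_subset[OF inj E(2)]] by simp
      then show "e \<in> p_subsets p (V ` {..<k})" unfolding p_subsets_def E(1) using E(2) by blast
    next
      fix e assume "e \<in> p_subsets p (V ` {..<k})"
      then have "e \<subseteq> V ` {..<k}" and e: "card e = p" by (simp_all add: p_subsets_def)
      then obtain E where E: "E \<subseteq> {..<k}" "e = V ` E" by (meson subset_imageE)
      then have "card E = p" using card_image[OF inj_on_subset[OF inj E(1)]] e by simp
      then show "e \<in> (`) V ` p_subsets p {..<k}" using E by (simp add: p_subsets_def)
    qed
  qed
  then have "(\<Sum>e\<in>p_subsets p (V ` {..<k}). edge_weight p m D y ((!) (sorted_list_of_set e))) =
    (\<Sum>E\<in>p_subsets p {..<k}. edge_weight p m D y ((!) (sorted_list_of_set (V ` E))))"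
    by (rule sum.reindex_bij_betw[symmetric])
  also have "\<dots> = (\<Sum>l<m. \<Sum>E\<in>p_subsets p {..<k}.
      \<Sum>w\<in>{w \<in> {..<p} \<rightarrow>\<^sub>E E. \<forall>e\<in>E. \<not> {..<e} \<subseteq> E \<longrightarrow> e \<in> w ` {..<p}}. \<Prod>i<p. y l (V (w i)))"
    by (subst sum.swap) (intro sum.cong refl edge_weight_block_set[OF _ V mono])
  finally show ?thesis
    by (simp only: sum_canonical[OF \<open>p \<le> k\<close>, of "\<lambda>i. y l (V i)" for l])
qed

section \<open>Cliques as choices of one vertex per block, and the values of vertices\<close>

definition block_edges :: "nat \<Rightarrow> nat \<Rightarrow> nat \<Rightarrow> nat set set" where
  "block_edges p k D = {e \<in> p_subsets p {..<k * D}. inj_on (\<lambda>v. v div D) e}"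

text \<open>As \<open>2 <= p <= k\<close>, any two vertices of a clique extend to a p-subset of it,
  which is a hyperedge; so they lie in different blocks. Then \<open>k\<close> vertices in
  \<open>k\<close> blocks meet each block once.\<close>

lemma block_clique_iff:
  assumes "2 \<le> p" "p \<le> k" "0 < D"
  shows "K \<subseteq> {..<k * D} \<and> card K = k \<and> p_subsets p K \<subseteq> block_edges p k D \<longleftrightarrow>
    (\<exists>x. (\<forall>i<k. x i < D) \<and> K = (\<lambda>i. i * D + x i) ` {..<k})"
proof (intro iffI)
  assume *: "K \<subseteq> {..<k * D} \<and> card K = k \<and> p_subsets p K \<subseteq> block_edges p k D"
  then have K: "K \<subseteq> {..<k * D}" "k = card K" "p_subsets p K \<subseteq> block_edges p (card K) D" by auto
  have fin: "finite K" using K finite_subset by blast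
  have inj: "inj_on (\<lambda>v. v div D) K"
  proof (rule inj_onI)
    fix u v assume uv: "u \<in> K" "v \<in> K" "u div D = v div D"
    have "card {u, v} \<le> p" using assms by (cases "u = v") auto
    then obtain e where "{u, v} \<subseteq> e" "e \<subseteq> K" "card e = p"
      using exists_subset_between[of "{u, v}" p K] uv fin K assms by auto
    then have "e \<in> block_edges p (card K) D" using K(3) by (auto simp: p_subsets_def)
    then show "u = v" using uv \<open>{u, v} \<subseteq> e\<close> by (auto simp: block_edges_def inj_on_def)
  qed
  have "(\<lambda>v. v div D) ` K = {..<k}"
    by (rule card_subset_eq)
      (use K inj assms in \<open>auto simp: card_image less_mult_imp_div_less\<close>)
  then have "\<forall>i<k. \<exists>v\<in>K. v div D = i" by (metis (lifting) imageE lessThan_iff)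
  then obtain V where V: "\<And>i. i < k \<Longrightarrow> V i \<in> K \<and> V i div D = i" by metis
  have "K = (\<lambda>i. i * D + V i mod D) ` {..<k}"
  proof (rule card_subset_eq[OF fin, symmetric])
    have eq: "i * D + V i mod D = V i" if "i < k" for i
      using V[OF that] by (metis div_mult_mod_eq)
    then show "(\<lambda>i. i * D + V i mod D) ` {..<k} \<subseteq> K" using V by auto
    have "inj_on V {..<k}" using V by (metis inj_onI lessThan_iff)
    then have "card (V ` {..<k}) = k" by (simp add: card_image)
    moreover have "(\<lambda>i. i * D + V i mod D) ` {..<k} = V ` {..<k}" using eq by auto
    ultimately show "card ((\<lambda>i. i * D + V i mod D) ` {..<k}) = card K" using K(2) by simp
  qed
  then show "\<exists>x. (\<forall>i<k. x i < D) \<and> K = (\<lambda>i. i * D + x i) ` {..<k}"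
    using assms by (intro exI[of _ "\<lambda>i. V i mod D"]) auto
next
  assume "\<exists>x. (\<forall>i<k. x i < D) \<and> K = (\<lambda>i. i * D + x i) ` {..<k}"
  then obtain x where x: "\<forall>i<k. x i < D" and K: "K = (\<lambda>i. i * D + x i) ` {..<k}" by blast
  have lt: "i * D + x i < k * D" if "i < k" for i
  proof -
    have "i * D + x i < Suc i * D" using x that by simp
    also have "\<dots> \<le> k * D" using that by (intro mult_le_mono1) auto
    finally show ?thesis .
  qed
  have d: "(i * D + x i) div D = i" if "i < k" for i using x that assms by simp
  have "inj_on (\<lambda>i. i * D + x i) {..<k}"
    by (rule inj_onI) (use d in \<open>metis lessThan_iff\<close>)
  then have "card K = k" by (simp add: K card_image)
  moreover have sub: "K \<subseteq> {..<k * D}" using lt by (auto simp: K)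
  moreover have "inj_on (\<lambda>v. v div D) K"
    unfolding K by (rule inj_onI) (use d in auto)
  then have "p_subsets p K \<subseteq> block_edges p k D"
    using sub by (auto simp: block_edges_def p_subsets_def intro: inj_on_subset)
  ultimately show "K \<subseteq> {..<k * D} \<and> card K = k \<and> p_subsets p K \<subseteq> block_edges p k D" by blast
qed

text \<open>Column \<open>j\<close> of the basis belongs to block \<open>j mod k\<close>, and its coefficient is bit \<open>j div k\<close> of the vertex
  within that block. The target is charged to block \<open>0\<close>.\<close>

definition vertex_value ::
  "(nat \<Rightarrow> nat \<Rightarrow> int) \<Rightarrow> (nat \<Rightarrow> int) \<Rightarrow> nat \<Rightarrow> nat \<Rightarrow> nat \<Rightarrow> nat \<Rightarrow> nat \<Rightarrow> int" where
  "vertex_value B t n k D l v =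
     (\<Sum>j | j < n \<and> j mod k = v div D. B l j * int (bit_of (v mod D) (j div k))) -
     (if v div D = 0 then t l else 0)"

lemma sum_vertex_value:
  assumes "0 < k" "\<And>i. i < k \<Longrightarrow> x i < D"
  shows "(\<Sum>i<k. vertex_value B t n k D l (i * D + x i)) =
    (\<Sum>j<n. B l j * int (bit_of (x (j mod k)) (j div k))) - t l"
proof -
  let ?f = "\<lambda>j. B l j * int (bit_of (x (j mod k)) (j div k))"
  have "(i * D + x i) div D = i" "(i * D + x i) mod D = x i" if "i < k" for i
    using assms(2)[OF that] by simp_all
  then have "(\<Sum>i<k. vertex_value B t n k D l (i * D + x i)) =
    (\<Sum>i<k. (\<Sum>j\<in>{j \<in> {..<n}. j mod k = i}. ?f j) - (if i = 0 then t l else 0))"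
    unfolding vertex_value_def
    by (intro sum.cong arg_cong2[of _ _ _ _ "(-)"]) auto
  also have "\<dots> = (\<Sum>i<k. \<Sum>j\<in>{j \<in> {..<n}. j mod k = i}. ?f j) - t l"
    using assms(1) by (simp add: sum_subtractf)
  also have "(\<Sum>i<k. \<Sum>j\<in>{j \<in> {..<n}. j mod k = i}. ?f j) = (\<Sum>j<n. ?f j)"
    by (rule sum.group) (use assms in auto)
  finally show ?thesis .
qed

section \<open>Weakest preconditions for the random access machine\<close>

notation Seq (infixr ";;" 60)

definition fits :: "nat \<Rightarrow> int \<Rightarrow> bool" where
  "fits W x \<longleftrightarrow> \<bar>x\<bar> < 2 ^ W"

lemma bit_length_le_iff_fits: "bit_length x \<le> W \<longleftrightarrow> fits W x"
proof -
  have "bit_length x \<le> W \<longleftrightarrow> nat \<bar>x\<bar> < 2 ^ W"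
    unfolding bit_length_def by (simp add: floorlog_le_iff)
  also have "\<dots> \<longleftrightarrow> \<bar>x\<bar> < 2 ^ W" by (simp add: nat_less_iff)
  finally show ?thesis by (simp add: fits_def)
qed

type_synonym assn = "(reg \<Rightarrow> int) \<Rightarrow> int list \<Rightarrow> bool"

definition config :: "(int \<Rightarrow> int) \<Rightarrow> nat \<Rightarrow> (reg \<Rightarrow> int) \<Rightarrow> int list \<Rightarrow> ram_state \<Rightarrow> bool" where
  "config M W R os s \<longleftrightarrow>
     regs s = R \<and> out_tape s = os \<and> mem s = M \<and> width s \<le> W \<and> finite (cells s)"

text \<open>Every step touches at most one cell or emits at most one number, so the space never grows faster
  than the number of steps, and a bound on the time is also one on the space. Programs that do not
  write to memory suffice here, hence the fixed \<open>M\<close>.\<close>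

definition wp :: "(int \<Rightarrow> int) \<Rightarrow> nat \<Rightarrow> com \<Rightarrow> nat \<Rightarrow> assn \<Rightarrow> assn" where
  "wp M W c T Q R os \<longleftrightarrow> (\<forall>s. config M W R os s \<longrightarrow>
     (\<exists>s' R' os'. big_step c s s' \<and> config M W R' os' s' \<and> Q R' os' \<and> steps s' \<le> steps s + T \<and>
       space_used s' + steps s \<le> space_used s + steps s'))"

lemma wpE:
  assumes "wp M W c T Q R os" "config M W R os s"
  obtains s' R' os' where "big_step c s s'" "config M W R' os' s'" "Q R' os'"
    "steps s' \<le> steps s + T" "space_used s' + steps s \<le> space_used s + steps s'"
  using assms(1)[unfolded wp_def, rule_format, OF assms(2)] by (elim exE conjE) (rule that)

lemma wpI:
  assumes "\<And>s. config M W R os s \<Longrightarrow>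
    \<exists>s' R' os'. big_step c s s' \<and> config M W R' os' s' \<and> Q R' os' \<and> steps s' \<le> steps s + T \<and>
      space_used s' + steps s \<le> space_used s + steps s'"
  shows "wp M W c T Q R os"
  unfolding wp_def by (intro allI impI assms)

lemma wp_mono:
  assumes "wp M W c T Q R os" "T \<le> T'" "\<And>R os. Q R os \<Longrightarrow> Q' R os"
  shows "wp M W c T' Q' R os"
proof (rule wpI)
  fix s assume "config M W R os s"
  then obtain s' R' os' where "big_step c s s'" "config M W R' os' s'" "Q R' os'"
    "steps s' \<le> steps s + T" "space_used s' + steps s \<le> space_used s + steps s'"
    using wpE[OF assms(1)] by blast
  then show "\<exists>s' R' os'. big_step c s s' \<and> config M W R' os' s' \<and> Q' R' os' \<and>
      steps s' \<le> steps s + T' \<and> space_used s' + steps s \<le> space_used s + steps s'"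
    using assms(2,3) by (intro exI[of _ s'] exI[of _ R'] exI[of _ os']) auto
qed

lemma wp_Seq:
  assumes "wp M W c1 T1 (wp M W c2 T2 Q) R os"
  shows "wp M W (c1 ;; c2) (T1 + T2) Q R os"
proof (rule wpI)
  fix s assume "config M W R os s"
  then obtain u R' os' where u: "big_step c1 s u" "config M W R' os' u" "wp M W c2 T2 Q R' os'"
    "steps u \<le> steps s + T1" "space_used u + steps s \<le> space_used s + steps u"
    using wpE[OF assms] by blast
  obtain v R'' os'' where v: "big_step c2 u v" "config M W R'' os'' v" "Q R'' os''"
    "steps v \<le> steps u + T2" "space_used v + steps u \<le> space_used u + steps v"
    using wpE[OF u(3,2)] by blast
  have "big_step (c1 ;; c2) s v" using u(1) v(1) by (rule big_step.Seq)
  then show "\<exists>s' R' os'. big_step (c1 ;; c2) s s' \<and> config M W R' os' s' \<and> Q R' os' \<and>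
      steps s' \<le> steps s + (T1 + T2) \<and> space_used s' + steps s \<le> space_used s + steps s'"
    using u v by (intro exI[of _ v] exI[of _ R''] exI[of _ os'']) linarith
qed

lemma config_tick: "config M W R os (tick s) \<longleftrightarrow> config M W R os s"
  by (simp add: config_def tick_def)

lemma steps_tick [simp]: "steps (tick s) = Suc (steps s)"
  and space_used_tick [simp]: "space_used (tick s) = space_used s"
  by (simp_all add: tick_def space_used_def)

lemma wp_tick:
  assumes "wp M W c T Q R os" "\<And>s s'. regs s = R \<Longrightarrow> big_step c (tick s) s' \<Longrightarrow> big_step c' s s'"
  shows "wp M W c' (Suc T) Q R os"
proof (rule wpI)
  fix s assume s: "config M W R os s"
  then obtain u R' os' where u: "big_step c (tick s) u" "config M W R' os' u" "Q R' os'"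
    "steps u \<le> steps (tick s) + T" "space_used u + steps (tick s) \<le> space_used (tick s) + steps u"
    using wpE[OF assms(1)] config_tick by metis
  moreover have "big_step c' s u" using assms(2)[OF _ u(1)] s by (simp add: config_def)
  ultimately show "\<exists>s' R' os'. big_step c' s s' \<and> config M W R' os' s' \<and> Q R' os' \<and>
      steps s' \<le> steps s + Suc T \<and> space_used s' + steps s \<le> space_used s + steps s'"
    by (intro exI[of _ u] exI[of _ R'] exI[of _ os']) simp
qed

section \<open>Rules for conditionals, loops and loop-free code\<close>

lemma wp_IfPos:
  assumes "R r > 0 \<Longrightarrow> wp M W c1 T1 Q R os" "R r \<le> 0 \<Longrightarrow> wp M W c2 T2 Q R os"
  shows "wp M W (IfPos r c1 c2) (Suc (T1 + T2)) Q R os"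
proof (cases "R r > 0")
  case True
  have "wp M W c1 (T1 + T2) Q R os" using assms(1)[OF True] by (rule wp_mono) simp_all
  then show ?thesis by (rule wp_tick) (use True in \<open>simp add: IfPos_True\<close>)
next
  case False
  have "wp M W c2 (T1 + T2) Q R os" by (rule wp_mono[OF assms(2)]) (use False in simp_all)
  then show ?thesis by (rule wp_tick) (use False in \<open>simp add: IfPos_False\<close>)
qed

text \<open>The index \<open>i\<close> of the invariant is a variant that bounds the number of
  rounds. Each round pays one step for its test, and the final \<open>+ 1\<close> is the failing
  test.\<close>

lemma wp_WhilePos:
  assumes "I i R os"
    and step: "\<And>i R os. I i R os \<Longrightarrow> R r > 0 \<Longrightarrow> wp M W c T (\<lambda>R os. \<exists>j<i. I j R os) R os"
    and stop: "\<And>i R os. I i R os \<Longrightarrow> R r \<le> 0 \<Longrightarrow> Q R os"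
  shows "wp M W (WhilePos r c) (i * (T + 1) + 1) Q R os"
  using assms(1)
proof (induction i arbitrary: R os rule: less_induct)
  case (less i)
  show ?case
  proof (rule wpI)
    fix s assume s: "config M W R os s"
    show "\<exists>s' R' os'. big_step (WhilePos r c) s s' \<and> config M W R' os' s' \<and> Q R' os' \<and>
      steps s' \<le> steps s + (i * (T + 1) + 1) \<and> space_used s' + steps s \<le> space_used s + steps s'"
    proof (cases "R r > 0")
      case True
      then obtain u R' os' where u: "big_step c (tick s) u" "config M W R' os' u" "\<exists>j<i. I j R' os'"
        "steps u \<le> steps (tick s) + T" "space_used u + steps (tick s) \<le> space_used (tick s) + steps u"
        using wpE[OF step[OF less.prems]] s config_tick by metis
      then obtain j where j: "j < i" "I j R' os'" by blast
      obtain v R'' os'' where v: "big_step (WhilePos r c) u v" "config M W R'' os'' v" "Q R'' os''"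
        "steps v \<le> steps u + (j * (T + 1) + 1)" "space_used v + steps u \<le> space_used u + steps v"
        using wpE[OF less.IH[OF j] u(2)] by blast
      have "big_step (WhilePos r c) s v"
        using WhilePos_True[OF _ u(1) v(1)] True s by (simp add: config_def)
      moreover have "Suc j * (T + 1) \<le> i * (T + 1)" using j(1) by (intro mult_le_mono1) simp
      then have "steps v \<le> steps s + (i * (T + 1) + 1)" using u v by simp
      moreover have "space_used v + steps s \<le> space_used s + steps v" using u v by simp
      ultimately show ?thesis using v by blast
    next
      case False
      moreover have "big_step (WhilePos r c) s (tick s)"
        using WhilePos_False[of s r c] False s by (simp add: config_def)
      ultimately show ?thesis
        using stop[OF less.prems] s
        by (intro exI[of _ "tick s"] exI[of _ R] exI[of _ os]) (simp add: config_tick)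
    qed
  qed
qed

text \<open>The register holds exactly \<open>b - j\<close>, so the loop can only stop at
  \<open>j = b\<close>. The variant is \<open>b - j\<close>.\<close>

lemma wp_for_up:
  assumes init: "I 0 R os"
    and step: "\<And>j R os. j < b \<Longrightarrow> I j R os \<Longrightarrow> wp M W c T (I (Suc j)) R os"
    and counter: "\<And>j R os. I j R os \<Longrightarrow> R r = int b - int j"
    and final: "\<And>R os. I b R os \<Longrightarrow> Q R os"
  shows "wp M W (WhilePos r c) (b * (T + 1) + 1) Q R os"
proof (rule wp_WhilePos[where I = "\<lambda>i R os. i \<le> b \<and> I (b - i) R os"])
  fix i R os assume I: "i \<le> b \<and> I (b - i) R os"
  { assume "R r > 0"
    then have "i > 0" using counter[of "b - i" R os] I by auto
    then have "wp M W c T (I (b - (i - 1))) R os"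
      using step[of "b - i" R os] I by (simp add: Suc_diff_le)
    then show "wp M W c T (\<lambda>R os. \<exists>j<i. j \<le> b \<and> I (b - j) R os) R os"
      using I \<open>i > 0\<close> by (elim wp_mono) (auto intro!: exI[of _ "i - 1"]) }
  { assume "R r \<le> 0"
    then have "i = 0" using counter[of "b - i" R os] I by auto
    then show "Q R os" using I final by simp }
qed (use init in simp)

lemma wp_for_down:
  assumes init: "I b R os"
    and step: "\<And>i R os. i < b \<Longrightarrow> I (Suc i) R os \<Longrightarrow> wp M W c T (I i) R os"
    and counter: "\<And>i R os. I i R os \<Longrightarrow> R r = int i"
    and final: "\<And>R os. I 0 R os \<Longrightarrow> Q R os"
  shows "wp M W (WhilePos r c) (b * (T + 1) + 1) Q R os"
proof (rule wp_for_up[where I = "\<lambda>j R os. j \<le> b \<and> I (b - j) R os"])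
  fix j R os assume "j < b" "j \<le> b \<and> I (b - j) R os"
  then have "wp M W c T (I (b - Suc j)) R os"
    using step[of "b - Suc j" R os] by (simp add: Suc_diff_Suc)
  then show "wp M W c T (\<lambda>R os. Suc j \<le> b \<and> I (b - Suc j) R os) R os"
    by (rule wp_mono) (use \<open>j < b\<close> in auto)
next
  fix j R os assume "j \<le> b \<and> I (b - j) R os"
  then show "R r = int b - int j" using counter[of "b - j" R os] by (simp add: of_nat_diff)
qed (use init final in auto)

text \<open>A precondition computed by recursion on the code, so that the simplifier executes
  loop-free code symbolically. Loops and \<open>Store\<close> lie outside this fragment and get the
  value \<open>False\<close>.\<close>

primrec straight :: "(int \<Rightarrow> int) \<Rightarrow> nat \<Rightarrow> com \<Rightarrow> assn \<Rightarrow> assn" where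
  "straight M W (Const r x) Q R os \<longleftrightarrow> fits W x \<and> Q (R(r := x)) os"
| "straight M W (Arith r f r1 r2) Q R os \<longleftrightarrow>
     fits W (arith f (R r1) (R r2)) \<and> Q (R(r := arith f (R r1) (R r2))) os"
| "straight M W (Load r ra) Q R os \<longleftrightarrow> fits W (M (R ra)) \<and> Q (R(r := M (R ra))) os"
| "straight M W (Store ra r) Q R os \<longleftrightarrow> False"
| "straight M W (Emit r) Q R os \<longleftrightarrow> Q R (os @ [R r])"
| "straight M W (c1 ;; c2) Q R os \<longleftrightarrow> straight M W c1 (straight M W c2 Q) R os"
| "straight M W (IfPos r c1 c2) Q R os \<longleftrightarrow>
     (if R r > 0 then straight M W c1 Q R os else straight M W c2 Q R os)"
| "straight M W (WhilePos r c) Q R os \<longleftrightarrow> False"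

text \<open>Adding both branches of a conditional is an upper bound that avoids a case distinction.
  The values for \<open>Store\<close> and \<open>WhilePos\<close> are arbitrary, since
  \<open>straight\<close> fails there.\<close>

primrec straight_cost :: "com \<Rightarrow> nat" where
  "straight_cost (Const r x) = 1"
| "straight_cost (Arith r f r1 r2) = 1"
| "straight_cost (Load r ra) = 1"
| "straight_cost (Store ra r) = 1"
| "straight_cost (Emit r) = 1"
| "straight_cost (c1 ;; c2) = straight_cost c1 + straight_cost c2"
| "straight_cost (IfPos r c1 c2) = Suc (straight_cost c1 + straight_cost c2)"
| "straight_cost (WhilePos r c) = 1"

lemma straight_mono:
  assumes "straight M W c Q R os" "\<And>R os. Q R os \<Longrightarrow> Q' R os"
  shows "straight M W c Q' R os"
  using assms
proof (induction c arbitrary: Q Q' R os)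
  case (Seq c1 c2)
  from Seq.prems(1) have "straight M W c1 (straight M W c2 Q) R os" by simp
  then have "straight M W c1 (straight M W c2 Q') R os"
    by (rule Seq.IH(1)) (rule Seq.IH(2)[OF _ Seq.prems(2)])
  then show ?case by simp
next
  case (IfPos r c1 c2)
  then show ?case
    using IfPos.IH(1)[of Q R os Q'] IfPos.IH(2)[of Q R os Q'] by (simp split: if_splits)
qed simp_all

lemma wp_step:
  assumes "\<And>s. config M W R os s \<Longrightarrow> \<exists>s'. big_step c s s' \<and> config M W R' os' s' \<and>
    steps s' = Suc (steps s) \<and> space_used s' \<le> Suc (space_used s)" and "Q R' os'"
  shows "wp M W c 1 Q R os"
proof (rule wpI)
  fix s assume "config M W R os s"
  then obtain s' where "big_step c s s'" "config M W R' os' s'" "steps s' = Suc (steps s)"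
    "space_used s' \<le> Suc (space_used s)"
    using assms(1) by blast
  then show "\<exists>s' R' os'. big_step c s s' \<and> config M W R' os' s' \<and> Q R' os' \<and>
      steps s' \<le> steps s + 1 \<and> space_used s' + steps s \<le> space_used s + steps s'"
    using assms(2) by (intro exI[of _ s'] exI[of _ R'] exI[of _ os']) simp
qed

lemma wp_straight:
  assumes "straight M W c Q R os"
  shows "wp M W c (straight_cost c) Q R os"
  using assms
proof (induction c arbitrary: Q R os)
  case (Const r x)
  show ?case
    unfolding straight_cost.simps
  proof (rule wp_step[where R' = "R(r := x)" and os' = "os"])
    show "\<exists>s'. big_step (Const r x) s s' \<and> config M W (R(r := x)) os s' \<and> steps s' = Suc (steps s) \<and>
        space_used s' \<le> Suc (space_used s)" if "config M W R os s" for s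
      using that Const big_step.Const[of r x s]
      by (intro exI[of _ "set_reg r x (tick s)"])
        (auto simp: config_def set_reg_def tick_def space_used_def bit_length_le_iff_fits)
  qed (rule Const[unfolded straight.simps, THEN conjunct2])
next
  case (Arith r f r1 r2)
  let ?v = "arith f (R r1) (R r2)"
  show ?case
    unfolding straight_cost.simps
  proof (rule wp_step[where R' = "R(r := ?v)" and os' = "os"])
    show "\<exists>s'. big_step (Arith r f r1 r2) s s' \<and> config M W (R(r := ?v)) os s' \<and>
        steps s' = Suc (steps s) \<and> space_used s' \<le> Suc (space_used s)" if "config M W R os s" for s
      using that Arith big_step.Arith[of r f r1 r2 s]
      by (intro exI[of _ "set_reg r ?v (tick s)"])
        (auto simp: config_def set_reg_def tick_def space_used_def bit_length_le_iff_fits)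
  qed (rule Arith[unfolded straight.simps, THEN conjunct2])
next
  case (Load r ra)
  let ?v = "M (R ra)"
  show ?case
    unfolding straight_cost.simps
  proof (rule wp_step[where R' = "R(r := ?v)" and os' = "os"])
    show "\<exists>s'. big_step (Load r ra) s s' \<and> config M W (R(r := ?v)) os s' \<and>
        steps s' = Suc (steps s) \<and> space_used s' \<le> Suc (space_used s)" if "config M W R os s" for s
      using that Load big_step.Load[of r ra s]
      by (intro exI[of _ "set_reg r ?v (touch (R ra) (tick s))"])
        (auto simp: config_def set_reg_def tick_def touch_def space_used_def bit_length_le_iff_fits card_insert_if)
  qed (rule Load[unfolded straight.simps, THEN conjunct2])
next
  case (Emit r)
  show ?case
    unfolding straight_cost.simps
  proof (rule wp_step[where R' = "R" and os' = "os @ [R r]"])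
    show "\<exists>s'. big_step (Emit r) s s' \<and> config M W R (os @ [R r]) s' \<and>
        steps s' = Suc (steps s) \<and> space_used s' \<le> Suc (space_used s)" if "config M W R os s" for s
      using that big_step.Emit[of r s]
      by (intro exI[of _ "(tick s)\<lparr>out_tape := out_tape s @ [regs s r]\<rparr>"])
        (auto simp: config_def tick_def space_used_def)
  qed (rule Emit[unfolded straight.simps])
next
  case (Seq c1 c2)
  have "straight M W c1 (wp M W c2 (straight_cost c2) Q) R os"
    using straight_mono[OF Seq.prems[unfolded straight.simps] Seq.IH(2)] .
  from Seq.IH(1)[OF this] show ?case unfolding straight_cost.simps by (rule wp_Seq)
next
  case (IfPos r c1 c2)
  then show ?case unfolding straight_cost.simps by (intro wp_IfPos) (auto split: if_splits)
qed simp_all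

text \<open>Executes the code up to the next loop symbolically and leaves the rest of the program as
  the postcondition. The verification below advances from loop to loop in this way.\<close>

lemma wp_straight_Seq:
  assumes "straight M W c1 (wp M W c2 T Q) R os"
  shows "wp M W (c1 ;; c2) (straight_cost c1 + T) Q R os"
  by (intro wp_Seq wp_straight assms)

text \<open>All counters start at 0, so the relative inequality in \<open>wp\<close> says that the
  space is at most the number of steps; hence one bound serves for both.\<close>

lemma halts_within_if_wp:
  assumes "wp (mem (init_state xs)) W P T (\<lambda>R os. os = ys) (\<lambda>_. 0) []"
    and "real T \<le> bound" "real W \<le> w"
  shows "halts_within P xs bound bound w ys"
proof -
  have "config (mem (init_state xs)) W (\<lambda>_. 0) [] (init_state xs)" "steps (init_state xs) = 0"
    "space_used (init_state xs) = 0"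
    by (simp_all add: config_def init_state_def space_used_def)
  then obtain s where s: "big_step P (init_state xs) s" "out_tape s = ys" "width s \<le> W" "steps s \<le> T"
    "space_used s \<le> steps s"
    using wpE[OF assms(1)] by (metis add.right_neutral add_0 config_def)
  then have "real (steps s) \<le> bound" "real (space_used s) \<le> bound" "real (width s) \<le> w"
    using assms by linarith+
  then show ?thesis unfolding halts_within_def using s by blast
qed

section \<open>The program\<close>

lemma wp_straightI:
  assumes "straight M W c Q R os" "straight_cost c \<le> T"
  shows "wp M W c T Q R os"
  using wp_mono[OF wp_straight[OF assms(1)] assms(2)] by blast

lemma fits_le: "fits W y \<Longrightarrow> \<bar>x\<bar> \<le> \<bar>y\<bar> \<Longrightarrow> fits W x"
  by (simp add: fits_def)

text \<open>Register \<open>0\<close> is never written and supplies the constant \<open>0\<close>. The loops own nested ranges of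
  registers (powers from \<open>50\<close>, columns from \<open>40\<close>, positions from \<open>30\<close>, rows and masks from \<open>20\<close>), so that
  the frame condition of a loop is that all registers below some number are unchanged. Register \<open>1\<close>
  is left out because the simplifier would turn it into \<open>Suc 0\<close>.\<close>

abbreviation (input) "rZero \<equiv> 0 :: reg"
abbreviation (input) "rOne \<equiv> 2 :: reg"
abbreviation (input) "rTwo \<equiv> 3 :: reg"
abbreviation (input) "rFour \<equiv> 4 :: reg"
abbreviation (input) "rK \<equiv> 5 :: reg"
abbreviation (input) "rP \<equiv> 6 :: reg"
abbreviation (input) "rM \<equiv> 7 :: reg"
abbreviation (input) "rN \<equiv> 8 :: reg"
abbreviation (input) "rD \<equiv> 9 :: reg"
abbreviation (input) "rVerts \<equiv> 10 :: reg"
abbreviation (input) "rMasks \<equiv> 11 :: reg"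
abbreviation (input) "rTarget \<equiv> 12 :: reg"
abbreviation (input) "rCode \<equiv> 13 :: reg"
abbreviation (input) "rDen \<equiv> 14 :: reg"
abbreviation (input) "rNum \<equiv> 15 :: reg"
abbreviation (input) "rWeight \<equiv> 20 :: reg"
abbreviation (input) "rTerm \<equiv> 21 :: reg"
abbreviation (input) "rRow \<equiv> 22 :: reg"
abbreviation (input) "rEntry \<equiv> 23 :: reg"
abbreviation (input) "rBits \<equiv> 30 :: reg"
abbreviation (input) "rDigits \<equiv> 31 :: reg"
abbreviation (input) "rPos \<equiv> 32 :: reg"
abbreviation (input) "rCount \<equiv> 33 :: reg"
abbreviation (input) "rSign \<equiv> 34 :: reg"
abbreviation (input) "rSum \<equiv> 35 :: reg"
abbreviation (input) "rBlock \<equiv> 36 :: reg"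
abbreviation (input) "rBit \<equiv> 37 :: reg"
abbreviation (input) "rPrev \<equiv> 38 :: reg"
abbreviation (input) "rOk \<equiv> 39 :: reg"
abbreviation (input) "rY \<equiv> 40 :: reg"
abbreviation (input) "rX \<equiv> 41 :: reg"
abbreviation (input) "rAddr \<equiv> 42 :: reg"
abbreviation (input) "rRem \<equiv> 43 :: reg"
abbreviation (input) "rA \<equiv> 48 :: reg"
abbreviation (input) "rB \<equiv> 49 :: reg"
abbreviation (input) "rBase \<equiv> 50 :: reg"
abbreviation (input) "rExp \<equiv> 51 :: reg"
abbreviation (input) "rPow \<equiv> 52 :: reg"

section \<open>The code, from the innermost loop outwards\<close>

abbreviation (input) "mov r r' \<equiv> Arith r Plus r' rZero"

definition "power_body = (Arith rPow Times rPow rBase ;; Arith rExp Minus rExp rOne)"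

definition "power_prog = (mov rPow rOne ;; WhilePos rExp power_body)"

text \<open>The columns of one block are \<open>k\<close> apart, so the address and
  \<open>rRem\<close> move in steps of \<open>k\<close>, and \<open>rX\<close> loses one bit per
  column. \<open>rRem\<close> may end below 0.\<close>

definition "column_body =
  (Arith rA Divide rX rTwo ;; Arith rB Times rA rTwo ;; Arith rB Minus rX rB ;; mov rX rA ;;
   Load rA rAddr ;; Arith rA Times rB rA ;; Arith rY Plus rY rA ;;
   Arith rAddr Plus rAddr rK ;; Arith rRem Minus rRem rK)"

text \<open>The machine has no remainder operation; the digit left in \<open>rB\<close> is computed
  from the quotient.\<close>

definition "next_digit =
  (Arith rA Divide rDigits rVerts ;; Arith rB Times rA rVerts ;; Arith rB Minus rDigits rB ;;
   mov rDigits rA)"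

text \<open>Truth values are computed by division: \<open>1 div (x + 1)\<close> is \<open>1\<close> for \<open>x = 0\<close> and \<open>0\<close> for \<open>x > 0\<close>.\<close>

definition "term_before =
  (next_digit ;; Arith rBlock Divide rB rD ;; Arith rA Times rBlock rD ;; Arith rX Minus rB rA ;;
   Arith rA Divide rBits rTwo ;; Arith rBit Times rA rTwo ;; Arith rBit Minus rBits rBit ;;
   mov rBits rA ;;
   Arith rA Plus rBlock rOne ;; Arith rA Divide rOne rA ;; Arith rA Times rA rEntry ;;
   Arith rY Minus rZero rA ;; Arith rAddr Plus rRow rBlock ;; Arith rRem Minus rN rBlock)"

text \<open>With \<open>w\<close> the quotient \<open>1 div (block - position + 1)\<close>, the sign
  is multiplied by \<open>1 - bit * (2 - w)\<close>. This is 1 if the bit is 0, and otherwise 0 or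
  -1 according to whether the block equals or exceeds the position. A block below its position never
  occurs, since only tuples with ascending blocks are evaluated.\<close>

definition "term_after =
  (Arith rA Minus rOne rBit ;; Arith rA Times rA rY ;; Arith rSum Plus rSum rA ;;
   Arith rA Minus rBlock rPos ;; Arith rA Plus rA rOne ;; Arith rA Divide rOne rA ;;
   Arith rA Minus rTwo rA ;; Arith rA Times rBit rA ;; Arith rA Minus rOne rA ;;
   Arith rSign Times rSign rA ;; Arith rPos Plus rPos rOne ;; Arith rCount Minus rCount rOne)"

definition "term_body = (term_before ;; WhilePos rRem column_body ;; term_after)"

text \<open>\<open>rBits\<close> receives the whole index, row included: the \<open>p\<close> rounds
  of the next loop read only its low \<open>p\<close> bits. The 4 in \<open>rFour\<close> is the
  length of the header before the basis.\<close>

definition "row_before =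
  (Arith rTerm Minus rTerm rOne ;; Arith rA Divide rTerm rMasks ;; Arith rB Times rA rN ;;
   Arith rRow Plus rFour rB ;; Arith rA Plus rTarget rA ;; Load rEntry rA ;;
   mov rBits rTerm ;; mov rDigits rCode ;; mov rPos rZero ;; mov rCount rP ;; mov rSign rOne ;;
   mov rSum rZero)"

definition "row_body =
  (row_before ;; WhilePos rCount term_body ;; (mov rBase rSum ;; mov rExp rP) ;; power_prog ;;
   (Arith rA Times rSign rPow ;; Arith rWeight Plus rWeight rA))"

text \<open>After the first descent \<open>rPrev\<close> is stale, but then \<open>rOk\<close> stays \<open>0\<close>.\<close>

definition "check_body =
  (next_digit ;; Arith rBlock Divide rB rD ;; Arith rA Minus rBlock rPrev ;;
   IfPos rA (mov rPrev rBlock) (Const rOk 0) ;; Arith rCount Minus rCount rOne)"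

definition "emit_body = (next_digit ;; Emit rB ;; Arith rCount Minus rCount rOne)"

text \<open>The last number emitted is the denominator of the integral weight.\<close>

definition "edge_output =
  ((mov rWeight rZero ;; Arith rTerm Times rM rMasks) ;; WhilePos rTerm row_body ;;
   (mov rDigits rCode ;; mov rCount rP) ;; WhilePos rCount emit_body ;;
   (Emit rWeight ;; Emit rOne))"

text \<open>Tuples are counted down from \<open>N ^ p\<close>, hence the decrement at the start. The
  value -1 of \<open>rPrev\<close> lies below every block number, so the first vertex always passes
  the check.\<close>

definition "edge_body =
  ((Arith rCode Minus rCode rOne ;; mov rDigits rCode ;; mov rCount rP ;; Const rPrev (- 1) ;;
    mov rOk rOne) ;;
   WhilePos rCount check_body ;; IfPos rOk edge_output (mov rA rZero))"

text \<open>The division of \<open>n + k - 1\<close> by \<open>k\<close> rounds \<open>n / k\<close>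
  up; it becomes the exponent of the block size.\<close>

definition "load_parameters =
  (Const rOne 1 ;; Const rTwo 2 ;; Const rFour 4 ;; Load rK rZero ;;
   Load rP rOne ;; Load rM rTwo ;; Arith rA Plus rTwo rOne ;; Load rN rA ;;
   Arith rA Plus rN rK ;; Arith rA Minus rA rOne ;; Arith rExp Divide rA rK ;; mov rBase rTwo)"

text \<open>The five calls of \<open>power_prog\<close> compute the block size, the number of masks,
  the number of tuples, and the powers of numerator and denominator of the distance bound.\<close>

definition "reduction_prog =
  (load_parameters ;; power_prog ;;
   (mov rD rPow ;; Arith rVerts Times rK rD ;; mov rBase rTwo ;; mov rExp rP) ;; power_prog ;;
   (mov rMasks rPow ;; mov rBase rVerts ;; mov rExp rP) ;; power_prog ;;
   (mov rCode rPow ;; Arith rA Times rM rN ;; Arith rTarget Plus rFour rA ;;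
    Arith rA Plus rTarget rM ;; Load rBase rA ;; Arith rA Plus rA rOne ;; Load rDen rA ;;
    mov rExp rP) ;; power_prog ;;
   (mov rNum rPow ;; mov rBase rDen ;; mov rExp rP) ;; power_prog ;;
   (Emit rK ;; Emit rP ;; Emit rVerts ;; Emit rNum ;; Emit rPow) ;;
   WhilePos rCode edge_body)"

section \<open>Verification of the program on a fixed input\<close>

lemma wp_power:
  assumes "R rZero = 0" "R rOne = 1" "R rBase = b" "R rExp = int e"
    and fits: "\<And>i. i \<le> e \<Longrightarrow> fits W (b ^ i)" "fits W (int e)"
    and post: "\<And>R'. \<forall>r<50. R' r = R r \<Longrightarrow> R' rPow = b ^ e \<Longrightarrow> Q R' os"
  shows "wp M W power_prog (e * 3 + 2) Q R os"
proof -
  have "wp M W (WhilePos rExp power_body) (e * (2 + 1) + 1) Q (R(rPow := 1)) os"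
  proof (rule wp_for_up[where I = "\<lambda>j R' os'. os' = os \<and> (\<forall>r<50. R' r = R r) \<and> R' rBase = b \<and>
      R' rPow = b ^ j \<and> R' rExp = int e - int j"])
    fix j R' os'
    assume j: "j < e" and I: "os' = os \<and> (\<forall>r<50. R' r = R r) \<and> R' rBase = b \<and>
      R' rPow = b ^ j \<and> R' rExp = int e - int j"
    have "fits W (b ^ j * b)" using fits(1)[of "Suc j"] j by (simp add: mult.commute)
    moreover have "fits W (int e - int j - 1)" using fits(2) by (rule fits_le) (use j in simp)
    ultimately show "wp M W power_body 2 (\<lambda>R' os'. os' = os \<and> (\<forall>r<50. R' r = R r) \<and> R' rBase = b \<and>
      R' rPow = b ^ Suc j \<and> R' rExp = int e - int (Suc j)) R' os'"
      unfolding power_body_def using I assms(2) j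
      by (intro wp_straightI) (simp_all add: mult.commute)
  qed (use assms in auto)
  then have "wp M W power_prog (straight_cost (mov rPow rOne) + (e * (2 + 1) + 1)) Q R os"
    unfolding power_prog_def using assms(1,2) fits(1)[of 0]
    by (intro wp_straight_Seq) simp
  then show ?thesis by (rule wp_mono) simp_all
qed

text \<open>\<open>A\<close> bounds the entries of basis and target, and \<open>W\<close> is any
  width that suffices for the listed magnitudes; the choice of \<open>W\<close> is thus separated
  from the verification. The quantity \<open>(n + 1) * A\<close> bounds the value of a vertex (up to
  \<open>n\<close> entries and the target), and \<open>p\<close> times it bounds the base of a
  power.\<close>

locale reduction_run =
  fixes n k p m c D N W A :: nat and B :: "nat \<Rightarrow> nat \<Rightarrow> int" and t :: "nat \<Rightarrow> int"
    and num den :: int and M :: "int \<Rightarrow> int"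
  assumes p: "2 \<le> p" and pk: "p \<le> k" and kn: "k \<le> n" and c: "c = (n + k - 1) div k"
    and D: "D = 2 ^ c" and N: "N = k * D"
    and mem_params: "M 0 = int k" "M 1 = int p" "M 2 = int m" "M 3 = int n"
    and mem_basis: "\<And>l j. l < m \<Longrightarrow> j < n \<Longrightarrow> M (int (4 + l * n + j)) = B l j"
    and mem_target: "\<And>l. l < m \<Longrightarrow> M (int (4 + m * n + l)) = t l"
    and mem_bound: "M (int (4 + m * n + m)) = num" "M (int (4 + m * n + m + 1)) = den"
    and A: "1 \<le> A" "\<And>l j. l < m \<Longrightarrow> j < n \<Longrightarrow> \<bar>B l j\<bar> \<le> int A" "\<And>l. l < m \<Longrightarrow> \<bar>t l\<bar> \<le> int A"
    and width_small: "m * n + 2 * m + 2 * n + 20 < 2 ^ W"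
    and width_counters: "N ^ p < 2 ^ W" "m * 2 ^ p < 2 ^ W"
    and width_values: "(p * ((n + 1) * A)) ^ p < 2 ^ W" "m * 2 ^ p * (p * ((n + 1) * A)) ^ p < 2 ^ W"
    and width_bound: "\<And>i. i \<le> p \<Longrightarrow> fits W (num ^ i)" "\<And>i. i \<le> p \<Longrightarrow> fits W (den ^ i)"
begin

lemma fits_int: "x < 2 ^ W \<Longrightarrow> fits W (int x)"
  unfolding fits_def by (metis abs_of_nat of_nat_less_iff of_nat_numeral of_nat_power)

lemma fits_small: "\<bar>x\<bar> \<le> int (m * n + 2 * m + 2 * n + 20) \<Longrightarrow> fits W x"
  using fits_int[OF width_small] by (rule fits_le) simp

lemma fits_value: "\<bar>x\<bar> \<le> int (p * ((n + 1) * A)) \<Longrightarrow> fits W x"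
proof (rule fits_le[OF fits_int[OF width_values(1)]])
  assume "\<bar>x\<bar> \<le> int (p * ((n + 1) * A))"
  also have "\<dots> \<le> int ((p * ((n + 1) * A)) ^ p)"
    using p A(1) by (subst of_nat_le_iff, intro self_le_power) auto
  finally show "\<bar>x\<bar> \<le> \<bar>int ((p * ((n + 1) * A)) ^ p)\<bar>" by simp
qed

definition env :: "(reg \<Rightarrow> int) \<Rightarrow> bool" where
  "env R \<longleftrightarrow> R rZero = 0 \<and> R rOne = 1 \<and> R rTwo = 2 \<and> R rFour = 4 \<and> R rK = int k \<and> R rP = int p \<and>
     R rM = int m \<and> R rN = int n \<and> R rD = int D \<and> R rVerts = int N \<and> R rMasks = 2 ^ p \<and>
     R rTarget = int (4 + m * n)"

lemma envD:
  assumes "env R"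
  shows "R rZero = 0" "R rOne = 1" "R rTwo = 2" "R rFour = 4" "R rK = int k" "R rP = int p"
    "R rM = int m" "R rN = int n" "R rD = int D" "R rVerts = int N" "R rMasks = 2 ^ p"
    "R rTarget = int (4 + m * n)"
  using assms by (auto simp: env_def)

text \<open>Among the \<open>k\<close> consecutive indices from \<open>u\<close> on, only
  \<open>u\<close> itself is congruent to \<open>e\<close> modulo \<open>k\<close>.\<close>

lemma column_sum_step:
  assumes "u mod k = e" "u < n"
  shows "(\<Sum>j | j < n \<and> j < u + k \<and> j mod k = e. f j) =
    (\<Sum>j | j < n \<and> j < u \<and> j mod k = e. f j) + (f u :: int)"
proof -
  have "j = u" if "j < u + k" "\<not> j < u" "j mod k = e" for j
  proof -
    have "k dvd j - u" using that assms by (metis mod_eq_dvd_iff_nat not_less)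
    then have "j - u = 0" using that by (metis dvd_imp_le add_diff_cancel_left' diff_less_mono2 leD less_diff_conv2 linorder_not_less neq0_conv add.commute)
    then show ?thesis using that by simp
  qed
  moreover have "0 < k" using p pk by simp
  ultimately have "{j. j < n \<and> j < u + k \<and> j mod k = e} = insert u {j. j < n \<and> j < u \<and> j mod k = e}"
    using assms by auto
  then show ?thesis by simp
qed

lemma column_sum_bound:
  assumes "l < m"
  shows "\<bar>\<Sum>j | j < n \<and> P j. B l j * int (bit_of x (f j))\<bar> \<le> int (n * A)"
proof -
  have "\<bar>\<Sum>j | j < n \<and> P j. B l j * int (bit_of x (f j))\<bar> \<le> (\<Sum>j | j < n \<and> P j. \<bar>B l j * int (bit_of x (f j))\<bar>)"
    by (rule sum_abs)
  also have "\<dots> \<le> (\<Sum>j | j < n \<and> P j. int A)"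
  proof (rule sum_mono)
    fix j assume "j \<in> {j. j < n \<and> P j}"
    then have "\<bar>B l j\<bar> \<le> int A" using A(2) assms by auto
    then show "\<bar>B l j * int (bit_of x (f j))\<bar> \<le> int A"
      using bit_of_cases[of x "f j"] by auto
  qed
  also have "\<dots> \<le> int (n * A)"
  proof -
    have "card {j. j < n \<and> P j} \<le> card {..<n}" by (rule card_mono) auto
    then show ?thesis by (simp add: mult_right_mono)
  qed
  finally show ?thesis .
qed

text \<open>The counter drops by \<open>k\<close> and may become negative, so the rules for counting
  loops do not fit. The variant is \<open>n - (e + k * b)\<close> in truncated subtraction: after
  \<open>b\<close> rounds the next column is \<open>e + k * b\<close>, and its coefficient is the
  lowest bit of \<open>x div 2 ^ b\<close>. Charging up to \<open>n\<close> rounds, not about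
  \<open>n / k\<close>, affects only the polynomial.\<close>

lemma wp_column:
  assumes R: "env R" "R rX = int x" "R rAddr = int (4 + l * n + e)" "R rRem = int n - int e" "R rY = y0"
    and "x < D" "e < k" "l < m" "\<bar>y0\<bar> \<le> int A"
    and post: "\<And>R'. \<forall>r<40. R' r = R r \<Longrightarrow>
      R' rY = y0 + (\<Sum>j | j < n \<and> j mod k = e. B l j * int (bit_of x (j div k))) \<Longrightarrow> Q R' os"
  shows "wp M W (WhilePos rRem column_body) (n * 10 + 1) Q R os"
proof -
  define f where "f j = B l j * int (bit_of x (j div k))" for j
  define ps where "ps u = (\<Sum>j | j < n \<and> j < u \<and> j mod k = e. f j)" for u
  have k: "0 < k" using p pk by simp
  have ln: "l * n + n \<le> m * n"
    using mult_le_mono1[of "Suc l" m n] \<open>l < m\<close> by simp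
  have Ap: "int ((n + 1) * A) \<le> int (p * ((n + 1) * A))" using p by (simp only: of_nat_le_iff) simp
  have ps: "\<bar>y0 + ps u\<bar> \<le> int ((n + 1) * A)" for u
  proof -
    have "\<bar>ps u\<bar> \<le> int (n * A)" unfolding ps_def f_def
      using column_sum_bound[OF \<open>l < m\<close>, where P = "\<lambda>j. j < u \<and> j mod k = e"] by simp
    then show ?thesis using \<open>\<bar>y0\<bar> \<le> int A\<close> by (simp add: algebra_simps)
  qed
  have Dn: "int D \<le> int (N ^ p)"
  proof -
    have "D \<le> N" using k by (simp add: N)
    also have "\<dots> \<le> N ^ p" using p k by (intro self_le_power) (auto simp: N D)
    finally show ?thesis by simp
  qed
  define I where "I i R' os' \<longleftrightarrow> os' = os \<and> (\<forall>r<40. R' r = R r) \<and> (\<exists>b. i = n - (e + k * b) \<and>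
      e + k * b < n + k \<and> R' rX = int (x div 2 ^ b) \<and> R' rAddr = int (4 + l * n + (e + k * b)) \<and>
      R' rRem = int n - int (e + k * b) \<and> R' rY = y0 + ps (e + k * b))" for i R' os'
  have ps0: "ps e = 0"
  proof -
    have "{j. j < n \<and> j < e \<and> j mod k = e} = {}" using \<open>e < k\<close> by auto
    then show ?thesis unfolding ps_def by (simp only: sum.empty)
  qed
  have "wp M W (WhilePos rRem column_body) ((n - e) * (9 + 1) + 1) Q R os"
  proof (rule wp_WhilePos[where I = I])
    show "I (n - e) R os"
      unfolding I_def using R assms kn ps0 by (auto intro!: exI[of _ 0])
  next
    fix i R' os' assume I: "I i R' os'" and pos: "R' rRem > 0"
    from I obtain b X where b: "i = n - (e + k * b)" and X: "X = x div 2 ^ b"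
      and R': "os' = os" "\<forall>r<40. R' r = R r" "R' rX = int X" "R' rAddr = int (4 + l * n + (e + k * b))"
      "R' rRem = int n - int (e + k * b)" "R' rY = y0 + ps (e + k * b)"
      unfolding I_def by blast
    define u where "u = e + k * b"
    have "u < n" using R'(5) pos unfolding u_def by linarith
    then have u: "u mod k = e" "u div k = b" "u < n" using \<open>e < k\<close> by (auto simp: u_def)
    have step: "ps (u + k) = ps u + int (X mod 2) * B l u"
      using column_sum_step[OF u(1,3), of f] by (simp add: ps_def f_def u X bit_of_def)
    have mem: "M (int (4 + l * n + u)) = B l u" using mem_basis \<open>l < m\<close> u(3) by blast
    have fitsX: "fits W (int y)" if "y \<le> X" for y
    proof -
      have "y \<le> x" using that X by (meson div_le_dividend le_trans)
      then show ?thesis using Dn \<open>x < D\<close> by (intro fits_le[OF fits_int[OF width_counters(1)]]) simp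
    qed
    have eqs: "int X div 2 = int (X div 2)" "int (X div 2) * 2 = int (X div 2 * 2)"
      "int X - int (X div 2 * 2) = int (X mod 2)"
      by (simp_all add: zdiv_int minus_div_mult_eq_mod zmod_int)
    have fits: "fits W (int (X div 2))" "fits W (int (X div 2 * 2))" "fits W (int (X mod 2))"
      "fits W (B l u)" "fits W (int (X mod 2) * B l u)" "fits W (y0 + ps u + int (X mod 2) * B l u)"
      "fits W (int (4 + l * n + u) + int k)" "fits W (int n - int u - int k)"
    proof -
      have B: "\<bar>B l u\<bar> \<le> int A" using A(2) \<open>l < m\<close> u(3) by blast
      have "int A \<le> int (p * ((n + 1) * A))"
        by (rule order_trans[OF _ Ap]) (simp only: of_nat_le_iff, simp)
      then show "fits W (B l u)" "fits W (int (X mod 2) * B l u)"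
        using B by (auto intro!: fits_value simp: mod2_eq_if)
      show "fits W (y0 + ps u + int (X mod 2) * B l u)"
        using ps[of "u + k"] Ap by (intro fits_value) (simp add: step)
      show "fits W (int (4 + l * n + u) + int k)" "fits W (int n - int u - int k)"
        using ln \<open>u < n\<close> kn by (intro fits_small; simp flip: of_nat_mult; fail)+
    qed (use fitsX in \<open>auto intro!: fitsX simp del: of_nat_mult\<close>)
    have less: "n - (u + k) < i" using \<open>u < n\<close> k by (simp add: b u_def)
    have I_next: "I (n - (u + k)) R'' os" if "\<forall>r<40. R'' r = R r" "R'' rX = int (X div 2)"
      "R'' rAddr = int (4 + l * n + u) + int k" "R'' rRem = int n - int u - int k"
      "R'' rY = y0 + ps u + int (X mod 2) * B l u" for R''
    proof -
      have eq: "u + k = e + k * Suc b" by (simp add: u_def)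
      have "X div 2 = x div 2 ^ Suc b" by (simp only: X power_Suc2 div_mult2_eq)
      then have "n - (u + k) = n - (u + k) \<and> u + k < n + k \<and> R'' rX = int (x div 2 ^ Suc b) \<and>
          R'' rAddr = int (4 + l * n + (u + k)) \<and> R'' rRem = int n - int (u + k) \<and>
          R'' rY = y0 + ps (u + k)"
        using that \<open>u < n\<close> by (simp add: step)
      then show ?thesis unfolding I_def eq using that(1) by blast
    qed
    show "wp M W column_body 9 (\<lambda>R' os'. \<exists>j<i. I j R' os') R' os'"
      unfolding column_body_def
      using R' envD[OF R(1)] fits mem
      apply (intro wp_straightI)
      by (simp_all add: eqs u_def[symmetric] less del: of_nat_add of_nat_mult)
        (intro exI[of _ "n - (u + k)"] conjI less I_next; simp del: of_nat_add of_nat_mult)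
  next
    fix i R' os' assume I: "I i R' os'" and neg: "R' rRem \<le> 0"
    then obtain b where b: "R' rRem = int n - int (e + k * b)" "R' rY = y0 + ps (e + k * b)"
      "os' = os" "\<forall>r<40. R' r = R r"
      unfolding I_def by blast
    then have "n \<le> e + k * b" using neg by linarith
    then have "ps (e + k * b) = (\<Sum>j | j < n \<and> j mod k = e. f j)"
      unfolding ps_def by (intro sum.cong) auto
    then show "Q R' os'" using post b by (simp add: f_def)
  qed
  then show ?thesis by (rule wp_mono) simp_all
qed


text \<open>A tuple of \<open>p\<close> vertices is represented by the number with these digits in base \<open>N\<close>.\<close>

definition digit :: "nat \<Rightarrow> nat \<Rightarrow> nat" where
  "digit q j = q div N ^ j mod N"

abbreviation "val \<equiv> vertex_value B t n k D"

lemma k_pos: "0 < k" and D_pos: "0 < D" and N_pos: "0 < N"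
  using p pk by (auto simp: D N)

lemma digit_less: "digit q j < N"
  using N_pos by (simp add: digit_def)

lemma digit_block_less: "digit q j div D < k"
  using digit_less[of q j] by (simp add: N less_mult_imp_div_less)

lemma D_le: "D \<le> N ^ p"
proof -
  have "D \<le> N" using k_pos by (simp add: N)
  also have "\<dots> \<le> N ^ p" using p N_pos by (intro self_le_power) auto
  finally show ?thesis .
qed

lemma N_le: "N \<le> N ^ p"
  using p N_pos by (intro self_le_power) auto

lemma fits_code: "x \<le> N ^ p \<Longrightarrow> fits W (int x)"
  using width_counters(1) by (intro fits_int) simp

lemma fits_mask: "x \<le> m * 2 ^ p \<Longrightarrow> fits W (int x)"
  using width_counters(2) by (intro fits_int) simp

lemma fits_smallI: "\<bar>x\<bar> \<le> int m * int n + 2 * int m + 2 * int n + 20 \<Longrightarrow> fits W x"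
  by (rule fits_small) simp

lemma val_bound:
  assumes "l < m"
  shows "\<bar>val l v\<bar> \<le> int ((n + 1) * A)"
proof -
  have "\<bar>\<Sum>j | j < n \<and> j mod k = v div D. B l j * int (bit_of (v mod D) (j div k))\<bar> \<le> int (n * A)"
    by (rule column_sum_bound[OF assms])
  moreover have "\<bar>if v div D = 0 then t l else 0\<bar> \<le> int A" using A(3)[OF assms] by auto
  ultimately show ?thesis unfolding vertex_value_def by (simp add: algebra_simps)
qed

text \<open>Stated for partial sums because every intermediate value of the accumulating register
  has to fit into the width.\<close>

lemma term_base_partial_bound:
  assumes "l < m" "j \<le> p"
  shows "\<bar>\<Sum>i<j. (1 - int (bit_of r i)) * val l (f i)\<bar> \<le> int (p * ((n + 1) * A))"
proof -
  have "\<bar>\<Sum>i<j. (1 - int (bit_of r i)) * val l (f i)\<bar> \<le> (\<Sum>i<j. \<bar>(1 - int (bit_of r i)) * val l (f i)\<bar>)"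
    by (rule sum_abs)
  also have "\<dots> \<le> (\<Sum>i<j. int ((n + 1) * A))"
  proof (rule sum_mono)
    fix i
    show "\<bar>(1 - int (bit_of r i)) * val l (f i)\<bar> \<le> int ((n + 1) * A)"
      using bit_of_cases[of r i] val_bound[OF assms(1), of "f i"] by auto
  qed
  also have "\<dots> = int (j * ((n + 1) * A))" by simp
  also have "\<dots> \<le> int (p * ((n + 1) * A))" using assms(2) by (simp only: of_nat_le_iff mult_le_mono1)
  finally show ?thesis .
qed

definition sign_factor :: "nat \<Rightarrow> nat \<Rightarrow> nat \<Rightarrow> int" where
  "sign_factor q r j = (if bit_of r j = 0 then 1 else if digit q j div D \<noteq> j then - 1 else 0)"

lemma wp_term_body:
  assumes env: "env R" and R: "R rEntry = t l" "R rRow = int (4 + l * n)" "R rDigits = int (q div N ^ j)"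
      "R rBits = int (r div 2 ^ j)" "R rPos = int j" "R rCount = int p - int j"
    and "\<bar>R rSign\<bar> \<le> 1" "j < p" "l < m" "q < N ^ p" "r < m * 2 ^ p" "j \<le> digit q j div D"
    and sum: "\<bar>R rSum + (1 - int (bit_of r j)) * val l (digit q j)\<bar> \<le> int (p * ((n + 1) * A))"
    and post: "\<And>R'. \<forall>r<30. R' r = R r \<Longrightarrow> R' rDigits = int (q div N ^ Suc j) \<Longrightarrow>
      R' rBits = int (r div 2 ^ Suc j) \<Longrightarrow> R' rPos = int (Suc j) \<Longrightarrow> R' rCount = int p - int (Suc j) \<Longrightarrow>
      R' rSign = R rSign * sign_factor q r j \<Longrightarrow>
      R' rSum = R rSum + (1 - int (bit_of r j)) * val l (digit q j) \<Longrightarrow> Q R' os"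
  shows "wp M W term_body (n * 10 + 30) Q R os"
proof -
  define Q1 where "Q1 = q div N ^ j"
  define U1 where "U1 = r div 2 ^ j"
  define v where "v = digit q j"
  define e where "e = v div D"
  define x where "x = v mod D"
  define b where "b = bit_of r j"
  define y where "y = val l v"
  define fac where "fac = sign_factor q r j"
  have v: "v = Q1 mod N" by (simp add: v_def digit_def Q1_def)
  have b: "b = U1 mod 2" by (simp add: b_def bit_of_def U1_def)
  have e: "e < k" "j \<le> e" using digit_block_less \<open>j \<le> digit q j div D\<close> by (simp_all add: e_def v_def)
  have x: "x < D" using D_pos by (simp add: x_def)
  have nxt: "Q1 div N = q div N ^ Suc j" "U1 div 2 = r div 2 ^ Suc j"
    by (simp_all only: Q1_def U1_def power_Suc2 div_mult2_eq)
  have Q1: "Q1 \<le> N ^ p" using \<open>q < N ^ p\<close> unfolding Q1_def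
    by (meson div_le_dividend le_trans less_imp_le)
  have U1: "U1 \<le> m * 2 ^ p" using \<open>r < m * 2 ^ p\<close> unfolding U1_def
    by (meson div_le_dividend le_trans less_imp_le)
  have ln: "int l * int n + int n \<le> int m * int n"
    using of_nat_mono[OF mult_le_mono1[of "Suc l" m n], where 'a = int] \<open>l < m\<close> by simp
  have ln0: "0 \<le> int l * int n" by simp
  have sizes: "int e < int k" "int k \<le> int n" "int j < int p" "int p \<le> int k" "int j \<le> int e"
    using e pk kn \<open>j < p\<close> by auto
  \<comment> \<open>The quotient is the indicator of \<open>e = j\<close> because
    \<open>j <= e\<close> makes the divisor positive.\<close>
  define w where "w = 1 div (int e - int j + 1)"
  have w: "w = (if e = j then 1 else 0)" using sizes(5) by (auto simp: w_def)
  have eqs: "int Q1 div int N = int (Q1 div N)" "int (Q1 div N) * int N = int (Q1 div N * N)"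
    "int Q1 - int (Q1 div N * N) = int v" "int v div int D = int e" "int e * int D = int (e * D)"
    "int v - int (e * D) = int x" "int U1 div 2 = int (U1 div 2)" "int (U1 div 2) * 2 = int (U1 div 2 * 2)"
    "int U1 - int (U1 div 2 * 2) = int b"
    by (simp_all add: zdiv_int minus_div_mult_eq_mod zmod_int v b e_def x_def)
  \<comment> \<open>Indicator of block 0, to which the target is charged; the column loop therefore
    starts from \<open>- (iv * t l)\<close>.\<close>
  define iv :: int where "iv = (if e = 0 then 1 else 0)"
  have ind: "1 div (int e + 1) = iv" by (simp add: iv_def)
  have iv01: "iv = 0 \<or> iv = 1" by (simp add: iv_def)
  have fits1: "fits W (int (Q1 div N))" "fits W (int (Q1 div N * N))" "fits W (int v)" "fits W (int e)"
    "fits W (int (e * D))" "fits W (int x)"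
  proof -
    have "v \<le> N ^ p" using digit_less[of q j] N_le by (simp add: v_def)
    moreover have "e \<le> v" "e * D \<le> v" "x \<le> v" by (simp_all add: e_def x_def div_times_less_eq_dividend)
    moreover have "Q1 div N \<le> N ^ p" "Q1 div N * N \<le> N ^ p"
      using order_trans[OF div_le_dividend Q1] order_trans[OF div_times_less_eq_dividend Q1] by blast+
    ultimately show "fits W (int (Q1 div N))" "fits W (int (Q1 div N * N))" "fits W (int v)" "fits W (int e)"
      "fits W (int (e * D))" "fits W (int x)"
      by (auto intro!: fits_code simp del: of_nat_mult)
  qed
  have fits2: "fits W (int (U1 div 2))" "fits W (int (U1 div 2 * 2))" "fits W (int b)"
    using U1 b div_le_dividend[of U1 2] mod_less_eq_dividend[of U1 2]
    by (auto intro!: fits_mask simp del: of_nat_mult)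
  have fits3: "fits W (int e + 1)" "fits W (int (4 + l * n) + int e)" "fits W (int n - int e)"
    using sizes ln ln0 by (intro fits_smallI; simp only: of_nat_add of_nat_mult of_nat_numeral; linarith)+
  have tl: "\<bar>t l\<bar> \<le> int A" using A(3) \<open>l < m\<close> by blast
  have Ap: "int A \<le> int (p * ((n + 1) * A))"
  proof -
    have "A \<le> (n + 1) * A" "(n + 1) * A \<le> p * ((n + 1) * A)" using p by simp_all
    then show ?thesis by (simp only: of_nat_le_iff)
  qed
  have fits4: "fits W iv" "fits W (iv * t l)"
    "fits W (0 - iv * t l)"
    using iv01 tl Ap by (auto intro: fits_smallI fits_value)
  define T where "T = n * 10 + 1 + (12 :: nat)"
  have cont: "wp M W (WhilePos rRem column_body ;; term_after) T Q R1 os"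
    if R1: "env R1" "\<forall>r<30. R1 r = R r" "R1 rDigits = int (q div N ^ Suc j)" "R1 rBits = int (r div 2 ^ Suc j)"
      "R1 rPos = int j" "R1 rCount = int p - int j" "R1 rSign = R rSign" "R1 rSum = R rSum"
      "R1 rBlock = int e" "R1 rBit = int b" "R1 rX = int x" "R1 rAddr = int (4 + l * n + e)"
      "R1 rRem = int n - int e" "R1 rY = - (iv * t l)" for R1
    unfolding T_def
  proof (rule wp_Seq, rule wp_column[where ?y0.0 = "- (iv * t l)", OF R1(1) R1(11,12,13,14) x e(1) \<open>l < m\<close>])
    show "\<bar>- (iv * t l)\<bar> \<le> int A" using iv01 tl by auto
  next
    fix R2
    assume R2: "\<forall>r<40. R2 r = R1 r" and "R2 rY = - (iv * t l) +
      (\<Sum>j | j < n \<and> j mod k = e. B l j * int (bit_of x (j div k)))"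
    then have Y: "R2 rY = y" by (simp add: y_def vertex_value_def e_def x_def iv_def)
    have y: "\<bar>y\<bar> \<le> int (p * ((n + 1) * A))"
    proof -
      have "int ((n + 1) * A) \<le> int (p * ((n + 1) * A))" using p by (simp only: of_nat_le_iff) simp
      then show ?thesis using val_bound[OF \<open>l < m\<close>, of v] by (simp add: y_def)
    qed
    have b01: "b = 0 \<or> b = 1" using b by auto
    have w01: "w = 0 \<or> w = 1" by (simp add: w)
    have fits: "fits W (1 - int b)" "fits W ((1 - int b) * y)" "fits W (R rSum + (1 - int b) * y)"
      "fits W (int e - int j)" "fits W (int e - int j + 1)" "fits W w" "fits W (2 - w)"
      "fits W (int b * (2 - w))" "fits W (1 - int b * (2 - w))" "fits W (R rSign * fac)"
      "fits W (int j + 1)" "fits W (int p - int j - 1)"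
    proof -
      show "fits W (R rSum + (1 - int b) * y)" using sum by (intro fits_value) (simp add: b_def y_def v_def)
      show "fits W ((1 - int b) * y)" using b01 y by (auto intro: fits_value fits_small)
      have "\<bar>R rSign * fac\<bar> \<le> 1"
        using \<open>\<bar>R rSign\<bar> \<le> 1\<close> by (simp add: fac_def sign_factor_def)
      then show "fits W (R rSign * fac)" using ln ln0 by (intro fits_smallI) linarith
      have "0 \<le> int b * (2 - w)" "int b * (2 - w) \<le> 2" using b01 w01 by auto
      then show "fits W (1 - int b)" "fits W (int e - int j)" "fits W (int e - int j + 1)" "fits W w" "fits W (2 - w)"
        "fits W (int b * (2 - w))" "fits W (1 - int b * (2 - w))" "fits W (int j + 1)" "fits W (int p - int j - 1)"
        using b01 w01 sizes ln ln0 by (intro fits_smallI; linarith)+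
    qed
    have fac: "1 - int b * (2 - w) = fac"
      using b01 by (auto simp: fac_def sign_factor_def w simp flip: b_def v_def e_def)
    show "wp M W term_after 12 Q R2 os"
      unfolding term_after_def
      using R2 Y R1(3-10) envD[OF R1(1)] fits fac
      by (intro wp_straightI)
        (simp_all add: w_def[symmetric] del: of_nat_add of_nat_mult of_nat_Suc power_Suc,
          intro post, simp_all add: R1(2) b_def y_def v_def fac_def mult.commute)
  qed
  have "straight M W term_before (wp M W (WhilePos rRem column_body ;; term_after) T Q) R os"
    unfolding term_before_def next_digit_def
    using R(1,2,5,6) R(3)[folded Q1_def] R(4)[folded U1_def] envD[OF env] fits1 fits2 fits3 fits4
    by (simp_all add: eqs ind del: of_nat_add of_nat_mult power_Suc)
      (intro cont; simp add: env_def nxt)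
  from wp_straight_Seq[OF this] show ?thesis
    unfolding term_body_def
    by (rule wp_mono) (simp_all add: term_before_def next_digit_def T_def)
qed


lemma wp_terms:
  assumes env: "env R" and R: "R rEntry = t l" "R rRow = int (4 + l * n)" "R rDigits = int q"
      "R rBits = int r" "R rPos = 0" "R rCount = int p" "R rSign = 1" "R rSum = 0"
    and "l < m" "q < N ^ p" "r < m * 2 ^ p" and ord: "\<And>j. j < p \<Longrightarrow> j \<le> digit q j div D"
    and post: "\<And>R'. \<forall>r<30. R' r = R r \<Longrightarrow> R' rSign = term_sign p D (digit q) r \<Longrightarrow>
      R' rSum = term_base p (val l) (digit q) r \<Longrightarrow> Q R' os"
  shows "wp M W (WhilePos rCount term_body) (p * (n * 10 + 31) + 1) Q R os"
proof -
  have "wp M W (WhilePos rCount term_body) (p * (n * 10 + 30 + 1) + 1) Q R os"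
  proof (rule wp_for_up[where I = "\<lambda>j R' os'. os' = os \<and> (\<forall>r<30. R' r = R r) \<and>
      R' rDigits = int (q div N ^ j) \<and> R' rBits = int (r div 2 ^ j) \<and> R' rPos = int j \<and>
      R' rCount = int p - int j \<and> R' rSign = (\<Prod>i<j. sign_factor q r i) \<and>
      R' rSum = (\<Sum>i<j. (1 - int (bit_of r i)) * val l (digit q i))"])
    fix j R' os'
    assume j: "j < p" and I: "os' = os \<and> (\<forall>r<30. R' r = R r) \<and>
      R' rDigits = int (q div N ^ j) \<and> R' rBits = int (r div 2 ^ j) \<and> R' rPos = int j \<and>
      R' rCount = int p - int j \<and> R' rSign = (\<Prod>i<j. sign_factor q r i) \<and>
      R' rSum = (\<Sum>i<j. (1 - int (bit_of r i)) * val l (digit q i))"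
    have "\<bar>\<Prod>i<j. sign_factor q r i\<bar> \<le> 1"
      unfolding abs_prod by (rule prod_le_1) (simp add: sign_factor_def)
    then have sg: "\<bar>R' rSign\<bar> \<le> 1" using I by simp
    have sm: "\<bar>R' rSum + (1 - int (bit_of r j)) * val l (digit q j)\<bar> \<le> int (p * ((n + 1) * A))"
      using term_base_partial_bound[OF \<open>l < m\<close>, of "Suc j" r "digit q"] j I by simp
    have env': "env R'" using env I by (simp add: env_def)
    have R': "R' rEntry = t l" "R' rRow = int (4 + l * n)" "R' rDigits = int (q div N ^ j)"
      "R' rBits = int (r div 2 ^ j)" "R' rPos = int j" "R' rCount = int p - int j"
      using I R by simp_all
    show "wp M W term_body (n * 10 + 30) (\<lambda>R' os'. os' = os \<and> (\<forall>r<30. R' r = R r) \<and>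
      R' rDigits = int (q div N ^ Suc j) \<and> R' rBits = int (r div 2 ^ Suc j) \<and> R' rPos = int (Suc j) \<and>
      R' rCount = int p - int (Suc j) \<and> R' rSign = (\<Prod>i<Suc j. sign_factor q r i) \<and>
      R' rSum = (\<Sum>i<Suc j. (1 - int (bit_of r i)) * val l (digit q i))) R' os'"
      by (rule wp_term_body[OF env' R' sg j assms(10-12) ord[OF j] sm])
        (use I in \<open>simp add: power_Suc2 del: power_Suc\<close>)
  qed (use R post in \<open>auto simp: term_sign_def term_base_def sign_factor_def\<close>)
  then show ?thesis by (rule wp_mono) simp_all
qed

definition term_value :: "nat \<Rightarrow> nat \<Rightarrow> int" where
  "term_value q r = term_sign p D (digit q) r * term_base p (val (r div 2 ^ p)) (digit q) r ^ p"

lemma abs_term_sign: "\<bar>term_sign p D vs r\<bar> \<le> 1"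
  unfolding term_sign_def abs_prod by (rule prod_le_1) simp

lemma abs_term_base:
  assumes "l < m"
  shows "\<bar>term_base p (val l) vs r\<bar> \<le> int (p * ((n + 1) * A))"
  unfolding term_base_def using term_base_partial_bound[OF assms, of p r vs] by simp

lemma abs_term_value:
  assumes "r < m * 2 ^ p"
  shows "\<bar>term_value q r\<bar> \<le> int ((p * ((n + 1) * A)) ^ p)"
proof -
  have "r div 2 ^ p < m" using assms by (simp add: less_mult_imp_div_less)
  then have "\<bar>term_base p (val (r div 2 ^ p)) (digit q) r\<bar> ^ p \<le> int (p * ((n + 1) * A)) ^ p"
    by (intro power_mono abs_term_base) auto
  then show ?thesis
    unfolding term_value_def abs_mult power_abs[symmetric] of_nat_power
    using abs_term_sign[of "digit q" r] mult_mono[of "\<bar>term_sign p D (digit q) r\<bar>" 1] by fastforce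
qed

text \<open>The index of the outer loop runs downwards, so the intermediate weights are sums over
  upper parts of the range.\<close>

lemma fits_weight:
  assumes "i \<le> m * 2 ^ p"
  shows "fits W (\<Sum>r\<in>{i..<m * 2 ^ p}. term_value q r)"
proof (rule fits_le[OF fits_int[OF width_values(2)]])
  have "\<bar>\<Sum>r\<in>{i..<m * 2 ^ p}. term_value q r\<bar> \<le> (\<Sum>r\<in>{i..<m * 2 ^ p}. \<bar>term_value q r\<bar>)"
    by (rule sum_abs)
  also have "\<dots> \<le> (\<Sum>r\<in>{i..<m * 2 ^ p}. int ((p * ((n + 1) * A)) ^ p))"
    by (intro sum_mono abs_term_value) simp
  also have "\<dots> = int ((m * 2 ^ p - i) * (p * ((n + 1) * A)) ^ p)" by simp
  also have "\<dots> \<le> int (m * 2 ^ p * (p * ((n + 1) * A)) ^ p)"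
    by (simp only: of_nat_le_iff) (intro mult_le_mono1, simp)
  finally show "\<bar>\<Sum>r\<in>{i..<m * 2 ^ p}. term_value q r\<bar> \<le> \<bar>int (m * 2 ^ p * (p * ((n + 1) * A)) ^ p)\<bar>"
    by simp
qed

lemma wp_row_body:
  assumes env: "env R" and R: "R rCode = int q" "R rTerm = int (Suc i)"
    and "q < N ^ p" "i < m * 2 ^ p" and ord: "\<And>j. j < p \<Longrightarrow> j \<le> digit q j div D"
    and wt: "fits W (R rWeight + term_value q i)"
    and post: "\<And>R'. \<forall>r<20. R' r = R r \<Longrightarrow> R' rTerm = int i \<Longrightarrow>
      R' rWeight = R rWeight + term_value q i \<Longrightarrow> Q R' os"
  shows "wp M W row_body (p * (n * 10 + 34) + 19) Q R os"
proof -
  define l where "l = i div 2 ^ p"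
  have l: "l < m" using assms by (simp add: l_def less_mult_imp_div_less)
  have ln: "int l * int n + int n \<le> int m * int n"
    using of_nat_mono[OF mult_le_mono1[of "Suc l" m n], where 'a = int] l by simp
  have ln0: "0 \<le> int l * int n" by simp
  have lm: "int l < int m" using l by simp
  define s where "s = term_base p (val l) (digit q) i"
  have tv: "term_sign p D (digit q) i * s ^ p = term_value q i"
    by (simp add: term_value_def s_def l_def)
  have fits_pow: "fits W (s ^ j)" if "j \<le> p" for j
  proof (rule fits_le[OF fits_int[OF width_values(1)]])
    let ?S = "int (p * ((n + 1) * A))"
    have "1 \<le> ?S" using p A(1) by (simp add: Suc_le_eq flip: of_nat_mult)
    have "\<bar>s ^ j\<bar> \<le> ?S ^ j"
      unfolding power_abs s_def by (intro power_mono abs_term_base l) simp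
    also have "\<dots> \<le> ?S ^ p" using \<open>1 \<le> ?S\<close> that by (rule power_increasing[rotated])
    finally show "\<bar>s ^ j\<bar> \<le> \<bar>int ((p * ((n + 1) * A)) ^ p)\<bar>" by simp
  qed
  have fits_term: "fits W (term_value q i)"
    using abs_term_value[OF \<open>i < m * 2 ^ p\<close>] by (intro fits_le[OF fits_int[OF width_values(1)]]) simp
  have fits_sign: "fits W (term_sign p D (digit q) i)"
    using abs_term_sign[of "digit q" i] ln ln0 by (intro fits_smallI) linarith
  have i: "fits W (int i)" using assms by (intro fits_mask) simp
  have q: "fits W (int q)" using assms by (intro fits_code) simp
  have small: "fits W (int l)" "fits W (int l * int n)" "fits W (4 + int l * int n)"
    "fits W (int (4 + m * n) + int l)" "fits W (int p)" "fits W 1" "fits W 0"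
    using ln ln0 lm p pk kn by (intro fits_smallI; simp only: of_nat_add of_nat_mult of_nat_numeral; linarith)+
  have "\<bar>t l\<bar> \<le> int (p * ((n + 1) * A))"
  proof -
    have "A \<le> (n + 1) * A" "(n + 1) * A \<le> p * ((n + 1) * A)" using p by simp_all
    then have "int A \<le> int (p * ((n + 1) * A))" by (simp only: of_nat_le_iff)
    then show ?thesis using A(3)[OF l] by linarith
  qed
  then have fits_t: "fits W (t l)" by (rule fits_value)
  have mem: "M (int (4 + m * n) + int l) = t l" using mem_target[OF l] by simp
  have div: "int i div 2 ^ p = int l" by (simp add: l_def zdiv_int)
  \<comment> \<open>The segments are treated from the last to the first: each of the following facts
    gives the precondition of all the code that remains at that point.\<close>
  have last: "wp M W (Arith rA Times rSign rPow ;; Arith rWeight Plus rWeight rA) 2 Q R1 os"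
    if "\<forall>r<20. R1 r = R r" "R1 rTerm = int i" "R1 rWeight = R rWeight"
      "R1 rSign = term_sign p D (digit q) i" "R1 rPow = s ^ p" for R1
    using that fits_term wt by (intro wp_straightI) (simp_all add: tv, intro post, simp_all)
  define T2 where "T2 = p * 3 + 2 + (2 :: nat)"
  have pow: "wp M W (power_prog ;; (Arith rA Times rSign rPow ;; Arith rWeight Plus rWeight rA))
      T2 Q R1 os"
    if "env R1" "\<forall>r<20. R1 r = R r" "R1 rTerm = int i" "R1 rWeight = R rWeight"
      "R1 rSign = term_sign p D (digit q) i" "R1 rBase = s" "R1 rExp = int p" for R1
    unfolding T2_def
  proof (rule wp_Seq, rule wp_power[where b = s and e = p])
    fix R2 assume R2: "\<forall>r<50. R2 r = R1 r" "R2 rPow = s ^ p"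
    show "wp M W (Arith rA Times rSign rPow ;; Arith rWeight Plus rWeight rA) 2 Q R2 os"
      by (rule last) (use that R2 in simp_all)
  qed (use that fits_pow small in \<open>simp_all add: env_def\<close>)
  define T where "T = (p * (n * 10 + 31) + 1) + (2 + T2)"
  have terms: "wp M W (WhilePos rCount term_body ;; (mov rBase rSum ;; mov rExp rP) ;; power_prog ;;
      (Arith rA Times rSign rPow ;; Arith rWeight Plus rWeight rA)) T Q R1 os"
    if R1: "env R1" "\<forall>r<20. R1 r = R r" "R1 rTerm = int i" "R1 rWeight = R rWeight"
      "R1 rEntry = t l" "R1 rRow = int (4 + l * n)" "R1 rDigits = int q"
      "R1 rBits = int i" "R1 rPos = 0" "R1 rCount = int p" "R1 rSign = 1" "R1 rSum = 0" for R1
    unfolding T_def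
  proof (rule wp_Seq, rule wp_terms[OF R1(1) R1(5-12) l assms(4,5) ord])
    fix R2
    assume R2: "\<forall>r<30. R2 r = R1 r" "R2 rSign = term_sign p D (digit q) i"
      "R2 rSum = term_base p (val l) (digit q) i"
    have "fits W s" using fits_pow[of 1] p by simp
    then have "straight M W (mov rBase rSum ;; mov rExp rP)
      (wp M W (power_prog ;; (Arith rA Times rSign rPow ;; Arith rWeight Plus rWeight rA))
      T2 Q) R2 os"
      using R2 R1 envD[OF R1(1)] small
      by (simp add: s_def[symmetric]) (intro pow; simp add: env_def)
    from wp_straight_Seq[OF this]
    show "wp M W ((mov rBase rSum ;; mov rExp rP) ;; power_prog ;;
      (Arith rA Times rSign rPow ;; Arith rWeight Plus rWeight rA)) (2 + T2) Q R2 os"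
      by (simp add: numeral_2_eq_2)
  qed
  have "straight M W row_before (wp M W (WhilePos rCount term_body ;; (mov rBase rSum ;; mov rExp rP) ;;
      power_prog ;; (Arith rA Times rSign rPow ;; Arith rWeight Plus rWeight rA)) T Q) R os"
    unfolding row_before_def
    using R envD[OF env] i q small fits_t mem
    by (simp_all add: div) (intro terms; simp add: env_def)
  from wp_straight_Seq[OF this] show ?thesis
    unfolding row_body_def by (rule wp_mono) (simp_all add: row_before_def T_def T2_def algebra_simps)
qed

lemma wp_rows:
  assumes env: "env R" and R: "R rCode = int q" "R rTerm = int (m * 2 ^ p)" "R rWeight = 0"
    and "q < N ^ p" and ord: "\<And>j. j < p \<Longrightarrow> j \<le> digit q j div D"
    and post: "\<And>R'. \<forall>r<20. R' r = R r \<Longrightarrow>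
      R' rWeight = edge_weight p m D val (digit q) \<Longrightarrow> Q R' os"
  shows "wp M W (WhilePos rTerm row_body) (m * 2 ^ p * (p * (n * 10 + 34) + 20) + 1) Q R os"
proof -
  have "wp M W (WhilePos rTerm row_body) (m * 2 ^ p * (p * (n * 10 + 34) + 19 + 1) + 1) Q R os"
  proof (rule wp_for_down[where I = "\<lambda>i R' os'. os' = os \<and> (\<forall>r<20. R' r = R r) \<and> R' rTerm = int i \<and>
      R' rWeight = (\<Sum>r\<in>{i..<m * 2 ^ p}. term_value q r)"])
    fix i R' os'
    assume i: "i < m * 2 ^ p" and I: "os' = os \<and> (\<forall>r<20. R' r = R r) \<and> R' rTerm = int (Suc i) \<and>
      R' rWeight = (\<Sum>r\<in>{Suc i..<m * 2 ^ p}. term_value q r)"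
    have sum: "R' rWeight + term_value q i = (\<Sum>r\<in>{i..<m * 2 ^ p}. term_value q r)"
      using I i by (simp add: sum.atLeast_Suc_lessThan)
    have env': "env R'" using env I by (simp add: env_def)
    have R': "R' rCode = int q" "R' rTerm = int (Suc i)" using I R by simp_all
    have wt: "fits W (R' rWeight + term_value q i)"
      unfolding sum using i by (intro fits_weight) simp
    show "wp M W row_body (p * (n * 10 + 34) + 19) (\<lambda>R' os'. os' = os \<and> (\<forall>r<20. R' r = R r) \<and>
        R' rTerm = int i \<and> R' rWeight = (\<Sum>r\<in>{i..<m * 2 ^ p}. term_value q r)) R' os'"
      by (rule wp_row_body[OF env' R' \<open>q < N ^ p\<close> i ord wt]) (use I sum in simp_all)
  next
    fix R' os' assume "os' = os \<and> (\<forall>r<20. R' r = R r) \<and> R' rTerm = int 0 \<and>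
      R' rWeight = (\<Sum>r\<in>{0..<m * 2 ^ p}. term_value q r)"
    then show "Q R' os'"
      using post by (simp add: edge_weight_def term_value_def lessThan_atLeast0)
  qed (use R in auto)
  then show ?thesis by (rule wp_mono) simp_all
qed


section \<open>Tuples with ascending blocks and their output\<close>

abbreviation "blk q j \<equiv> digit q j div D"

text \<open>For \<open>b = p\<close> this selects one tuple per hyperedge, namely its vertices in
  increasing order.\<close>

definition ascending :: "nat \<Rightarrow> nat \<Rightarrow> bool" where
  "ascending q b \<longleftrightarrow> (\<forall>j. Suc j < b \<longrightarrow> blk q j < blk q (Suc j))"

lemma ascending_0 [simp]: "ascending q 0"
  by (simp add: ascending_def)

lemma ascending_Suc: "ascending q (Suc b) \<longleftrightarrow> ascending q b \<and> (b = 0 \<or> blk q (b - 1) < blk q b)"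
proof (cases b)
  case (Suc b')
  then show ?thesis unfolding ascending_def by (auto simp: less_Suc_eq)
qed (simp add: ascending_def)

text \<open>Strictly increasing natural numbers are at least their index. This supplies the
  condition under which the division test of the term loop is correct.\<close>

lemma ascending_ge:
  assumes "ascending q b" "j < b"
  shows "j \<le> blk q j"
  using assms(2)
proof (induction j)
  case (Suc j)
  then have "j \<le> blk q j" "blk q j < blk q (Suc j)" using assms(1) by (auto simp: ascending_def)
  then show ?case by simp
qed simp

lemma next_digit_facts:
  assumes "q < N ^ p"
  shows "int (q div N ^ j) div int N = int (q div N ^ Suc j)"
    "int (q div N ^ Suc j) * int N = int (q div N ^ Suc j * N)"
    "int (q div N ^ j) - int (q div N ^ Suc j * N) = int (digit q j)"
    "int (digit q j) div int D = int (blk q j)"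
    "fits W (int (q div N ^ Suc j))" "fits W (int (q div N ^ Suc j * N))" "fits W (int (digit q j))"
    "fits W (int (blk q j))"
proof -
  have eq: "q div N ^ Suc j = q div N ^ j div N" by (simp only: power_Suc2 div_mult2_eq)
  show "int (q div N ^ j) div int N = int (q div N ^ Suc j)"
    "int (q div N ^ Suc j) * int N = int (q div N ^ Suc j * N)"
    "int (q div N ^ j) - int (q div N ^ Suc j * N) = int (digit q j)"
    "int (digit q j) div int D = int (blk q j)"
    unfolding eq by (simp_all add: zdiv_int minus_div_mult_eq_mod zmod_int digit_def)
  have "q div N ^ Suc j \<le> q" "q div N ^ Suc j * N \<le> q"
  proof -
    show "q div N ^ Suc j \<le> q" by (rule div_le_dividend)
    have "q div N ^ Suc j * N \<le> q div N ^ j" unfolding eq by (rule div_times_less_eq_dividend)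
    also have "\<dots> \<le> q" by (rule div_le_dividend)
    finally show "q div N ^ Suc j * N \<le> q" .
  qed
  moreover have "digit q j \<le> N ^ p" "blk q j \<le> N ^ p"
    using digit_less[of q j] N_le div_le_dividend[of "digit q j" D] by linarith+
  ultimately show "fits W (int (q div N ^ Suc j))" "fits W (int (q div N ^ Suc j * N))" "fits W (int (digit q j))"
    "fits W (int (blk q j))"
    using assms by (intro fits_code; linarith)+
qed

lemma fits_tiny: "\<bar>x\<bar> \<le> 2 * int n + 20 \<Longrightarrow> fits W x"
proof (rule fits_smallI)
  assume "\<bar>x\<bar> \<le> 2 * int n + 20"
  moreover have "0 \<le> int m * int n" by simp
  ultimately show "\<bar>x\<bar> \<le> int m * int n + 2 * int m + 2 * int n + 20" by linarith
qed

lemma wp_check: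
  assumes env: "env R" and R: "R rDigits = int q" "R rCount = int p" "R rPrev = - 1" "R rOk = 1"
    and "q < N ^ p"
    and post: "\<And>R'. \<forall>r<30. R' r = R r \<Longrightarrow> R' rOk = (if ascending q p then 1 else 0) \<Longrightarrow> Q R' os"
  shows "wp M W (WhilePos rCount check_body) (p * 11 + 1) Q R os"
proof -
  have "wp M W (WhilePos rCount check_body) (p * (10 + 1) + 1) Q R os"
  \<comment> \<open>After a descent only the bound on \<open>rPrev\<close> is kept; it still ensures
    that the comparison fits into the width.\<close>
  proof (rule wp_for_up[where I = "\<lambda>j R' os'. os' = os \<and> (\<forall>r<30. R' r = R r) \<and>
      R' rDigits = int (q div N ^ j) \<and> R' rCount = int p - int j \<and>
      R' rOk = (if ascending q j then 1 else 0) \<and> \<bar>R' rPrev\<bar> \<le> int k \<and>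
      (ascending q j \<longrightarrow> R' rPrev = (if j = 0 then - 1 else int (blk q (j - 1))))"])
    fix j R' os'
    assume j: "j < p" and I: "os' = os \<and> (\<forall>r<30. R' r = R r) \<and>
      R' rDigits = int (q div N ^ j) \<and> R' rCount = int p - int j \<and>
      R' rOk = (if ascending q j then 1 else 0) \<and> \<bar>R' rPrev\<bar> \<le> int k \<and>
      (ascending q j \<longrightarrow> R' rPrev = (if j = 0 then - 1 else int (blk q (j - 1))))"
    have env': "env R'" using env I by (simp add: env_def)
    have e: "int (blk q j) < int k" using digit_block_less[of q j] by simp
    have fits: "fits W (int (blk q j) - R' rPrev)" "fits W 0" "fits W (int p - int j - 1)"
      using e I kn pk j by (intro fits_tiny; linarith)+
    have asc: "ascending q (Suc j) \<longleftrightarrow> ascending q j \<and> R' rPrev < int (blk q j)"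
      using I unfolding ascending_Suc by (auto split: if_splits)
    show "wp M W check_body 10 (\<lambda>R' os'. os' = os \<and> (\<forall>r<30. R' r = R r) \<and>
      R' rDigits = int (q div N ^ Suc j) \<and> R' rCount = int p - int (Suc j) \<and>
      R' rOk = (if ascending q (Suc j) then 1 else 0) \<and> \<bar>R' rPrev\<bar> \<le> int k \<and>
      (ascending q (Suc j) \<longrightarrow> R' rPrev = (if Suc j = 0 then - 1 else int (blk q (Suc j - 1))))) R' os'"
    proof (rule wp_straightI)
      show "straight M W check_body (\<lambda>R' os'. os' = os \<and> (\<forall>r<30. R' r = R r) \<and>
        R' rDigits = int (q div N ^ Suc j) \<and> R' rCount = int p - int (Suc j) \<and>
        R' rOk = (if ascending q (Suc j) then 1 else 0) \<and> \<bar>R' rPrev\<bar> \<le> int k \<and>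
        (ascending q (Suc j) \<longrightarrow> R' rPrev = (if Suc j = 0 then - 1 else int (blk q (Suc j - 1))))) R' os'"
        unfolding check_body_def next_digit_def asc
        using I envD[OF env'] next_digit_facts[OF \<open>q < N ^ p\<close>, of j] fits e
        by (auto simp del: of_nat_mult power_Suc)
    qed (simp add: check_body_def next_digit_def)
  qed (use R kn pk p post in auto)
  then show ?thesis by (rule wp_mono) simp_all
qed

lemma wp_emit:
  assumes env: "env R" and R: "R rDigits = int q" "R rCount = int p"
    and "q < N ^ p"
    and post: "\<And>R'. \<forall>r<30. R' r = R r \<Longrightarrow> Q R' (os @ map (\<lambda>j. int (digit q j)) [0..<p])"
  shows "wp M W (WhilePos rCount emit_body) (p * 7 + 1) Q R os"
proof -
  have "wp M W (WhilePos rCount emit_body) (p * (6 + 1) + 1) Q R os"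
  proof (rule wp_for_up[where I = "\<lambda>j R' os'. os' = os @ map (\<lambda>j. int (digit q j)) [0..<j] \<and>
      (\<forall>r<30. R' r = R r) \<and> R' rDigits = int (q div N ^ j) \<and> R' rCount = int p - int j"])
    fix j R' os'
    assume j: "j < p" and I: "os' = os @ map (\<lambda>j. int (digit q j)) [0..<j] \<and>
      (\<forall>r<30. R' r = R r) \<and> R' rDigits = int (q div N ^ j) \<and> R' rCount = int p - int j"
    have env': "env R'" using env I by (simp add: env_def)
    have fits: "fits W (int p - int j - 1)"
      using kn pk j by (intro fits_tiny) linarith
    show "wp M W emit_body 6 (\<lambda>R' os'. os' = os @ map (\<lambda>j. int (digit q j)) [0..<Suc j] \<and>
      (\<forall>r<30. R' r = R r) \<and> R' rDigits = int (q div N ^ Suc j) \<and> R' rCount = int p - int (Suc j)) R' os'"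
      unfolding emit_body_def next_digit_def
      using I envD[OF env'] next_digit_facts[OF \<open>q < N ^ p\<close>, of j] fits
      by (intro wp_straightI) (simp_all del: of_nat_mult power_Suc)
  qed (use R post in auto)
  then show ?thesis by (rule wp_mono) simp_all
qed

definition edge_code :: "nat \<Rightarrow> int list" where
  "edge_code q = (if ascending q p
     then map (\<lambda>j. int (digit q j)) [0..<p] @ [edge_weight p m D val (digit q), 1] else [])"

lemma wp_edge_output:
  assumes env: "env R" and R: "R rCode = int q" and "q < N ^ p" "ascending q p"
    and post: "\<And>R'. \<forall>r<20. R' r = R r \<Longrightarrow> Q R' (os @ edge_code q)"
  shows "wp M W edge_output (m * 2 ^ p * (p * (n * 10 + 34) + 20) + p * 7 + 8) Q R os"
proof -
  have fits: "fits W 0" "fits W (int m * 2 ^ p)" "fits W (int q)" "fits W (int p)"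
  proof -
    show "fits W (int m * 2 ^ p)" using fits_mask[of "m * 2 ^ p"] by simp
    show "fits W (int q)" using \<open>q < N ^ p\<close> by (intro fits_code) simp
  qed (use pk kn in \<open>auto intro!: fits_tiny\<close>)
  have out: "wp M W (Emit rWeight ;; Emit rOne) 2 Q R1 (os @ map (\<lambda>j. int (digit q j)) [0..<p])"
    if "\<forall>r<20. R1 r = R r" "R1 rWeight = edge_weight p m D val (digit q)" for R1
    using that post envD[OF env] \<open>ascending q p\<close>
    by (intro wp_straightI) (simp_all add: edge_code_def)
  define T1 where "T1 = p * 7 + 1 + (2 :: nat)"
  have emit: "wp M W (WhilePos rCount emit_body ;; (Emit rWeight ;; Emit rOne)) T1 Q R1 os"
    if R1: "env R1" "\<forall>r<20. R1 r = R r" "R1 rWeight = edge_weight p m D val (digit q)"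
      "R1 rDigits = int q" "R1 rCount = int p" for R1
    unfolding T1_def
    by (rule wp_Seq, rule wp_emit[OF R1(1,4,5) \<open>q < N ^ p\<close>], rule out) (use R1 in auto)
  define T2 where "T2 = m * 2 ^ p * (p * (n * 10 + 34) + 20) + 1 + (2 + T1)"
  have rows: "wp M W (WhilePos rTerm row_body ;; (mov rDigits rCode ;; mov rCount rP) ;;
      WhilePos rCount emit_body ;; (Emit rWeight ;; Emit rOne)) T2 Q R1 os"
    if R1: "env R1" "\<forall>r<20. R1 r = R r" "R1 rCode = int q" "R1 rTerm = int (m * 2 ^ p)" "R1 rWeight = 0" for R1
    unfolding T2_def
  proof (rule wp_Seq, rule wp_rows[OF R1(1,3,4,5) \<open>q < N ^ p\<close> ascending_ge[OF \<open>ascending q p\<close>]])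
    fix R2
    assume R2: "\<forall>r<20. R2 r = R1 r" "R2 rWeight = edge_weight p m D val (digit q)"
    have "straight M W (mov rDigits rCode ;; mov rCount rP)
      (wp M W (WhilePos rCount emit_body ;; (Emit rWeight ;; Emit rOne)) T1 Q) R2 os"
      using R2 R1 envD[OF R1(1)] fits by simp (intro emit; simp add: env_def)
    from wp_straight_Seq[OF this]
    show "wp M W ((mov rDigits rCode ;; mov rCount rP) ;;
      WhilePos rCount emit_body ;; (Emit rWeight ;; Emit rOne)) (2 + T1) Q R2 os"
      by (simp add: numeral_2_eq_2)
  qed
  have "straight M W (mov rWeight rZero ;; Arith rTerm Times rM rMasks)
     (wp M W (WhilePos rTerm row_body ;; (mov rDigits rCode ;; mov rCount rP) ;;
      WhilePos rCount emit_body ;; (Emit rWeight ;; Emit rOne)) T2 Q) R os"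
    using R envD[OF env] fits by simp (intro rows; simp add: env_def)
  from wp_straight_Seq[OF this] show ?thesis
    unfolding edge_output_def by (rule wp_mono) (simp_all add: T2_def T1_def)
qed

lemma wp_edge_body:
  assumes env: "env R" and R: "R rCode = int (Suc q)" and "q < N ^ p"
    and post: "\<And>R'. \<forall>r<13. R' r = R r \<Longrightarrow> R' rCode = int q \<Longrightarrow> Q R' (os @ edge_code q)"
  shows "wp M W edge_body (m * 2 ^ p * (p * (n * 10 + 34) + 20) + p * 18 + 16) Q R os"
proof -
  have fits: "fits W 0" "fits W 1" "fits W (- 1)" "fits W (int q)" "fits W (int p)"
  proof -
    show "fits W (int q)" using \<open>q < N ^ p\<close> by (intro fits_code) simp
  qed (use pk kn in \<open>auto intro!: fits_tiny\<close>)
  define T1 where "T1 = m * 2 ^ p * (p * (n * 10 + 34) + 20) + p * 7 + (8 :: nat)"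
  define T2 where "T2 = p * 11 + 1 + Suc (T1 + 1)"
  have check: "wp M W (WhilePos rCount check_body ;; IfPos rOk edge_output (mov rA rZero)) T2 Q R1 os"
    if R1: "env R1" "R1 rDigits = int q" "R1 rCount = int p" "R1 rPrev = - 1" "R1 rOk = 1"
      "\<forall>r<13. R1 r = R r" "R1 rCode = int q" for R1
    unfolding T2_def
  proof (rule wp_Seq, rule wp_check[OF R1(1-5) \<open>q < N ^ p\<close>], rule wp_IfPos)
    fix R2
    assume R2: "\<forall>r<30. R2 r = R1 r" "R2 rOk = (if ascending q p then 1 else 0)"
    have env2: "env R2" using R1(1) R2(1) by (simp add: env_def)
    show "wp M W edge_output T1 Q R2 os" if "0 < R2 rOk"
      unfolding T1_def
      by (rule wp_edge_output[OF env2 _ \<open>q < N ^ p\<close>]) (use R1 R2 that post in \<open>auto split: if_splits\<close>)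
    show "wp M W (mov rA rZero) 1 Q R2 os" if "R2 rOk \<le> 0"
      using that R1 R2 post[of "R2(rA := 0)"] fits envD[OF env2]
      by (intro wp_straightI) (auto simp: edge_code_def split: if_splits)
  qed
  have "straight M W (Arith rCode Minus rCode rOne ;; mov rDigits rCode ;; mov rCount rP ;; Const rPrev (- 1) ;;
    mov rOk rOne) (wp M W (WhilePos rCount check_body ;; IfPos rOk edge_output (mov rA rZero)) T2 Q) R os"
    using R envD[OF env] fits by simp (intro check; simp add: env_def)
  from wp_straight_Seq[OF this] show ?thesis
    unfolding edge_body_def by (rule wp_mono) (simp_all add: T2_def T1_def)
qed

text \<open>Reversed because the tuple counter runs downwards; the encoding of a hypergraph admits
  any order of its hyperedges.\<close>

definition edge_list_code :: "int list" where
  "edge_list_code = concat (map edge_code (rev [0..<N ^ p]))"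

lemma wp_edges:
  assumes env: "env R" and R: "R rCode = int (N ^ p)"
    and post: "\<And>R'. Q R' (os @ edge_list_code)"
  shows "wp M W (WhilePos rCode edge_body)
    (N ^ p * (m * 2 ^ p * (p * (n * 10 + 34) + 20) + p * 18 + 16 + 1) + 1) Q R os"
proof (rule wp_for_down[where I = "\<lambda>i R' os'. env R' \<and> R' rCode = int i \<and>
    os' = os @ concat (map edge_code (rev [i..<N ^ p]))"])
  fix i R' os'
  assume i: "i < N ^ p" and I: "env R' \<and> R' rCode = int (Suc i) \<and>
    os' = os @ concat (map edge_code (rev [Suc i..<N ^ p]))"
  have "[i..<N ^ p] = i # [Suc i..<N ^ p]" using i by (rule upt_conv_Cons)
  then have out: "os @ concat (map edge_code (rev [i..<N ^ p])) = os' @ edge_code i" using I by simp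
  show "wp M W edge_body (m * 2 ^ p * (p * (n * 10 + 34) + 20) + p * 18 + 16)
      (\<lambda>R' os'. env R' \<and> R' rCode = int i \<and> os' = os @ concat (map edge_code (rev [i..<N ^ p]))) R' os'"
    unfolding out by (rule wp_edge_body[OF _ _ i]) (use I in \<open>auto simp: env_def\<close>)
qed (use assms in \<open>auto simp: edge_list_code_def\<close>)


section \<open>The complete run\<close>

definition run_output :: "int list" where
  "run_output = [int k, int p, int N, num ^ p, den ^ p] @ edge_list_code"

text \<open>The summands \<open>c * 3\<close> and \<open>p * 12\<close> pay for the five powers, one
  with exponent \<open>c\<close> and four with exponent \<open>p\<close>; 60 covers the
  straight-line code between them.\<close>

definition run_time :: nat where
  "run_time = N ^ p * (m * 2 ^ p * (p * (n * 10 + 34) + 20) + p * 18 + 17) + c * 3 + p * 12 + 60"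

lemma wp_reduction:
  shows "wp M W reduction_prog run_time (\<lambda>R os. os = run_output) (\<lambda>_. 0) []"
proof -
  let ?Q = "\<lambda>R os. os = run_output"
  let ?emit = "Emit rK ;; Emit rP ;; Emit rVerts ;; Emit rNum ;; Emit rPow"
  define T6 where "T6 = N ^ p * (m * 2 ^ p * (p * (n * 10 + 34) + 20) + p * 18 + 16 + 1) + (1 :: nat)"
  define T5 where "T5 = p * 3 + 2 + (5 + T6)"
  define T4 where "T4 = p * 3 + 2 + (3 + T5)"
  define T3 where "T3 = p * 3 + 2 + (8 + T4)"
  define T2 where "T2 = p * 3 + 2 + (3 + T3)"
  define T1 where "T1 = c * 3 + 2 + (4 + T2)"
  have N2: "2 \<le> N" using p pk D_pos by (simp add: N Suc_le_eq less_le_trans[of 1 k] le_trans[of 2 k])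
  have c_le: "c \<le> n"
  proof -
    have "n + k - 1 < k * (n + 1)" using k_pos p pk by (cases k) auto
    then have "c < n + 1" unfolding c by (simp add: less_mult_imp_div_less mult.commute)
    then show ?thesis by simp
  qed
  have fits_int_c: "fits W (int c)" using c_le by (intro fits_tiny) simp
  have fits_int_p: "fits W (int p)" using pk kn by (intro fits_tiny) simp
  have fits_pow_c: "fits W (2 ^ i)" if "i \<le> c" for i
  proof -
    have "(2 :: nat) ^ i \<le> D" unfolding D using that by (intro power_increasing) auto
    then show ?thesis using fits_code[of "2 ^ i"] D_le by simp
  qed
  have fits_pow_p: "fits W (2 ^ i)" if "i \<le> p" for i
  proof -
    have "(2 :: nat) ^ i \<le> 2 ^ p" using that by (intro power_increasing) auto
    also have "\<dots> \<le> N ^ p" using N2 by (intro power_mono) auto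
    finally show ?thesis using fits_code[of "2 ^ i"] by simp
  qed
  have fits_pow_N: "fits W (int N ^ i)" if "i \<le> p" for i
  proof -
    have "N ^ i \<le> N ^ p" using that N2 by (intro power_increasing) auto
    then show ?thesis using fits_code[of "N ^ i"] by simp
  qed
  have fits: "fits W 0" "fits W 1" "fits W 2" "fits W 3" "fits W 4" "fits W (int k)" "fits W (int n)"
    "fits W (int n + int k)" "fits W (int n + int k - 1)" "fits W (int D)" "fits W (int N)"
    "fits W (int m)" "fits W (int m * int n)" "fits W (4 + int m * int n)" "fits W (4 + int m * int n + int m)"
    "fits W (4 + int m * int n + int m + 1)" "fits W num" "fits W den" "fits W (num ^ p)"
    "fits W (2 ^ p)" "fits W (int N ^ p)"
  proof -
    show "fits W (int D)" using D_le by (rule fits_code)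
    show "fits W (int N)" using N_le by (rule fits_code)
    show "fits W num" "fits W den" "fits W (num ^ p)"
      using width_bound(1)[of 1] width_bound(1)[of p] width_bound(2)[of 1] p by simp_all
    show "fits W (2 ^ p)" "fits W (int N ^ p)" by (simp_all add: fits_pow_p fits_pow_N)
    show "fits W 0" "fits W 1" "fits W 2" "fits W 3" "fits W 4" "fits W (int k)" "fits W (int n)"
      "fits W (int n + int k)" "fits W (int n + int k - 1)"
      using kn by (intro fits_tiny; linarith)+
    have "0 \<le> int m * int n" by simp
    then show "fits W (int m)" "fits W (int m * int n)" "fits W (4 + int m * int n)"
      "fits W (4 + int m * int n + int m)" "fits W (4 + int m * int n + int m + 1)"
      by (intro fits_smallI; linarith)+
  qed
  have mem: "M (4 + int m * int n + int m) = num" "M (4 + int m * int n + int m + 1) = den"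
    using mem_bound by simp_all
  have edges: "wp M W (WhilePos rCode edge_body) T6 ?Q R [int k, int p, int N, num ^ p, den ^ p]"
    if "env R" "R rCode = int N ^ p" for R
    unfolding T6_def by (rule wp_edges) (use that in \<open>simp_all add: run_output_def\<close>)
  have s6: "wp M W (?emit ;; WhilePos rCode edge_body) (5 + T6) ?Q R []"
    if R: "env R" "R rCode = int N ^ p" "R rNum = num ^ p" "R rPow = den ^ p" for R
  proof -
    have "straight M W ?emit (wp M W (WhilePos rCode edge_body) T6 ?Q) R []"
      using R(2-4) envD[OF R(1)] by simp (intro edges R(1); simp)
    from wp_straight_Seq[OF this] show ?thesis by (rule wp_mono) simp_all
  qed
  have s5: "wp M W (power_prog ;; ?emit ;; WhilePos rCode edge_body) T5 ?Q R []"
    if R: "env R" "R rCode = int N ^ p" "R rNum = num ^ p" "R rBase = den" "R rExp = int p" for R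
    unfolding T5_def
  proof (rule wp_Seq, rule wp_power[where b = den and e = p])
    fix R' assume "\<forall>r<50. R' r = R r" "R' rPow = den ^ p"
    then show "wp M W (?emit ;; WhilePos rCode edge_body) (5 + T6) ?Q R' []"
      using R by (intro s6) (simp_all add: env_def)
  qed (use R fits_int_p width_bound in \<open>simp_all add: env_def\<close>)
  let ?c5 = "power_prog ;; ?emit ;; WhilePos rCode edge_body"
  let ?b4 = "mov rNum rPow ;; mov rBase rDen ;; mov rExp rP"
  have s4: "wp M W (power_prog ;; ?b4 ;; ?c5) T4 ?Q R []"
    if R: "env R" "R rCode = int N ^ p" "R rDen = den" "R rBase = num" "R rExp = int p" for R
    unfolding T4_def
  proof (rule wp_Seq, rule wp_power[where b = num and e = p])
    fix R' assume R': "\<forall>r<50. R' r = R r" "R' rPow = num ^ p"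
    then have "env R'" using R(1) by (simp add: env_def)
    then have "straight M W ?b4 (wp M W ?c5 T5 ?Q) R' []"
      using R' R envD[OF \<open>env R'\<close>] fits fits_int_p by simp (intro s5; simp add: env_def)
    from wp_straight_Seq[OF this] show "wp M W (?b4 ;; ?c5) (3 + T5) ?Q R' []" by (rule wp_mono) simp_all
  qed (use R fits_int_p width_bound in \<open>simp_all add: env_def\<close>)
  let ?c4 = "power_prog ;; ?b4 ;; ?c5"
  let ?b3 = "mov rCode rPow ;; Arith rA Times rM rN ;; Arith rTarget Plus rFour rA ;;
    Arith rA Plus rTarget rM ;; Load rBase rA ;; Arith rA Plus rA rOne ;; Load rDen rA ;; mov rExp rP"
  have s3: "wp M W (power_prog ;; ?b3 ;; ?c4) T3 ?Q R []"
    if R: "R rZero = 0" "R rOne = 1" "R rTwo = 2" "R rFour = 4" "R rK = int k" "R rP = int p"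
      "R rM = int m" "R rN = int n" "R rD = int D" "R rVerts = int N" "R rMasks = 2 ^ p"
      "R rBase = int N" "R rExp = int p" for R
    unfolding T3_def
  proof (rule wp_Seq, rule wp_power[where b = "int N" and e = p])
    fix R' assume R': "\<forall>r<50. R' r = R r" "R' rPow = int N ^ p"
    have "straight M W ?b3 (wp M W ?c4 T4 ?Q) R' []"
      using R' R fits fits_int_p mem by simp (intro s4; simp add: env_def)
    from wp_straight_Seq[OF this] show "wp M W (?b3 ;; ?c4) (8 + T4) ?Q R' []" by (rule wp_mono) simp_all
  qed (use R fits_int_p fits_pow_N in simp_all)
  let ?c3 = "power_prog ;; ?b3 ;; ?c4"
  let ?b2 = "mov rMasks rPow ;; mov rBase rVerts ;; mov rExp rP"
  have s2: "wp M W (power_prog ;; ?b2 ;; ?c3) T2 ?Q R []"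
    if R: "R rZero = 0" "R rOne = 1" "R rTwo = 2" "R rFour = 4" "R rK = int k" "R rP = int p"
      "R rM = int m" "R rN = int n" "R rD = int D" "R rVerts = int N" "R rBase = 2" "R rExp = int p" for R
    unfolding T2_def
  proof (rule wp_Seq, rule wp_power[where b = 2 and e = p])
    fix R' assume R': "\<forall>r<50. R' r = R r" "R' rPow = 2 ^ p"
    have "straight M W ?b2 (wp M W ?c3 T3 ?Q) R' []"
      using R' R fits fits_int_p by simp (intro s3; simp)
    from wp_straight_Seq[OF this] show "wp M W (?b2 ;; ?c3) (3 + T3) ?Q R' []" by (rule wp_mono) simp_all
  qed (use R fits_int_p fits_pow_p in simp_all)
  let ?c2 = "power_prog ;; ?b2 ;; ?c3"
  let ?b1 = "mov rD rPow ;; Arith rVerts Times rK rD ;; mov rBase rTwo ;; mov rExp rP"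
  have s1: "wp M W (power_prog ;; ?b1 ;; ?c2) T1 ?Q R []"
    if R: "R rZero = 0" "R rOne = 1" "R rTwo = 2" "R rFour = 4" "R rK = int k" "R rP = int p"
      "R rM = int m" "R rN = int n" "R rBase = 2" "R rExp = int c" for R
    unfolding T1_def
  proof (rule wp_Seq, rule wp_power[where b = 2 and e = c])
    fix R' assume R': "\<forall>r<50. R' r = R r" "R' rPow = 2 ^ c"
    then have "R' rPow = int D" by (simp add: D)
    moreover have "int k * int D = int N" by (simp add: N)
    ultimately have "straight M W ?b1 (wp M W ?c2 T2 ?Q) R' []"
      using R'(1) R fits fits_int_p by simp (intro s2; simp)
    from wp_straight_Seq[OF this] show "wp M W (?b1 ;; ?c2) (4 + T2) ?Q R' []" by (rule wp_mono) simp_all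
  qed (use R fits_int_c fits_pow_c in simp_all)
  have "int c = (int n + int k - 1) div int k"
    unfolding c using k_pos by (simp add: zdiv_int of_nat_diff)
  then have "straight M W load_parameters (wp M W (power_prog ;; ?b1 ;; ?c2) T1 ?Q) (\<lambda>_. 0) []"
    unfolding load_parameters_def
    using fits fits_int_c fits_int_p mem_params by simp (intro s1; simp)
  from wp_straight_Seq[OF this] show ?thesis
    unfolding reduction_prog_def
    by (rule wp_mono)
      (simp_all add: load_parameters_def T1_def T2_def T3_def T4_def T5_def T6_def run_time_def ac_simps)
qed

end

section \<open>Correctness of the reduction\<close>

lemma bounded_digits_exist:
  fixes f :: "nat \<Rightarrow> nat"
  assumes "\<And>j. j < c \<Longrightarrow> f j < b"
  shows "\<exists>x<b ^ c. \<forall>j<c. x div b ^ j mod b = f j"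
  using assms
proof (induction c arbitrary: f)
  case (Suc c)
  have "\<And>j. j < c \<Longrightarrow> f (Suc j) < b" using Suc.prems by simp
  then obtain x where x: "x < b ^ c" "\<forall>j<c. x div b ^ j mod b = f (Suc j)"
    using Suc.IH[of "\<lambda>j. f (Suc j)"] by blast
  have f0: "f 0 < b" using Suc.prems by simp
  have "(b * x + f 0) div b ^ j mod b = f j" if "j < Suc c" for j
  proof (cases j)
    case (Suc j')
    have "(b * x + f 0) div b = x" using f0 by simp
    then show ?thesis using x that Suc by (simp add: div_mult2_eq)
  qed (use f0 in simp)
  moreover have "b * x + f 0 < b ^ Suc c"
  proof -
    have "b * x + f 0 < b * Suc x" using f0 by simp
    also have "\<dots> \<le> b * b ^ c" using x(1) by (intro mult_le_mono2) simp
    finally show ?thesis by simp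
  qed
  ultimately show ?case by blast
qed simp

lemma digits_inject:
  fixes q :: nat
  assumes "q < b ^ c" "q' < b ^ c" "\<And>j. j < c \<Longrightarrow> q div b ^ j mod b = q' div b ^ j mod b"
  shows "q = q'"
  using assms
proof (induction c arbitrary: q q')
  case (Suc c)
  have "0 < b" using Suc.prems(1) by (cases b) auto
  have "q div b = q' div b"
  proof (rule Suc.IH)
    show "q div b < b ^ c" "q' div b < b ^ c"
      using Suc.prems(1,2) by (simp_all add: less_mult_imp_div_less mult.commute)
    show "q div b div b ^ j mod b = q' div b div b ^ j mod b" if "j < c" for j
      using Suc.prems(3)[of "Suc j"] that by (simp add: div_mult2_eq)
  qed
  moreover have "q mod b = q' mod b" using Suc.prems(3)[of 0] by simp
  ultimately show ?case by (metis div_mult_mod_eq)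
qed simp

text \<open>Rounds \<open>n / k\<close> up within the natural numbers, by the formula that the
  program uses.\<close>

definition block_size :: "nat \<Rightarrow> nat \<Rightarrow> nat" where
  "block_size n k = (n + k - 1) div k"

lemma block_size_bounds:
  assumes "0 < k"
  shows "n \<le> k * block_size n k" "k * block_size n k < n + k"
proof -
  have "k * block_size n k + (n + k - 1) mod k = n + k - 1" by (simp add: block_size_def)
  moreover have "(n + k - 1) mod k < k" using assms by simp
  ultimately show "n \<le> k * block_size n k" "k * block_size n k < n + k" using assms by linarith+
qed

lemma block_size_le:
  assumes "0 < k"
  shows "block_size n k \<le> n"
proof -
  have "k * block_size n k < n + k" by (rule block_size_bounds[OF assms])
  also have "\<dots> \<le> k * (n + 1)" using assms by (cases k) auto
  finally have "block_size n k < n + 1" by (simp only: mult_less_cancel1)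
  then show ?thesis by simp
qed

lemma nat_ceiling_divide:
  assumes "0 < k"
  shows "nat \<lceil>real n / real k\<rceil> = block_size n k"
proof -
  have "real n \<le> real (k * block_size n k)" "real (k * block_size n k) < real (n + k)"
    using block_size_bounds[OF assms] by (simp_all only: of_nat_le_iff of_nat_less_iff)
  then have "\<lceil>real n / real k\<rceil> = int (block_size n k)"
    using assms by (intro ceiling_unique) (simp_all add: field_simps)
  then show ?thesis by simp
qed

section \<open>The instance produced by the reduction\<close>

definition instance_value :: "cvp_instance \<Rightarrow> nat \<Rightarrow> nat \<Rightarrow> nat \<Rightarrow> nat \<Rightarrow> nat \<Rightarrow> int" where
  "instance_value I n k D = vertex_value (\<lambda>l j. basis I $$ (l, j)) (\<lambda>l. target I $ l) n k D"

definition reduction :: "nat \<Rightarrow> nat \<Rightarrow> nat \<Rightarrow> cvp_instance \<Rightarrow> clique_instance" where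
  "reduction n k p I = (let D = 2 ^ block_size n k in
     \<lparr>hypergraph = \<lparr>num_verts = k * D, hyperedges = block_edges p k D,
        weight = (\<lambda>e. of_int (edge_weight p (dim_row (basis I)) D (instance_value I n k D)
          ((!) (sorted_list_of_set e))))\<rparr>,
      weight_bound = dist_bound I ^ p\<rparr>)"

text \<open>Evenness of \<open>p\<close> removes the absolute values and monotonicity of the root
  removes the root. What remains compares an integer with a rational power, so no real arithmetic
  enters the clique instance.\<close>

lemma cvp_dist_le_iff:
  assumes I: "I \<in> cvp_instances n" and p: "0 < p" "even p" and z: "z \<in> carrier_vec n"
  shows "cvp_dist p I z \<le> of_rat (dist_bound I) \<longleftrightarrow>
    (of_int (\<Sum>l<dim_row (basis I). ((\<Sum>j<n. basis I $$ (l, j) * z $ j) - target I $ l) ^ p) :: rat)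
      \<le> dist_bound I ^ p"
proof -
  define s where "s = (\<Sum>l<dim_row (basis I). ((\<Sum>j<n. basis I $$ (l, j) * z $ j) - target I $ l) ^ p)"
  have dims: "dim_col (basis I) = n" "dim_vec (target I) = dim_row (basis I)" "dist_bound I > 0"
    using I by (auto simp: cvp_instances_def)
  have "(basis I *\<^sub>v z - target I) $ l = (\<Sum>j<n. basis I $$ (l, j) * z $ j) - target I $ l"
    if "l < dim_row (basis I)" for l
    using that dims z by (simp add: scalar_prod_def lessThan_atLeast0)
  then have "(\<Sum>i<dim_vec (map_vec real_of_int (basis I *\<^sub>v z - target I)).
      \<bar>map_vec real_of_int (basis I *\<^sub>v z - target I) $ i\<bar> ^ p) = of_int s"
    unfolding s_def using dims p by (simp add: power_even_abs)
  then have "cvp_dist p I z = root p (of_int s)" by (simp add: cvp_dist_def lp_norm_def)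
  moreover have "(of_rat (dist_bound I) :: real) = root p (of_rat (dist_bound I) ^ p)"
    using dims p by (simp add: real_root_power_cancel)
  ultimately have "cvp_dist p I z \<le> of_rat (dist_bound I) \<longleftrightarrow> (of_int s :: real) \<le> of_rat (dist_bound I) ^ p"
    using p by (metis real_root_le_iff)
  also have "\<dots> \<longleftrightarrow> (of_rat (of_int s) :: real) \<le> of_rat (dist_bound I ^ p)" by (simp add: of_rat_power)
  finally show ?thesis unfolding of_rat_less_eq s_def .
qed

lemma clique_weight_reduction:
  assumes I: "I \<in> cvp_instances n" and p: "p \<le> k" "0 < k" and x: "\<And>i. i < k \<Longrightarrow> x i < 2 ^ block_size n k"
  shows "clique_weight p (hypergraph (reduction n k p I)) ((\<lambda>i. i * 2 ^ block_size n k + x i) ` {..<k}) =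
    of_int (\<Sum>l<dim_row (basis I).
      ((\<Sum>j<n. basis I $$ (l, j) * int (bit_of (x (j mod k)) (j div k))) - target I $ l) ^ p)"
proof -
  let ?D = "2 ^ block_size n k :: nat"
  let ?V = "\<lambda>i. i * ?D + x i"
  have V: "?V i div ?D = i" if "i < k" for i using x[OF that] by simp
  have mono: "strict_mono_on {..<k} ?V"
  proof (rule strict_mono_onI)
    fix i j assume ij: "i \<in> {..<k}" "j \<in> {..<k}" "i < j"
    have "?V i < Suc i * ?D" using x ij by simp
    also have "\<dots> \<le> j * ?D" using ij by (intro mult_le_mono1) simp
    finally show "?V i < ?V j" by simp
  qed
  show ?thesis
    unfolding clique_weight_def reduction_def Let_def instance_value_def
    using sum_edge_weight_clique[where V = ?V, OF V mono p(1)] sum_vertex_value[OF p(2) x]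
    by (simp flip: of_int_sum)
qed

text \<open>A clique is a choice of an assignment \<open>x i\<close> in every block, and it yields
  the vector whose coordinate \<open>j\<close> is bit \<open>j div k\<close> of
  \<open>x (j mod k)\<close>. When \<open>k\<close> does not divide \<open>n\<close>, several
  cliques yield the same vector; the equivalence only needs that every 0/1-vector is reached and
  that the weight depends on the vector alone.\<close>

lemma reduction_clique_iff:
  assumes I: "I \<in> cvp_instances n" and p: "2 \<le> p" "p \<le> k" "even p"
  shows "(\<exists>K. is_clique p k (hypergraph (reduction n k p I)) K \<and>
      clique_weight p (hypergraph (reduction n k p I)) K \<le> weight_bound (reduction n k p I)) \<longleftrightarrow>
    (\<exists>z\<in>binary_vecs n. cvp_dist p I z \<le> of_rat (dist_bound I))"
proof -
  let ?D = "2 ^ block_size n k :: nat"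
  let ?K = "\<lambda>x. (\<lambda>i. i * ?D + x i) ` {..<k}"
  define F where "F b = (of_int (\<Sum>l<dim_row (basis I).
    ((\<Sum>j<n. basis I $$ (l, j) * b j) - target I $ l) ^ p) :: rat)" for b :: "nat \<Rightarrow> int"
  have F_cong: "F b = F b'" if "\<And>j. j < n \<Longrightarrow> b j = b' j" for b b' using that by (simp add: F_def)
  have k: "0 < k" and p0: "0 < p" using p by auto
  have cl: "is_clique p k (hypergraph (reduction n k p I)) K \<longleftrightarrow> (\<exists>x. (\<forall>i<k. x i < ?D) \<and> K = ?K x)" for K
    using block_clique_iff[of p k ?D K] p by (simp add: is_clique_def reduction_def Let_def)
  have bound: "weight_bound (reduction n k p I) = dist_bound I ^ p"
    by (simp add: reduction_def Let_def)
  have wt: "clique_weight p (hypergraph (reduction n k p I)) (?K x) = F (\<lambda>j. int (bit_of (x (j mod k)) (j div k)))"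
    if "\<forall>i<k. x i < ?D" for x
    unfolding F_def using that by (intro clique_weight_reduction[OF I p(2) k]) simp
  have "(\<exists>K. is_clique p k (hypergraph (reduction n k p I)) K \<and>
      clique_weight p (hypergraph (reduction n k p I)) K \<le> weight_bound (reduction n k p I)) \<longleftrightarrow>
    (\<exists>x. (\<forall>i<k. x i < ?D) \<and> F (\<lambda>j. int (bit_of (x (j mod k)) (j div k))) \<le> dist_bound I ^ p)"
  proof
    assume "\<exists>K. is_clique p k (hypergraph (reduction n k p I)) K \<and>
      clique_weight p (hypergraph (reduction n k p I)) K \<le> weight_bound (reduction n k p I)"
    then obtain x where x: "\<forall>i<k. x i < ?D"
      "clique_weight p (hypergraph (reduction n k p I)) (?K x) \<le> dist_bound I ^ p"
      unfolding cl bound by blast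
    show "\<exists>x. (\<forall>i<k. x i < ?D) \<and> F (\<lambda>j. int (bit_of (x (j mod k)) (j div k))) \<le> dist_bound I ^ p"
      using x(2) unfolding wt[OF x(1)] by (intro exI[of _ x] conjI x(1))
  next
    assume "\<exists>x. (\<forall>i<k. x i < ?D) \<and> F (\<lambda>j. int (bit_of (x (j mod k)) (j div k))) \<le> dist_bound I ^ p"
    then obtain x where x: "\<forall>i<k. x i < ?D"
      "F (\<lambda>j. int (bit_of (x (j mod k)) (j div k))) \<le> dist_bound I ^ p"
      by blast
    show "\<exists>K. is_clique p k (hypergraph (reduction n k p I)) K \<and>
      clique_weight p (hypergraph (reduction n k p I)) K \<le> weight_bound (reduction n k p I)"
      unfolding cl bound using x by (intro exI[of _ "?K x"] conjI exI[of _ x]) (simp_all add: wt)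
  qed
  also have "\<dots> \<longleftrightarrow> (\<exists>z\<in>binary_vecs n. F (\<lambda>j. z $ j) \<le> dist_bound I ^ p)"
  proof
    assume "\<exists>x. (\<forall>i<k. x i < ?D) \<and> F (\<lambda>j. int (bit_of (x (j mod k)) (j div k))) \<le> dist_bound I ^ p"
    then obtain x where x: "F (\<lambda>j. int (bit_of (x (j mod k)) (j div k))) \<le> dist_bound I ^ p" by blast
    let ?z = "vec n (\<lambda>j. int (bit_of (x (j mod k)) (j div k)))"
    have "F (\<lambda>j. ?z $ j) = F (\<lambda>j. int (bit_of (x (j mod k)) (j div k)))" by (rule F_cong) simp
    moreover have "?z \<in> binary_vecs n" using bit_of_cases by (auto simp: binary_vecs_def)
    ultimately show "\<exists>z\<in>binary_vecs n. F (\<lambda>j. z $ j) \<le> dist_bound I ^ p"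
      using x by (intro bexI[of _ ?z]) simp_all
  next
    assume "\<exists>z\<in>binary_vecs n. F (\<lambda>j. z $ j) \<le> dist_bound I ^ p"
    then obtain z where z: "z \<in> binary_vecs n" "F (\<lambda>j. z $ j) \<le> dist_bound I ^ p" by blast
    \<comment> \<open>Bits that belong to columns beyond \<open>n\<close> are padding and are set to
      0.\<close>
    define f where "f i b = (if i + k * b < n then nat (z $ (i + k * b)) else 0)" for i b
    have "f i b < 2" for i b using z(1) by (auto simp: f_def binary_vecs_def)
    then have "\<exists>x<?D. \<forall>b<block_size n k. x div 2 ^ b mod 2 = f i b" for i
      by (intro bounded_digits_exist)
    then obtain x where x: "\<And>i. x i < ?D" "\<And>i b. b < block_size n k \<Longrightarrow> bit_of (x i) b = f i b"
      unfolding bit_of_def by metis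
    have "F (\<lambda>j. int (bit_of (x (j mod k)) (j div k))) = F (\<lambda>j. z $ j)"
    proof (rule F_cong)
      fix j assume j: "j < n"
      then have "j < block_size n k * k" using block_size_bounds(1)[OF k, of n] by (simp add: mult.commute)
      then have "j div k < block_size n k" by (rule less_mult_imp_div_less)
      then have "bit_of (x (j mod k)) (j div k) = nat (z $ j)" using x(2) j by (simp add: f_def)
      moreover have "z $ j \<ge> 0" using z(1) j by (auto simp: binary_vecs_def)
      ultimately show "int (bit_of (x (j mod k)) (j div k)) = z $ j" by simp
    qed
    then show "\<exists>x. (\<forall>i<k. x i < ?D) \<and> F (\<lambda>j. int (bit_of (x (j mod k)) (j div k))) \<le> dist_bound I ^ p"
      using z(2) x(1) by (intro exI[of _ x]) simp
  qed
  also have "\<dots> \<longleftrightarrow> (\<exists>z\<in>binary_vecs n. cvp_dist p I z \<le> of_rat (dist_bound I))"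
    unfolding F_def using cvp_dist_le_iff[OF I p0 p(3)] by (auto simp: binary_vecs_def)
  finally show ?thesis .
qed

text \<open>In both problems the NO condition is the negation of the YES condition, so the single
  equivalence settles both directions.\<close>

lemma karp_reduction_reduction:
  assumes p: "2 \<le> p" "p \<le> k" "even p"
  shows "karp_reduction (reduction n k p) (CVP01 p n) (min_weight_clique k p (k * 2 ^ block_size n k))"
proof -
  have inst: "reduction n k p I \<in> clique_instances p (k * 2 ^ block_size n k)" for I
    by (auto simp: clique_instances_def p_uniform_def reduction_def Let_def block_edges_def p_subsets_def)
  show ?thesis
    unfolding karp_reduction_def yes_instances_def no_instances_def CVP01_def min_weight_clique_def fst_conv snd_conv
    using inst reduction_clique_iff[OF _ p] by (auto simp flip: not_le)
qed

section \<open>Output and resources\<close>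

lemma quotient_of_coprimeI:
  assumes "0 < b" "coprime a b"
  shows "quotient_of (of_int a / of_int b) = (a, b)"
  using assms by (simp add: Fract_of_int_quotient[symmetric] quotient_of_Fract normalize_stable)

lemma encode_rat_of_int: "encode_rat (of_int w) = [w, 1]"
  using quotient_of_coprimeI[of 1 w] by (simp add: encode_rat_def)

text \<open>Powers of coprime integers are coprime. Hence the program may raise numerator and
  denominator separately, without computing a greatest common divisor.\<close>

lemma encode_rat_power:
  "encode_rat (d ^ p) = [fst (quotient_of d) ^ p, snd (quotient_of d) ^ p]"
proof -
  obtain a b where q: "quotient_of d = (a, b)" by (cases "quotient_of d")
  have "0 < b" "coprime a b" "d = of_int a / of_int b"
    using quotient_of_denom_pos[OF q] quotient_of_coprime[OF q] quotient_of_div[OF q] by auto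
  then have "quotient_of (d ^ p) = (a ^ p, b ^ p)"
    using quotient_of_coprimeI[of "b ^ p" "a ^ p"] by (simp add: power_divide)
  then show ?thesis by (simp add: encode_rat_def q)
qed

section \<open>Accepted tuples enumerate the hyperedges\<close>

context reduction_run begin

lemma ascending_less:
  assumes "ascending q b" "i < j" "j < b"
  shows "blk q i < blk q j"
  using assms(2,3)
proof (induction j)
  case (Suc j)
  have "blk q j < blk q (Suc j)" using assms(1) Suc.prems by (auto simp: ascending_def)
  moreover have "i = j \<or> blk q i < blk q j" using Suc by (auto simp: less_Suc_eq)
  ultimately show ?case by auto
qed simp

definition edge_of :: "nat \<Rightarrow> nat set" where
  "edge_of q = digit q ` {..<p}"

text \<open>Division by \<open>D\<close> is monotone, so ascending blocks force ascending
  vertices.\<close>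

lemma sorted_edge_of:
  assumes "ascending q p"
  shows "sorted_list_of_set (edge_of q) = map (digit q) [0..<p]"
proof -
  have "strict_mono_on {..<p} (digit q)"
  proof (rule strict_mono_onI)
    fix i j assume "i \<in> {..<p}" "j \<in> {..<p}" "i < j"
    then have "blk q i < blk q j" using ascending_less[OF assms] by simp
    then show "digit q i < digit q j" by (meson div_le_mono leD not_less)
  qed
  then show ?thesis
    unfolding edge_of_def lessThan_atLeast0 by (simp add: sorted_list_of_set_image)
qed

lemma edge_of_mem:
  assumes "ascending q p"
  shows "edge_of q \<in> block_edges p k D"
proof -
  have inj: "inj_on (blk q) {..<p}"
    by (rule inj_onI) (metis ascending_less[OF assms] lessThan_iff linorder_neqE_nat nat_neq_iff)
  then have "inj_on (digit q) {..<p}" "inj_on (\<lambda>v. v div D) (edge_of q)"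
    unfolding edge_of_def by (auto simp: inj_on_def)
  moreover have "edge_of q \<subseteq> {..<k * D}" using digit_less by (auto simp: edge_of_def simp flip: N)
  ultimately show ?thesis
    by (simp add: block_edges_def p_subsets_def edge_of_def card_image)
qed

text \<open>The digits of the required code are the vertices of \<open>e\<close> in increasing
  order. Their block numbers increase weakly, and strictly because the blocks are distinct.\<close>

lemma edge_of_exists:
  assumes "e \<in> block_edges p k D"
  shows "\<exists>q<N ^ p. ascending q p \<and> edge_of q = e"
proof -
  let ?vs = "sorted_list_of_set e"
  have e: "e \<subseteq> {..<N}" "card e = p" "inj_on (\<lambda>v. v div D) e" "finite e"
    using assms finite_subset by (auto simp: block_edges_def p_subsets_def N)
  have nth: "?vs ! j \<in> e" if "j < p" for j
    using nth_mem[of j ?vs] that e by simp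
  then have "\<And>j. j < p \<Longrightarrow> ?vs ! j < N" using e(1) by auto
  then obtain q where q: "q < N ^ p" "\<And>j. j < p \<Longrightarrow> digit q j = ?vs ! j"
    using bounded_digits_exist[of p "\<lambda>j. ?vs ! j" N] unfolding digit_def by blast
  have "ascending q p"
    unfolding ascending_def
  proof (intro allI impI)
    fix j assume j: "Suc j < p"
    have "?vs ! j < ?vs ! Suc j"
      using sorted_wrt_nth_less[OF strict_sorted_list_of_set[of e], of j "Suc j"] j e by simp
    moreover from this have "?vs ! j div D \<noteq> ?vs ! Suc j div D"
      using e(3) nth j by (metis Suc_lessD inj_on_def nat_neq_iff)
    ultimately have "?vs ! j div D < ?vs ! Suc j div D" by (meson div_le_mono le_neq_implies_less less_imp_le)
    then show "blk q j < blk q (Suc j)" using q(2) j by simp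
  qed
  moreover have "edge_of q = e"
  proof -
    have "edge_of q = (\<lambda>j. ?vs ! j) ` {..<length ?vs}" unfolding edge_of_def using q(2) e by simp
    also have "\<dots> = set ?vs" by (auto simp: set_conv_nth)
    finally show ?thesis using e by simp
  qed
  ultimately show ?thesis using q(1) by blast
qed

lemma edge_of_inject:
  assumes "ascending q p" "ascending q' p" "q < N ^ p" "q' < N ^ p" "edge_of q = edge_of q'"
  shows "q = q'"
proof -
  have "map (digit q) [0..<p] = map (digit q') [0..<p]"
    using sorted_edge_of[OF assms(1)] sorted_edge_of[OF assms(2)] assms(5) by simp
  then have "digit q j = digit q' j" if "j < p" for j
    using that by simp
  then show ?thesis
    using digits_inject[OF assms(3,4)] by (simp add: digit_def)
qed

text \<open>Rejected tuples emit nothing, so the output over all codes is the output over the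
  accepted ones, which list every hyperedge once.\<close>

lemma encodes_run_output:
  assumes "encode_rat b = [num ^ p, den ^ p]"
  shows "encodes_clique k p \<lparr>hypergraph = \<lparr>num_verts = N, hyperedges = block_edges p k D,
      weight = \<lambda>e. of_int (edge_weight p m D val ((!) (sorted_list_of_set e)))\<rparr>, weight_bound = b\<rparr> run_output"
proof -
  let ?qs = "filter (\<lambda>q. ascending q p) (rev [0..<N ^ p])"
  let ?w = "\<lambda>e. of_int (edge_weight p m D val ((!) (sorted_list_of_set e))) :: rat"
  have "inj_on edge_of (set ?qs)"
    by (rule inj_onI) (auto intro: edge_of_inject)
  then have "distinct (map edge_of ?qs)" by (simp add: distinct_map)
  moreover have "set (map edge_of ?qs) = block_edges p k D"
    using edge_of_mem edge_of_exists by (auto simp: image_iff)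
  moreover have "edge_list_code = concat (map (\<lambda>e. map int (sorted_list_of_set e) @ encode_rat (?w e)) (map edge_of ?qs))"
  proof -
    have code: "edge_code q = (if ascending q p
      then map int (sorted_list_of_set (edge_of q)) @ encode_rat (?w (edge_of q)) else [])" for q
    proof (cases "ascending q p")
      case True
      have "edge_weight p m D val (digit q) = edge_weight p m D val ((!) (sorted_list_of_set (edge_of q)))"
        by (rule edge_weight_cong) (simp add: sorted_edge_of[OF True])
      then show ?thesis
        using True by (simp add: edge_code_def sorted_edge_of[OF True] encode_rat_of_int)
    qed (simp add: edge_code_def)
    have "concat (map edge_code xs) = concat (map (\<lambda>e. map int (sorted_list_of_set e) @ encode_rat (?w e))
        (map edge_of (filter (\<lambda>q. ascending q p) xs)))" for xs
      by (induction xs) (simp_all add: code)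
    then show ?thesis unfolding edge_list_code_def .
  qed
  ultimately show ?thesis
    unfolding encodes_clique_def
    by (intro exI[of _ "map edge_of ?qs"]) (simp add: run_output_def assms)
qed

text \<open>The cube comes from rows times positions times columns, each at most
  \<open>n + m\<close>. The constant is 32 + 35 + 75: evaluating the terms, handling the tuples, and
  the preparation.\<close>

lemma run_time_bound:
  "run_time \<le> 142 * (n + m) ^ 3 * (N ^ p * 2 ^ p)"
proof -
  define L where "L = n + m"
  define Z where "Z = N ^ p * 2 ^ p"
  have n2: "2 \<le> n" using p pk kn by simp
  have c_le: "c \<le> n" using block_size_le[OF k_pos, of n] by (simp add: c block_size_def)
  have L: "p \<le> L" "n \<le> L" "m \<le> L" "c \<le> L" "2 \<le> L" using pk kn n2 c_le by (auto simp: L_def)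
  have L2: "2 * L \<le> L ^ 2" "4 \<le> L ^ 2"
    using L(5) mult_le_mono[OF L(5) L(5)] by (simp_all add: power2_eq_square)
  have L3: "2 * L ^ 2 \<le> L ^ 3" using L(5) by (simp add: power3_eq_cube power2_eq_square)
  have Z1: "1 \<le> Z" using N_pos by (simp add: Z_def Suc_le_eq)
  have NZ: "N ^ p \<le> Z" by (simp add: Z_def)
  have "p * (n * 10 + 34) + 20 \<le> L * (L * 10 + 34) + 20"
    using L by (intro add_mono mult_le_mono) auto
  also have "\<dots> = 10 * L ^ 2 + 34 * L + 20" by (simp add: power2_eq_square algebra_simps)
  \<comment> \<open>For \<open>L >= 2\<close>, \<open>34 * L\<close> is at most
    \<open>17 * L^2\<close> and 20 is at most \<open>5 * L^2\<close>, and 10 + 17 + 5 = 32.\<close>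
  also have "\<dots> \<le> 32 * L ^ 2" using L2 by linarith
  finally have "m * 2 ^ p * (p * (n * 10 + 34) + 20) \<le> L * 2 ^ p * (32 * L ^ 2)"
    using L by (intro mult_le_mono) auto
  then have "N ^ p * (m * 2 ^ p * (p * (n * 10 + 34) + 20)) \<le> N ^ p * (L * 2 ^ p * (32 * L ^ 2))"
    by (intro mult_le_mono2)
  also have "\<dots> = 32 * L ^ 3 * Z" by (simp add: Z_def power3_eq_cube power2_eq_square ac_simps)
  finally have a: "N ^ p * (m * 2 ^ p * (p * (n * 10 + 34) + 20)) \<le> 32 * L ^ 3 * Z" .
  have "p * 18 + 17 \<le> 35 * L ^ 3" using L L2 L3 by linarith
  then have b: "N ^ p * (p * 18 + 17) \<le> Z * (35 * L ^ 3)" using NZ by (rule mult_le_mono[rotated])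
  have "c * 3 + p * 12 + 60 \<le> 75 * L ^ 3" using L L2 L3 by linarith
  then have d: "(c * 3 + p * 12 + 60) * 1 \<le> 75 * L ^ 3 * Z" using Z1 by (rule mult_le_mono)
  have "run_time = N ^ p * (m * 2 ^ p * (p * (n * 10 + 34) + 20)) + N ^ p * (p * 18 + 17) + (c * 3 + p * 12 + 60)"
    by (simp add: run_time_def distrib_left)
  also have "\<dots> \<le> 32 * L ^ 3 * Z + Z * (35 * L ^ 3) + 75 * L ^ 3 * Z"
    by (intro add_mono a b) (use d in simp)
  also have "\<dots> = 142 * L ^ 3 * Z" by simp
  finally show ?thesis by (simp add: L_def Z_def)
qed

end

text \<open>The rounding in \<open>block_size n k\<close> and the masks cost a factor \<open>4\<close> per vertex, which is absorbed by the
  second factor \<open>k\<close> as soon as \<open>k \<ge> 4\<close>. For \<open>k < 4\<close> the evenness of \<open>p\<close> forces \<open>p = 2\<close>.\<close>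

lemma block_count_bound:
  assumes "2 \<le> k" "even p" "0 < p" "p \<le> k"
  shows "real ((k * 2 ^ block_size n k) ^ p * 2 ^ p) \<le> 4 * (real k ^ 2 * 2 powr (real n / real k)) ^ p"
proof -
  define X where "X = 2 powr (real n / real k)"
  have X: "0 < X" by (simp add: X_def)
  have "k * block_size n k \<le> n + k" using block_size_bounds(2)[of k n] assms by simp
  then have "real (k * block_size n k) \<le> real (n + k)" by (simp only: of_nat_le_iff)
  then have "real (block_size n k) \<le> real n / real k + 1"
    using assms by (simp add: field_simps)
  then have "2 powr real (block_size n k) \<le> 2 powr (real n / real k + 1)" by simp
  then have D: "real (2 ^ block_size n k) \<le> 2 * X" by (simp add: X_def powr_add powr_realpow mult.commute)
  have "real ((k * 2 ^ block_size n k) ^ p * 2 ^ p) = (real k * real (2 ^ block_size n k) * 2) ^ p"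
    by (simp add: power_mult_distrib)
  also have "\<dots> \<le> (real k * (2 * X) * 2) ^ p"
    using D by (intro power_mono mult_right_mono mult_left_mono) auto
  also have "\<dots> = (4 * real k * X) ^ p" by (simp add: ac_simps)
  also have "\<dots> \<le> 4 * (real k ^ 2 * X) ^ p"
  proof (cases "4 \<le> k")
    case True
    then have "4 * real k * X \<le> real k ^ 2 * X"
      using X by (simp add: power2_eq_square)
    then have "(4 * real k * X) ^ p \<le> (real k ^ 2 * X) ^ p" using X by (intro power_mono) auto
    also have "\<dots> \<le> 4 * (real k ^ 2 * X) ^ p" using X by simp
    finally show ?thesis .
  next
    case False
    then have "p < 4" using assms by simp
    then have "p = 2" using assms(2,3) by presburger
    \<comment> \<open>Of the factor \<open>4^2 = 16\<close>, one 4 is absorbed by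
      \<open>k^2 >= 4\<close> and the other is the constant 4 of the bound.\<close>
    moreover have "2 ^ 2 \<le> real k ^ 2" using assms(1) by (intro power_mono) auto
    then have "4 * (real k ^ 2 * X ^ 2) \<le> real k ^ 2 * (real k ^ 2 * X ^ 2)"
      using X by (intro mult_right_mono) auto
    ultimately show ?thesis by (simp add: power_mult_distrib power2_eq_square ac_simps)
  qed
  finally show ?thesis by (simp add: X_def)
qed

section \<open>Memory layout and bit lengths for an encoded instance\<close>

lemma length_concat_uniform: "\<forall>r\<in>set rs. length r = n \<Longrightarrow> length (concat rs) = length rs * n"
  by (induction rs) auto

lemma nth_concat_uniform:
  assumes "\<forall>r\<in>set rs. length r = n" "l < length rs" "j < n"
  shows "concat rs ! (l * n + j) = rs ! l ! j"
  using assms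
proof (induction rs arbitrary: l)
  case (Cons r rs)
  then show ?case by (cases l) (simp_all add: nth_append)
qed simp

lemma encode_cvp_nth:
  assumes dims: "dim_col (basis I) = n" "dim_row (basis I) = m" "dim_vec (target I) = m"
  shows "length (encode_cvp k p I) = 4 + m * n + m + 2"
    "encode_cvp k p I ! 0 = int k" "encode_cvp k p I ! 1 = int p" "encode_cvp k p I ! 2 = int m"
    "encode_cvp k p I ! 3 = int n"
    "\<And>l j. l < m \<Longrightarrow> j < n \<Longrightarrow> encode_cvp k p I ! (4 + l * n + j) = basis I $$ (l, j)"
    "\<And>l. l < m \<Longrightarrow> encode_cvp k p I ! (4 + m * n + l) = target I $ l"
    "encode_cvp k p I ! (4 + m * n + m) = fst (quotient_of (dist_bound I))"
    "encode_cvp k p I ! (4 + m * n + m + 1) = snd (quotient_of (dist_bound I))"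
proof -
  define rs where "rs = map list_of_vec (rows (basis I))"
  have rs: "\<forall>r\<in>set rs. length r = n" "length rs = m" using dims by (auto simp: rs_def rows_def)
  have rs_nth: "rs ! l ! j = basis I $$ (l, j)" if "l < m" "j < n" for l j
    using that dims by (simp add: rs_def list_of_vec_index)
  define cc where "cc = concat rs"
  have cc: "length cc = m * n" "\<And>l j. l < m \<Longrightarrow> j < n \<Longrightarrow> cc ! (l * n + j) = basis I $$ (l, j)"
    using length_concat_uniform[OF rs(1)] nth_concat_uniform[OF rs(1)] rs(2) rs_nth by (simp_all add: cc_def)
  have enc: "encode_cvp k p I = [int k, int p, int m, int n] @ cc @ list_of_vec (target I) @
      [fst (quotient_of (dist_bound I)), snd (quotient_of (dist_bound I))]"
    by (simp add: encode_cvp_def encode_rat_def cc_def rs_def dims)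
  have lt: "l * n + j < m * n" if "l < m" "j < n" for l j
  proof -
    have "l * n + j < Suc l * n" using that by simp
    also have "\<dots> \<le> m * n" using that by (intro mult_le_mono1) simp
    finally show ?thesis .
  qed
  show "encode_cvp k p I ! (4 + l * n + j) = basis I $$ (l, j)" if "l < m" "j < n" for l j
    using cc(2)[OF that] cc(1) lt[OF that] unfolding enc by (simp add: nth_append)
  show "encode_cvp k p I ! (4 + m * n + l) = target I $ l" if "l < m" for l
    using cc(1) that dims unfolding enc by (simp add: nth_append list_of_vec_index)
  show "length (encode_cvp k p I) = 4 + m * n + m + 2"
    "encode_cvp k p I ! 0 = int k" "encode_cvp k p I ! 1 = int p" "encode_cvp k p I ! 2 = int m"
    "encode_cvp k p I ! 3 = int n"
    "encode_cvp k p I ! (4 + m * n + m) = fst (quotient_of (dist_bound I))"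
    "encode_cvp k p I ! (4 + m * n + m + 1) = snd (quotient_of (dist_bound I))"
    unfolding enc by (simp_all add: nth_append cc(1) dims)
qed

lemma mem_init_state_nth: "a < length xs \<Longrightarrow> mem (init_state xs) (int a) = xs ! a"
  by (simp add: init_state_def)

lemma abs_less_max_bit_length:
  assumes "x \<in> set xs"
  shows "\<bar>x\<bar> < 2 ^ max_bit_length xs"
proof -
  have "bit_length x \<le> max_bit_length xs"
    unfolding max_bit_length_def using assms by (intro Max_ge) auto
  then show ?thesis by (simp add: bit_length_le_iff_fits fits_def)
qed

text \<open>With \<open>L = n + m\<close>, the factor 8 leaves room for every demand on the width:
  the additive one is at most \<open>7 * L^2\<close>, and the exponents that bound the weights are
  at most \<open>L + 3 * L^2 * b\<close>. The factor \<open>b\<close> accounts for powers of the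
  input numbers.\<close>

lemma reduction_run_instance:
  assumes I: "I \<in> cvp_instances n" and p: "2 \<le> p" and pk: "p \<le> k" and kn: "k \<le> n"
    and m: "m = dim_row (basis I)" and b: "b = max_bit_length (encode_cvp k p I)"
  shows "reduction_run n k p m (block_size n k) (2 ^ block_size n k) (k * 2 ^ block_size n k)
    (8 * (n + m) ^ 2 * b) (2 ^ b) (\<lambda>l j. basis I $$ (l, j)) (\<lambda>l. target I $ l)
    (fst (quotient_of (dist_bound I))) (snd (quotient_of (dist_bound I))) (mem (init_state (encode_cvp k p I)))"
proof -
  define xs where "xs = encode_cvp k p I"
  define L where "L = n + m"
  define W where "W = 8 * L ^ 2 * b"
  define num where "num = fst (quotient_of (dist_bound I))"
  define den where "den = snd (quotient_of (dist_bound I))"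
  have dims: "dim_col (basis I) = n" "dim_row (basis I) = m" "dim_vec (target I) = m"
    using I m by (auto simp: cvp_instances_def)
  note enc = encode_cvp_nth[OF dims, where k = k and p = p, folded xs_def num_def den_def]
  have memory: "mem (init_state xs) (int a) = xs ! a" if "a < 4 + m * n + m + 2" for a
    using mem_init_state_nth[of a xs] that enc(1) by simp
  have abs: "\<bar>xs ! a\<bar> < 2 ^ b" if "a < 4 + m * n + m + 2" for a
    using abs_less_max_bit_length[of "xs ! a" xs] that enc(1) b by (simp add: xs_def)
  have entry: "4 + l * n + j < 4 + m * n + m + 2" if "l < m" "j < n" for l j
  proof -
    have "l * n + j < Suc l * n" using that by simp
    also have "\<dots> \<le> m * n" using that by (intro mult_le_mono1) simp
    finally show ?thesis by simp
  qed
  \<comment> \<open>The first input cell holds \<open>k >= 2\<close>, so the input contains a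
    nonzero number.\<close>
  have b1: "1 \<le> b"
  proof (rule ccontr)
    assume "\<not> 1 \<le> b"
    then have "b = 0" by simp
    then show False using abs[of 0] enc(2) p pk by simp
  qed
  have c_le: "block_size n k \<le> n" using p pk by (intro block_size_le) simp
  have L: "2 \<le> L" "n \<le> L" "m \<le> L" using p pk kn by (auto simp: L_def)
  have L2: "2 * L \<le> L ^ 2" "4 \<le> L ^ 2" "L ^ 2 \<le> L ^ 2 * b" "m * n \<le> L ^ 2" "n * n \<le> L ^ 2" "b * n \<le> L ^ 2 * b"
  proof -
    show "2 * L \<le> L ^ 2" "4 \<le> L ^ 2"
      using L(1) mult_le_mono[OF L(1) L(1)] by (simp_all add: power2_eq_square)
    show "L ^ 2 \<le> L ^ 2 * b" using b1 by simp
    show "m * n \<le> L ^ 2" "n * n \<le> L ^ 2" using L by (simp_all add: power2_eq_square mult_le_mono)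
    have "n \<le> L ^ 2" using L(2) \<open>2 * L \<le> L ^ 2\<close> by linarith
    then show "b * n \<le> L ^ 2 * b" by (simp add: mult.commute)
  qed
  have less: "x < 2 ^ W" if "x \<le> 2 ^ e" "e < W" for x e :: nat
    using that by (meson less_le_trans le_less_trans one_less_numeral_iff power_strict_increasing semiring_norm(76))
  have n2: "n \<le> 2 ^ n" "n + 1 \<le> 2 ^ n" "m \<le> 2 ^ m"
    using less_exp[of n] less_exp[of m] by (auto simp: Suc_le_eq)
  \<comment> \<open>The factors \<open>p\<close>, \<open>n + 1\<close> and the entry bound take at
    most \<open>n\<close>, \<open>n\<close> and \<open>b\<close> bits, and the exponent
    \<open>p\<close> is at most \<open>n\<close>.\<close>
  have S: "(p * ((n + 1) * 2 ^ b)) ^ p \<le> 2 ^ ((2 * n + b) * n)"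
  proof -
    have "p * ((n + 1) * 2 ^ b) \<le> 2 ^ n * (2 ^ n * 2 ^ b)"
      using n2 pk kn by (intro mult_le_mono) auto
    also have "\<dots> = 2 ^ (2 * n + b)" by (simp add: power_add mult_2)
    finally have "(p * ((n + 1) * 2 ^ b)) ^ p \<le> (2 ^ (2 * n + b)) ^ p" by (rule power_mono) simp
    also have "\<dots> \<le> (2 ^ (2 * n + b)) ^ n" using pk kn by (intro power_increasing) auto
    finally show ?thesis by (simp only: power_mult)
  qed
  have eS: "(2 * n + b) * n \<le> 3 * (L ^ 2 * b)"
  proof -
    have "(2 * n + b) * n = 2 * (n * n) + b * n" by (simp add: algebra_simps)
    then show ?thesis using L2 by linarith
  qed
  have mp: "m * 2 ^ p \<le> 2 ^ L"
  proof -
    have "m * 2 ^ p \<le> 2 ^ m * 2 ^ n" using n2 pk kn by (intro mult_le_mono power_increasing) auto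
    then show ?thesis by (simp add: L_def power_add mult.commute)
  qed
  have W: "W = 8 * (L ^ 2 * b)" by (simp add: W_def)
  have N: "(k * 2 ^ block_size n k) ^ p \<le> 2 ^ (2 * (n * n))"
  proof -
    have "k * 2 ^ block_size n k \<le> 2 ^ n * 2 ^ n"
      using n2 kn c_le by (intro mult_le_mono power_increasing) auto
    also have "\<dots> = 2 ^ (2 * n)" by (simp add: mult_2 power_add)
    finally have "(k * 2 ^ block_size n k) ^ p \<le> (2 ^ (2 * n)) ^ p" by (rule power_mono) simp
    also have "\<dots> \<le> (2 ^ (2 * n)) ^ n" using pk kn by (intro power_increasing) auto
    also have "\<dots> = 2 ^ (2 * (n * n))" by (simp only: power_mult[symmetric] mult.assoc)
    finally show ?thesis .
  qed
  have bound: "fits W (y ^ i)" if "\<bar>y\<bar> < 2 ^ b" "i \<le> p" for y i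
  proof -
    have "\<bar>y ^ i\<bar> \<le> (2 ^ b) ^ i" unfolding power_abs using that by (intro power_mono) auto
    also have "\<dots> \<le> (2 ^ b) ^ n" using that pk kn by (intro power_increasing) auto
    also have "\<dots> = 2 ^ (b * n)" by (simp only: power_mult)
    also have "\<dots> < 2 ^ W" using L2 b1 W by (intro power_strict_increasing) linarith+
    finally show ?thesis by (simp add: fits_def)
  qed
  have "reduction_run n k p m (block_size n k) (2 ^ block_size n k) (k * 2 ^ block_size n k)
    W (2 ^ b) (\<lambda>l j. basis I $$ (l, j)) (\<lambda>l. target I $ l) num den (mem (init_state xs))"
  proof
    show "mem (init_state xs) 0 = int k" "mem (init_state xs) 1 = int p" "mem (init_state xs) 2 = int m"
      "mem (init_state xs) 3 = int n"
      using memory[of 0] memory[of 1] memory[of 2] memory[of 3] enc by simp_all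
    show "mem (init_state xs) (int (4 + l * n + j)) = basis I $$ (l, j)" if "l < m" "j < n" for l j
      unfolding memory[OF entry[OF that]] using enc(6) that .
    show "mem (init_state xs) (int (4 + m * n + l)) = target I $ l" if "l < m" for l
      using memory[of "4 + m * n + l"] enc(7)[OF that] that by (simp only: add_less_mono)
    show "mem (init_state xs) (int (4 + m * n + m)) = num"
      "mem (init_state xs) (int (4 + m * n + m + 1)) = den"
      using memory[of "4 + m * n + m"] memory[of "4 + m * n + m + 1"] enc(8,9) by simp_all
    show "\<bar>basis I $$ (l, j)\<bar> \<le> int (2 ^ b)" if "l < m" "j < n" for l j
      using abs[OF entry[OF that]] enc(6)[OF that] by simp
    show "\<bar>target I $ l\<bar> \<le> int (2 ^ b)" if "l < m" for l
      using abs[of "4 + m * n + l"] enc(7)[OF that] that by simp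
    show "fits W (num ^ i)" if "i \<le> p" for i
      using abs[of "4 + m * n + m"] enc(8) that by (intro bound) simp_all
    show "fits W (den ^ i)" if "i \<le> p" for i
      using abs[of "4 + m * n + m + 1"] enc(9) that by (intro bound) simp_all
    have "m * n + 2 * m + 2 * n + 20 \<le> 8 * (L ^ 2 * b)"
      using L2 L_def by linarith
    then show "m * n + 2 * m + 2 * n + 20 < 2 ^ W"
      unfolding W by (rule le_less_trans[OF _ less_exp])
    show "(k * 2 ^ block_size n k) ^ p < 2 ^ W"
      by (rule less[OF N]) (use L2 b1 W in linarith)
    show "m * 2 ^ p < 2 ^ W"
      by (rule less[OF mp]) (use L2 b1 W in linarith)
    show "(p * ((n + 1) * 2 ^ b)) ^ p < 2 ^ W"
      by (rule less[OF S]) (use L2 b1 W eS in linarith)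
    have "m * 2 ^ p * (p * ((n + 1) * 2 ^ b)) ^ p \<le> 2 ^ (L + (2 * n + b) * n)"
      unfolding power_add by (rule mult_le_mono[OF mp S])
    then show "m * 2 ^ p * (p * ((n + 1) * 2 ^ b)) ^ p < 2 ^ W"
      by (rule less) (use L2 b1 W eS in linarith)
  qed (use p pk kn in \<open>simp_all add: block_size_def\<close>)
  then show ?thesis by (simp add: xs_def num_def den_def W_def L_def)
qed

theorem theorem5p2:
  shows "\<exists>(f :: nat \<Rightarrow> nat \<Rightarrow> nat \<Rightarrow> cvp_instance \<Rightarrow> clique_instance) (P :: com) (C :: nat) (a :: nat).
    \<forall>n k p :: nat. n > 0 \<and> k \<ge> 2 \<and> p > 0 \<and> even p \<and> p \<le> k \<and> k \<le> n \<longrightarrow>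
      karp_reduction (f n k p) (CVP01 p n)
        (min_weight_clique k p (k * 2 ^ nat \<lceil>real n / real k\<rceil>)) \<and>
      (\<forall>I \<in> instances (CVP01 p n). \<exists>ys.
        let m = dim_row (basis I);
            poly = real C * real (n + m) ^ a;
            bound = poly * (real k ^ 2 * 2 powr (real n / real k)) ^ p
        in encodes_clique k p (f n k p I) ys \<and>
           halts_within P (encode_cvp k p I) bound bound
             (poly * real (max_bit_length (encode_cvp k p I))) ys)"
proof (rule exI[of _ reduction], rule exI[of _ reduction_prog], rule exI[of _ 568], rule exI[of _ 3],
    intro allI impI conjI ballI)
  fix n k p :: nat
  assume *: "n > 0 \<and> k \<ge> 2 \<and> p > 0 \<and> even p \<and> p \<le> k \<and> k \<le> n"
  then have p: "2 \<le> p" "p \<le> k" "even p" "k \<le> n" by (auto elim!: evenE)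
  have c: "nat \<lceil>real n / real k\<rceil> = block_size n k" using * by (intro nat_ceiling_divide) simp
  show "karp_reduction (reduction n k p) (CVP01 p n) (min_weight_clique k p (k * 2 ^ nat \<lceil>real n / real k\<rceil>))"
    unfolding c using p by (intro karp_reduction_reduction)
  fix I assume "I \<in> instances (CVP01 p n)"
  then have I: "I \<in> cvp_instances n"
    by (auto simp: instances_def yes_instances_def no_instances_def CVP01_def)
  define m where "m = dim_row (basis I)"
  define b where "b = max_bit_length (encode_cvp k p I)"
  define X where "X = (real k ^ 2 * 2 powr (real n / real k)) ^ p"
  interpret reduction_run n k p m "block_size n k" "2 ^ block_size n k" "k * 2 ^ block_size n k"
    "8 * (n + m) ^ 2 * b" "2 ^ b" "\<lambda>l j. basis I $$ (l, j)" "\<lambda>l. target I $ l"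
    "fst (quotient_of (dist_bound I))" "snd (quotient_of (dist_bound I))" "mem (init_state (encode_cvp k p I))"
    by (rule reduction_run_instance[OF I p(1,2,4) m_def b_def])
  have "encodes_clique k p (reduction n k p I) run_output"
    using encodes_run_output[OF encode_rat_power] unfolding reduction_def Let_def instance_value_def m_def .
  moreover have "halts_within reduction_prog (encode_cvp k p I) (real 568 * real (n + m) ^ 3 * X)
    (real 568 * real (n + m) ^ 3 * X) (real 568 * real (n + m) ^ 3 * real b) run_output"
  proof (rule halts_within_if_wp[OF wp_reduction])
    have "real run_time \<le> real (142 * (n + m) ^ 3 * ((k * 2 ^ block_size n k) ^ p * 2 ^ p))"
      using run_time_bound by (simp only: of_nat_le_iff)
    also have "\<dots> = 142 * real (n + m) ^ 3 * real ((k * 2 ^ block_size n k) ^ p * 2 ^ p)" by simp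
    \<comment> \<open>The factor 4 pays for rounding and masks when \<open>p = 2\<close>; together
      with 142 it gives the constant 568.\<close>
    also have "\<dots> \<le> 142 * real (n + m) ^ 3 * (4 * X)"
      unfolding X_def using * by (intro mult_left_mono block_count_bound) auto
    finally show "real run_time \<le> real 568 * real (n + m) ^ 3 * X" by simp
    \<comment> \<open>The width needs only \<open>8 * (n + m)^2\<close>, but it is stated with the
      same polynomial as the time.\<close>
    have "(n + m) ^ 2 \<le> (n + m) ^ 3" using * by (intro power_increasing) auto
    then have "8 * (n + m) ^ 2 * b \<le> 568 * (n + m) ^ 3 * b" by (intro mult_le_mono) auto
    then have "real (8 * (n + m) ^ 2 * b) \<le> real (568 * (n + m) ^ 3 * b)" by (simp only: of_nat_le_iff)
    then show "real (8 * (n + m) ^ 2 * b) \<le> real 568 * real (n + m) ^ 3 * real b" by simp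
  qed
  ultimately show "\<exists>ys.
        let m = dim_row (basis I);
            poly = real 568 * real (n + m) ^ 3;
            bound = poly * (real k ^ 2 * 2 powr (real n / real k)) ^ p
        in encodes_clique k p (reduction n k p I) ys \<and>
           halts_within reduction_prog (encode_cvp k p I) bound bound
             (poly * real (max_bit_length (encode_cvp k p I))) ys"
    unfolding Let_def m_def X_def b_def by blast
qed

end
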